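(* Let $(\mathcal V,\otimes,\mathbf 1)$ be a monoidal category such that $\mathcal V$ is cocomplete and $\otimes$ is cocontinuous in each argument (i.e. $A\otimes-$ and $-\otimes B$ preserve small colimits for all $A,B\in\mathcal V$). Let $F\colon\mathcal I\to\mathrm{Cat}_{\mathcal V}$ be a small diagram. Then the $\mathcal V$-enriched category $\operatorname{colim}_*(\mathbb S_F)$ (defined in the context) is a colimit of $F$ in $\mathrm{Cat}_{\mathcal V}$.
   Context: $\mathrm{Cat}_{\mathcal V}$ is the category of small $\mathcal V$-enriched categories and $\mathcal V$-enriched functors; composition in an enriched category $\mathcal C$ is $\circ\colon\mathcal C(b,c)\otimes\mathcal C(a,b)\to\mathcal C(a,c)$ and unit maps are $j_a\colon\mathbf 1\to\mathcal C(a,a)$. $\mathrm{Ob}\colon\mathrm{Cat}_{\mathcal V}\to\mathrm{Set}$ is the object-set functor. Iterated tensor products are left-associated. For $x\in \mathrm{Ob}(F(i))$, $[x]$ denotes its class in $\operatorname{colim}(\mathrm{Ob}\circ F)$. **Edges.** An $F$-edge is a triple $(i,x,y)$ with $i\in\mathcal I$, $x,y\in F(i)$; a morphism of $F$-edges $(i,x,y)\to(i',x',y')$ is a morphism $f\colon i\to i'$ of $\mathcal I$ with $(Ff)(x)=x'$, $(Ff)(y)=y'$. **Category of strings.** For $a,b\in\operatorname{colim}(\mathrm{Ob}\circ F)$, the category $\mathcal S_F(a,b)$ has as objects the $F$-strings $[e_n,\dots,e_1]$, $n\ge 1$, of $F$-edges $e_k=(i_k,x_k,y_k)$ with $[x_1]=a$,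 $[y_n]=b$, $[y_{k-1}]=[x_k]$; if $a=b$ there is also the empty string $\varnothing_a=[\,]$. Concatenation of $t\in\mathcal S_F(b,c)$ and $s\in\mathcal S_F(a,b)$ is $t\star s$ ($t$ written to the left of $s$). Morphisms are generated by: transports $[\dots,f,\dots]\colon[\dots,e,\dots]\to[\dots,e',\dots]$ for a morphism of edges $f\colon e\to e'$; contractions $[\dots,(i,y,z),(i,x,y),\dots]\to[\dots,(i,x,z),\dots]$; unit insertions, which insert an edge $(i,x,x)$ at a position of the string where the endpoints match in $\operatorname{colim}(\mathrm{Ob}\circ F)$ (including $\varnothing_a\to[(i,x,x)]$ for $[x]=a$). These are subject to the interchange relation $(\beta\star\mathrm{id}_{s'})\circ(\mathrm{id}_t\star\alpha)=(\mathrm{id}_{t'}\star\alpha)\circ(\beta\star\mathrm{id}_s)$ for generators $\alpha\colon s\to s'$ and $\beta\colon t\to t'$, where a generator concatenated with an identity is the same generator applied inside the longer string. Thus $\star_{a,b,c}\colon\mathcal S_F(b,c)\times\mathcal S_F(a,b)\to\mathcal S_F(a,c)$ is a functor. **String evaluation.** The functor $\mathrm{ev}^F_{a,b}\colon\mathcal S_F(a,b)\to\mathcal V$ sends $[(i_n,x_n,y_n),\dots,(i_1,x_1,y_1)]$ to $F(i_n)(x_n,y_n)\otimes\cdots\otimes F(i_1)(x_1,y_1)$ and $\varnothing_a\mapsto\mathbf 1$. It sends transports to the tensor product of the maps on hom-objects given by the functors $Ff$ (identities on the other factors), contractions to the composition $\circ\colon F(i)(y,z)\otimes F(i)(x,y)\to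 F(i)(x,z)$ on the relevant factors, and unit insertions to the inverse unitor followed by $j_x\colon\mathbf 1\to F(i)(x,x)$ on the new factor (up to canonical reassociation). **$\theta$.** There are natural isomorphisms $\theta_{a,b,c}$ with components $\mathrm{ev}^F_{b,c}(t)\otimes\mathrm{ev}^F_{a,b}(s)\cong\mathrm{ev}^F_{a,c}(t\star s)$, given by iterated associators if $t,s$ are non-empty, by the left unitor if $t$ is empty and by the right unitor if $s$ is empty. **The enriched category $\operatorname{colim}_*(\mathbb S_F)$.** Objects are the elements of $\operatorname{colim}(\mathrm{Ob}\circ F)$. Hom-objects are $\operatorname{colim}_{\mathcal S_F(a,b)}\mathrm{ev}^F_{a,b}$, with colimiting cocone denoted $\kappa^{a,b}$. Composition is the composite $$\operatorname{colim}\mathrm{ev}^F_{b,c}\otimes\operatorname{colim}\mathrm{ev}^F_{a,b}\;\overset{\mu}{\cong}\;\operatorname{colim}_{(t,s)\in\mathcal S_F(b,c)\times\mathcal S_F(a,b)}\big(\mathrm{ev}^F_{b,c}(t)\otimes\mathrm{ev}^F_{a,b}(s)\big)\longrightarrow\operatorname{colim}\mathrm{ev}^F_{a,c},$$ where $\mu^{-1}$ is the map induced by the cocone $\kappa^{b,c}_t\otimes\kappa^{a,b}_s$ (an isomorphism since $\otimes$ is cocontinuous in each argument) and the second map is induced by the cocone with components $\kappa^{a,c}_{t\star s}\circ\theta_{t,s}$. The unit map $\mathbf 1\to\operatorname{colim}\mathrm{ev}^F_{a,a}$ is the cocone component $\kappa^{a,a}_{\varnothing_a}$. *)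

theory Defs
  imports Main
begin

unbundle cardinal_syntax

section \<open>Categories, functors and colimits\<close>

record ('o, 'm) cat =
  Obj :: "'o set"
  Arr :: "'m set"
  Dom :: "'m \<Rightarrow> 'o"
  Cod :: "'m \<Rightarrow> 'o"
  Ide :: "'o \<Rightarrow> 'm"
  Cmp :: "'m \<Rightarrow> 'm \<Rightarrow> 'm"  (infixr "\<cdot>\<index>" 75)

definition in_hom :: "('o, 'm, 'z) cat_scheme \<Rightarrow> 'm \<Rightarrow> 'o \<Rightarrow> 'o \<Rightarrow> bool" where
  "in_hom C f a b \<longleftrightarrow> f \<in> Arr C \<and> Dom C f = a \<and> Cod C f = b"

locale category =
  fixes C :: "('o, 'm, 'z) cat_scheme" (structure)
  assumes Dom_in: "f \<in> Arr C \<Longrightarrow> Dom C f \<in> Obj C"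
    and Cod_in: "f \<in> Arr C \<Longrightarrow> Cod C f \<in> Obj C"
    and Ide_in_hom: "a \<in> Obj C \<Longrightarrow> in_hom C (Ide C a) a a"
    and Cmp_in_hom: "in_hom C f a b \<Longrightarrow> in_hom C g b c \<Longrightarrow> in_hom C (g \<cdot> f) a c"
    and Ide_left: "in_hom C f a b \<Longrightarrow> Ide C b \<cdot> f = f"
    and Ide_right: "in_hom C f a b \<Longrightarrow> f \<cdot> Ide C a = f"
    and Cmp_assoc: "in_hom C f a b \<Longrightarrow> in_hom C g b c \<Longrightarrow> in_hom C h c d
                    \<Longrightarrow> (h \<cdot> g) \<cdot> f = h \<cdot> (g \<cdot> f)"

definition inverse_of :: "('o, 'm, 'z) cat_scheme \<Rightarrow> 'm \<Rightarrow> 'm \<Rightarrow> bool" where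
  "inverse_of C f g \<longleftrightarrow> in_hom C g (Cod C f) (Dom C f)
     \<and> g \<cdot>\<^bsub>C\<^esub> f = Ide C (Dom C f) \<and> f \<cdot>\<^bsub>C\<^esub> g = Ide C (Cod C f)"

definition is_iso :: "('o, 'm, 'z) cat_scheme \<Rightarrow> 'm \<Rightarrow> bool" where
  "is_iso C f \<longleftrightarrow> f \<in> Arr C \<and> (\<exists>g. inverse_of C f g)"

definition inv_arr :: "('o, 'm, 'z) cat_scheme \<Rightarrow> 'm \<Rightarrow> 'm" where
  "inv_arr C f = (THE g. inverse_of C f g)"

record ('i, 'k, 'o, 'm) func =
  FObj :: "'i \<Rightarrow> 'o"
  FArr :: "'k \<Rightarrow> 'm"

definition is_functor ::
  "('i, 'k, 'y) cat_scheme \<Rightarrow> ('o, 'm, 'z) cat_scheme \<Rightarrow> ('i, 'k, 'o, 'm) func \<Rightarrow> bool" where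
  "is_functor J C D \<longleftrightarrow>
     (\<forall>j\<in>Obj J. FObj D j \<in> Obj C) \<and>
     (\<forall>f\<in>Arr J. in_hom C (FArr D f) (FObj D (Dom J f)) (FObj D (Cod J f))) \<and>
     (\<forall>j\<in>Obj J. FArr D (Ide J j) = Ide C (FObj D j)) \<and>
     (\<forall>f\<in>Arr J. \<forall>g\<in>Arr J. Cod J f = Dom J g \<longrightarrow>
        FArr D (g \<cdot>\<^bsub>J\<^esub> f) = FArr D g \<cdot>\<^bsub>C\<^esub> FArr D f)"

definition func_comp ::
  "('o, 'm, 'p, 'n) func \<Rightarrow> ('i, 'k, 'o, 'm) func \<Rightarrow> ('i, 'k, 'p, 'n) func" where
  "func_comp G D = \<lparr> FObj = \<lambda>j. FObj G (FObj D j), FArr = \<lambda>f. FArr G (FArr D f) \<rparr>"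

definition prod_cat :: "('i, 'k) cat \<Rightarrow> ('j, 'l) cat \<Rightarrow> ('i \<times> 'j, 'k \<times> 'l) cat" where
  "prod_cat J K = \<lparr> Obj = Obj J \<times> Obj K, Arr = Arr J \<times> Arr K,
     Dom = map_prod (Dom J) (Dom K), Cod = map_prod (Cod J) (Cod K),
     Ide = map_prod (Ide J) (Ide K),
     Cmp = \<lambda>(g, g') (f, f'). (g \<cdot>\<^bsub>J\<^esub> f, g' \<cdot>\<^bsub>K\<^esub> f') \<rparr>"

definition is_cocone ::
  "('i, 'k, 'y) cat_scheme \<Rightarrow> ('o, 'm, 'z) cat_scheme \<Rightarrow> ('i, 'k, 'o, 'm) func
   \<Rightarrow> 'o \<Rightarrow> ('i \<Rightarrow> 'm) \<Rightarrow> bool" where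
  "is_cocone J C D c \<iota> \<longleftrightarrow> c \<in> Obj C \<and>
     (\<forall>j\<in>Obj J. in_hom C (\<iota> j) (FObj D j) c) \<and>
     (\<forall>f\<in>Arr J. \<iota> (Cod J f) \<cdot>\<^bsub>C\<^esub> FArr D f = \<iota> (Dom J f))"

definition is_colimit_cocone ::
  "('i, 'k, 'y) cat_scheme \<Rightarrow> ('o, 'm, 'z) cat_scheme \<Rightarrow> ('i, 'k, 'o, 'm) func
   \<Rightarrow> 'o \<Rightarrow> ('i \<Rightarrow> 'm) \<Rightarrow> bool" where
  "is_colimit_cocone J C D c \<iota> \<longleftrightarrow> is_cocone J C D c \<iota> \<and>
     (\<forall>d \<delta>. is_cocone J C D d \<delta> \<longrightarrow>
        (\<exists>!h. in_hom C h c d \<and> (\<forall>j\<in>Obj J. h \<cdot>\<^bsub>C\<^esub> \<iota> j = \<delta> j)))"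

definition is_colimit ::
  "('i, 'k, 'y) cat_scheme \<Rightarrow> ('o, 'm, 'z) cat_scheme \<Rightarrow> ('i, 'k, 'o, 'm) func \<Rightarrow> 'o \<Rightarrow> bool" where
  "is_colimit J C D c \<longleftrightarrow> (\<exists>\<iota>. is_colimit_cocone J C D c \<iota>)"

text \<open>A chosen colimit, meaningful whenever some colimit exists.\<close>

definition colim ::
  "('i, 'k, 'y) cat_scheme \<Rightarrow> ('o, 'm, 'z) cat_scheme \<Rightarrow> ('i, 'k, 'o, 'm) func
   \<Rightarrow> 'o \<times> ('i \<Rightarrow> 'm)" where
  "colim J C D = (SOME (c, \<iota>). is_colimit_cocone J C D c \<iota>)"

abbreviation "colim_obj J C D \<equiv> fst (colim J C D)"
abbreviation "colim_leg J C D \<equiv> snd (colim J C D)"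

definition colim_map ::
  "('i, 'k, 'y) cat_scheme \<Rightarrow> ('o, 'm, 'z) cat_scheme \<Rightarrow> ('i, 'k, 'o, 'm) func
   \<Rightarrow> 'o \<Rightarrow> ('i \<Rightarrow> 'm) \<Rightarrow> 'm" where
  "colim_map J C D d \<delta> = (THE h. in_hom C h (colim_obj J C D) d
     \<and> (\<forall>j\<in>Obj J. h \<cdot>\<^bsub>C\<^esub> colim_leg J C D j = \<delta> j))"


section \<open>Smallness\<close>

text \<open>
  HOL has no universe of sets, so ``small'' is taken relative to an arbitrary uncountable
  regular cardinal \<open>\<kappa>\<close>: a set is small iff its cardinality is less than \<open>\<kappa>\<close>. The small sets of
  a Grothendieck universe are the case where \<open>\<kappa>\<close> is in addition a strong limit.
  Since \<open>\<kappa>\<close> is an order on a subset of \<^typ>\<open>'u\<close>, every small set is in bijection with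
  a set of elements of \<^typ>\<open>'u\<close>. It therefore loses nothing to let diagram shapes in the
  definition of cocompleteness, and object sets of enriched categories, consist of elements
  of \<^typ>\<open>'u\<close>.
\<close>

definition size_bound :: "'u rel \<Rightarrow> bool" where
  "size_bound \<kappa> \<longleftrightarrow> Card_order \<kappa> \<and> regularCard \<kappa> \<and> natLeq <o \<kappa>"

definition small :: "'u rel \<Rightarrow> 'a set \<Rightarrow> bool" where
  "small \<kappa> A \<longleftrightarrow> |A| <o \<kappa>"

definition small_category :: "'u rel \<Rightarrow> ('i, 'k, 'y) cat_scheme \<Rightarrow> bool" where
  "small_category \<kappa> J \<longleftrightarrow> category J \<and> small \<kappa> (Obj J) \<and> small \<kappa> (Arr J)"

definition cocomplete :: "'u rel \<Rightarrow> ('o, 'm, 'z) cat_scheme \<Rightarrow> bool" where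
  "cocomplete \<kappa> C \<longleftrightarrow>
     (\<forall>(J :: ('u, 'u) cat) D. small_category \<kappa> J \<and> is_functor J C D \<longrightarrow> (\<exists>c. is_colimit J C D c))"

definition preserves_small_colimits ::
  "'u rel \<Rightarrow> ('o, 'm, 'y) cat_scheme \<Rightarrow> ('p, 'n, 'z) cat_scheme \<Rightarrow> ('o, 'm, 'p, 'n) func \<Rightarrow> bool" where
  "preserves_small_colimits \<kappa> C E T \<longleftrightarrow>
     (\<forall>(J :: ('u, 'u) cat) D c \<iota>.
        small_category \<kappa> J \<and> is_functor J C D \<and> is_colimit_cocone J C D c \<iota> \<longrightarrow>
        is_colimit_cocone J E (func_comp T D) (FObj T c) (\<lambda>j. FArr T (\<iota> j)))"


section \<open>The category of small sets\<close>

text \<open>An arrow is a function that is undefined outside its domain.\<close>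

record 'u set_map =
  SDom :: "'u set"
  SCod :: "'u set"
  SFun :: "'u \<Rightarrow> 'u"

definition SetC :: "'u rel \<Rightarrow> ('u set, 'u set_map) cat" where
  "SetC \<kappa> = \<lparr>
     Obj = {A. small \<kappa> A},
     Arr = {f. small \<kappa> (SDom f) \<and> small \<kappa> (SCod f) \<and> SFun f ` SDom f \<subseteq> SCod f
               \<and> (\<forall>x. x \<notin> SDom f \<longrightarrow> SFun f x = undefined)},
     Dom = SDom, Cod = SCod,
     Ide = \<lambda>A. \<lparr> SDom = A, SCod = A, SFun = \<lambda>x. if x \<in> A then x else undefined \<rparr>,
     Cmp = \<lambda>g f. \<lparr> SDom = SDom f, SCod = SCod g,
                    SFun = \<lambda>x. if x \<in> SDom f then SFun g (SFun f x) else undefined \<rparr> \<rparr>"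


section \<open>Monoidal categories\<close>

record ('o, 'm) mcat = "('o, 'm) cat" +
  Ten  :: "'o \<Rightarrow> 'o \<Rightarrow> 'o"  (infixl "\<otimes>\<index>" 80)
  TenA :: "'m \<Rightarrow> 'm \<Rightarrow> 'm"  (infixl "\<boxtimes>\<index>" 80)
  Unt  :: "'o"
  Asc  :: "'o \<Rightarrow> 'o \<Rightarrow> 'o \<Rightarrow> 'm"
  LUn  :: "'o \<Rightarrow> 'm"
  RUn  :: "'o \<Rightarrow> 'm"

locale monoidal_category = category V
  for V :: "('o, 'm) mcat" (structure) +
  assumes Ten_in: "A \<in> Obj V \<Longrightarrow> B \<in> Obj V \<Longrightarrow> A \<otimes> B \<in> Obj V"
    and TenA_in_hom: "in_hom V f A A' \<Longrightarrow> in_hom V g B B'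
                      \<Longrightarrow> in_hom V (f \<boxtimes> g) (A \<otimes> B) (A' \<otimes> B')"
    and TenA_Ide: "A \<in> Obj V \<Longrightarrow> B \<in> Obj V \<Longrightarrow> Ide V A \<boxtimes> Ide V B = Ide V (A \<otimes> B)"
    and TenA_Cmp: "in_hom V f A A' \<Longrightarrow> in_hom V f' A' A'' \<Longrightarrow> in_hom V g B B' \<Longrightarrow> in_hom V g' B' B''
                   \<Longrightarrow> (f' \<cdot> f) \<boxtimes> (g' \<cdot> g) = (f' \<boxtimes> g') \<cdot> (f \<boxtimes> g)"
    and Unt_in: "Unt V \<in> Obj V"
    and Asc_in_hom: "A \<in> Obj V \<Longrightarrow> B \<in> Obj V \<Longrightarrow> D \<in> Obj V
                     \<Longrightarrow> in_hom V (Asc V A B D) ((A \<otimes> B) \<otimes> D) (A \<otimes> (B \<otimes> D))"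
    and Asc_iso: "A \<in> Obj V \<Longrightarrow> B \<in> Obj V \<Longrightarrow> D \<in> Obj V \<Longrightarrow> is_iso V (Asc V A B D)"
    and Asc_natural: "in_hom V f A A' \<Longrightarrow> in_hom V g B B' \<Longrightarrow> in_hom V h D D'
                      \<Longrightarrow> Asc V A' B' D' \<cdot> ((f \<boxtimes> g) \<boxtimes> h) = (f \<boxtimes> (g \<boxtimes> h)) \<cdot> Asc V A B D"
    and LUn_in_hom: "A \<in> Obj V \<Longrightarrow> in_hom V (LUn V A) (Unt V \<otimes> A) A"
    and LUn_iso: "A \<in> Obj V \<Longrightarrow> is_iso V (LUn V A)"
    and LUn_natural: "in_hom V f A A' \<Longrightarrow> LUn V A' \<cdot> (Ide V (Unt V) \<boxtimes> f) = f \<cdot> LUn V A"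
    and RUn_in_hom: "A \<in> Obj V \<Longrightarrow> in_hom V (RUn V A) (A \<otimes> Unt V) A"
    and RUn_iso: "A \<in> Obj V \<Longrightarrow> is_iso V (RUn V A)"
    and RUn_natural: "in_hom V f A A' \<Longrightarrow> RUn V A' \<cdot> (f \<boxtimes> Ide V (Unt V)) = f \<cdot> RUn V A"
    and pentagon: "A \<in> Obj V \<Longrightarrow> B \<in> Obj V \<Longrightarrow> D \<in> Obj V \<Longrightarrow> E \<in> Obj V \<Longrightarrow>
        (Ide V A \<boxtimes> Asc V B D E) \<cdot> (Asc V A (B \<otimes> D) E \<cdot> (Asc V A B D \<boxtimes> Ide V E))
        = Asc V A B (D \<otimes> E) \<cdot> Asc V (A \<otimes> B) D E"
    and triangle: "A \<in> Obj V \<Longrightarrow> B \<in> Obj V \<Longrightarrow>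
        (Ide V A \<boxtimes> LUn V B) \<cdot> Asc V A (Unt V) B = RUn V A \<boxtimes> Ide V B"

definition tensor_left :: "('o, 'm) mcat \<Rightarrow> 'o \<Rightarrow> ('o, 'm, 'o, 'm) func" where
  "tensor_left V A = \<lparr> FObj = \<lambda>X. A \<otimes>\<^bsub>V\<^esub> X, FArr = \<lambda>f. Ide V A \<boxtimes>\<^bsub>V\<^esub> f \<rparr>"

definition tensor_right :: "('o, 'm) mcat \<Rightarrow> 'o \<Rightarrow> ('o, 'm, 'o, 'm) func" where
  "tensor_right V B = \<lparr> FObj = \<lambda>X. X \<otimes>\<^bsub>V\<^esub> B, FArr = \<lambda>f. f \<boxtimes>\<^bsub>V\<^esub> Ide V B \<rparr>"

definition tensor_cocontinuous :: "'u rel \<Rightarrow> ('o, 'm) mcat \<Rightarrow> bool" where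
  "tensor_cocontinuous \<kappa> V \<longleftrightarrow>
     (\<forall>A\<in>Obj V. preserves_small_colimits \<kappa> V V (tensor_left V A)) \<and>
     (\<forall>B\<in>Obj V. preserves_small_colimits \<kappa> V V (tensor_right V B))"


section \<open>Enriched categories\<close>

record ('u, 'o, 'm) vcat =
  vobj  :: "'u set"
  vhom  :: "'u \<Rightarrow> 'u \<Rightarrow> 'o"
  vcomp :: "'u \<Rightarrow> 'u \<Rightarrow> 'u \<Rightarrow> 'm"  \<comment> \<open>\<open>vcomp C a b c : C(b,c) \<otimes> C(a,b) \<rightarrow> C(a,c)\<close>\<close>
  vunit :: "'u \<Rightarrow> 'm"

locale enriched_category =
  fixes V :: "('o, 'm) mcat" (structure) and C :: "('u, 'o, 'm) vcat"
  assumes vhom_in: "a \<in> vobj C \<Longrightarrow> b \<in> vobj C \<Longrightarrow> vhom C a b \<in> Obj V"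
    and vcomp_in_hom: "a \<in> vobj C \<Longrightarrow> b \<in> vobj C \<Longrightarrow> c \<in> vobj C
          \<Longrightarrow> in_hom V (vcomp C a b c) (vhom C b c \<otimes> vhom C a b) (vhom C a c)"
    and vunit_in_hom: "a \<in> vobj C \<Longrightarrow> in_hom V (vunit C a) (Unt V) (vhom C a a)"
    and vcomp_assoc: "a \<in> vobj C \<Longrightarrow> b \<in> vobj C \<Longrightarrow> c \<in> vobj C \<Longrightarrow> d \<in> vobj C \<Longrightarrow>
          vcomp C a b d \<cdot> (vcomp C b c d \<boxtimes> Ide V (vhom C a b))
          = vcomp C a c d \<cdot> ((Ide V (vhom C c d) \<boxtimes> vcomp C a b c)
                              \<cdot> Asc V (vhom C c d) (vhom C b c) (vhom C a b))"
    and vunit_left: "a \<in> vobj C \<Longrightarrow> b \<in> vobj C \<Longrightarrow>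
          vcomp C a b b \<cdot> (vunit C b \<boxtimes> Ide V (vhom C a b)) = LUn V (vhom C a b)"
    and vunit_right: "a \<in> vobj C \<Longrightarrow> b \<in> vobj C \<Longrightarrow>
          vcomp C a a b \<cdot> (Ide V (vhom C a b) \<boxtimes> vunit C a) = RUn V (vhom C a b)"

record ('u, 'o, 'm) vfun =
  vdom :: "('u, 'o, 'm) vcat"
  vcod :: "('u, 'o, 'm) vcat"
  omap :: "'u \<Rightarrow> 'u"
  hmap :: "'u \<Rightarrow> 'u \<Rightarrow> 'm"

text \<open>As for \<^const>\<open>SetC\<close>, the maps are undefined where they carry no information, so that
  equality of records is equality of enriched functors.\<close>

locale enriched_functor =
  fixes V :: "('o, 'm) mcat" (structure) and G :: "('u, 'o, 'm) vfun"
  assumes omap_in: "a \<in> vobj (vdom G) \<Longrightarrow> omap G a \<in> vobj (vcod G)"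
    and hmap_in_hom: "a \<in> vobj (vdom G) \<Longrightarrow> b \<in> vobj (vdom G) \<Longrightarrow>
          in_hom V (hmap G a b) (vhom (vdom G) a b) (vhom (vcod G) (omap G a) (omap G b))"
    and hmap_comp: "a \<in> vobj (vdom G) \<Longrightarrow> b \<in> vobj (vdom G) \<Longrightarrow> c \<in> vobj (vdom G) \<Longrightarrow>
          hmap G a c \<cdot> vcomp (vdom G) a b c
          = vcomp (vcod G) (omap G a) (omap G b) (omap G c) \<cdot> (hmap G b c \<boxtimes> hmap G a b)"
    and hmap_unit: "a \<in> vobj (vdom G) \<Longrightarrow>
          hmap G a a \<cdot> vunit (vdom G) a = vunit (vcod G) (omap G a)"
    and omap_undefined: "a \<notin> vobj (vdom G) \<Longrightarrow> omap G a = undefined"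
    and hmap_undefined: "a \<notin> vobj (vdom G) \<or> b \<notin> vobj (vdom G) \<Longrightarrow> hmap G a b = undefined"

definition CatV :: "'u rel \<Rightarrow> ('o, 'm) mcat \<Rightarrow> (('u, 'o, 'm) vcat, ('u, 'o, 'm) vfun) cat" where
  "CatV \<kappa> V = \<lparr>
     Obj = {C. enriched_category V C \<and> small \<kappa> (vobj C)},
     Arr = {G. enriched_category V (vdom G) \<and> small \<kappa> (vobj (vdom G)) \<and>
               enriched_category V (vcod G) \<and> small \<kappa> (vobj (vcod G)) \<and>
               enriched_functor V G},
     Dom = vdom, Cod = vcod,
     Ide = \<lambda>C. \<lparr> vdom = C, vcod = C,
        omap = \<lambda>a. if a \<in> vobj C then a else undefined,
        hmap = \<lambda>a b. if a \<in> vobj C \<and> b \<in> vobj C then Ide V (vhom C a b) else undefined \<rparr>,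
     Cmp = \<lambda>H G. \<lparr> vdom = vdom G, vcod = vcod H,
        omap = \<lambda>a. if a \<in> vobj (vdom G) then omap H (omap G a) else undefined,
        hmap = \<lambda>a b. if a \<in> vobj (vdom G) \<and> b \<in> vobj (vdom G)
                     then hmap H (omap G a) (omap G b) \<cdot>\<^bsub>V\<^esub> hmap G a b else undefined \<rparr> \<rparr>"

definition Ob_functor :: "(('u, 'o, 'm) vcat, ('u, 'o, 'm) vfun, 'u set, 'u set_map) func" where
  "Ob_functor = \<lparr> FObj = vobj,
     FArr = \<lambda>G. \<lparr> SDom = vobj (vdom G), SCod = vobj (vcod G), SFun = omap G \<rparr> \<rparr>"


section \<open>Strings\<close>

type_synonym ('i, 'u) edge = "'i \<times> 'u \<times> 'u"

text \<open>
  The string \<open>[e\<^sub>n, \<dots>, e\<^sub>1]\<close> is represented by the list with head \<open>e\<^sub>1\<close> and last element \<open>e\<^sub>n\<close>;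
  this makes recursion on lists peel off the rightmost factor of a left-associated tensor
  product. Whence the reversal in the concatenation \<open>t \<star> s\<close>.
\<close>

type_synonym ('i, 'u) strng = "('i, 'u) edge list"

definition star :: "('i, 'u) strng \<Rightarrow> ('i, 'u) strng \<Rightarrow> ('i, 'u) strng"  (infixr "\<star>" 65) where
  "t \<star> s = s @ t"

text \<open>
  A generating morphism is a triple \<open>(u, p, v)\<close> with source \<open>u \<star> prim_src p \<star> v\<close>; distinct positions
  of the same elementary move are distinct generators, even if source and target agree.
  \<open>Transport f x y\<close> is the transport along \<open>f : (i, x, y) \<rightarrow> (i', (Ff)(x), (Ff)(y))\<close>,
  \<open>Contract i x y z\<close> the contraction \<open>[(i,y,z), (i,x,y)] \<rightarrow> [(i,x,z)]\<close>,
  \<open>Insert i x\<close> the insertion \<open>[] \<rightarrow> [(i,x,x)]\<close>.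
\<close>

datatype ('i, 'k, 'u) prim =
    Transport 'k 'u 'u
  | Contract 'i 'u 'u 'u
  | Insert 'i 'u

type_synonym ('i, 'k, 'u) gen = "('i, 'u) strng \<times> ('i, 'k, 'u) prim \<times> ('i, 'u) strng"

definition whisker_left :: "('i, 'u) strng \<Rightarrow> ('i, 'k, 'u) gen \<Rightarrow> ('i, 'k, 'u) gen" where
  "whisker_left t = (\<lambda>(u, p, v). (t \<star> u, p, v))"

definition whisker_right :: "('i, 'k, 'u) gen \<Rightarrow> ('i, 'u) strng \<Rightarrow> ('i, 'k, 'u) gen" where
  "whisker_right = (\<lambda>(u, p, v) s. (u, p, v \<star> s))"

text \<open>A morphism is a triple (source, set of representing paths of generators, target); paths list
  the generators in the order in which they are applied.\<close>

type_synonym ('i, 'k, 'u) str_arr =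
  "('i, 'u) strng \<times> ('i, 'k, 'u) gen list set \<times> ('i, 'u) strng"

locale string_construction =
  fixes \<kappa> :: "'u rel"
    and V :: "('o, 'm) mcat" (structure)
    and I :: "('i, 'k) cat"
    and F :: "('i, 'k, ('u, 'o, 'm) vcat, ('u, 'o, 'm) vfun) func"
begin

definition obF :: "('i, 'k, 'u set, 'u set_map) func" where
  "obF = func_comp Ob_functor F"

definition colimOb :: "'u set" where
  "colimOb = colim_obj I (SetC \<kappa>) obF"

definition cls :: "'i \<Rightarrow> 'u \<Rightarrow> 'u" where
  "cls i x = SFun (colim_leg I (SetC \<kappa>) obF i) x"

fun is_edge :: "('i, 'u) edge \<Rightarrow> bool" where
  "is_edge (i, x, y) \<longleftrightarrow> i \<in> Obj I \<and> x \<in> vobj (FObj F i) \<and> y \<in> vobj (FObj F i)"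

fun is_string :: "'u \<Rightarrow> 'u \<Rightarrow> ('i, 'u) strng \<Rightarrow> bool" where
  "is_string a b [] \<longleftrightarrow> a \<in> colimOb \<and> a = b"
| "is_string a b ((i, x, y) # es) \<longleftrightarrow>
     is_edge (i, x, y) \<and> cls i x = a \<and> is_string (cls i y) b es"

fun prim_src :: "('i, 'k, 'u) prim \<Rightarrow> ('i, 'u) strng" where
  "prim_src (Transport f x y) = [(Dom I f, x, y)]"
| "prim_src (Contract i x y z) = [(i, y, z)] \<star> [(i, x, y)]"
| "prim_src (Insert i x) = []"

fun prim_tgt :: "('i, 'k, 'u) prim \<Rightarrow> ('i, 'u) strng" where
  "prim_tgt (Transport f x y) = [(Cod I f, omap (FArr F f) x, omap (FArr F f) y)]"
| "prim_tgt (Contract i x y z) = [(i, x, z)]"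
| "prim_tgt (Insert i x) = [(i, x, x)]"

fun is_prim :: "('i, 'k, 'u) prim \<Rightarrow> bool" where
  "is_prim (Transport f x y) \<longleftrightarrow> f \<in> Arr I \<and> is_edge (Dom I f, x, y)"
| "is_prim (Contract i x y z) \<longleftrightarrow> is_edge (i, x, y) \<and> is_edge (i, y, z)"
| "is_prim (Insert i x) \<longleftrightarrow> is_edge (i, x, x)"

fun gen_src :: "('i, 'k, 'u) gen \<Rightarrow> ('i, 'u) strng" where
  "gen_src (u, p, v) = u \<star> prim_src p \<star> v"

fun gen_tgt :: "('i, 'k, 'u) gen \<Rightarrow> ('i, 'u) strng" where
  "gen_tgt (u, p, v) = u \<star> prim_tgt p \<star> v"

fun is_gen :: "'u \<Rightarrow> 'u \<Rightarrow> ('i, 'k, 'u) gen \<Rightarrow> bool" where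
  "is_gen a b (u, p, v) \<longleftrightarrow>
     is_prim p \<and> is_string a b (gen_src (u, p, v)) \<and> is_string a b (gen_tgt (u, p, v))"

fun is_path :: "'u \<Rightarrow> 'u \<Rightarrow> ('i, 'u) strng \<Rightarrow> ('i, 'k, 'u) gen list \<Rightarrow> ('i, 'u) strng \<Rightarrow> bool" where
  "is_path a b s [] t \<longleftrightarrow> is_string a b s \<and> s = t"
| "is_path a b s (g # gs) t \<longleftrightarrow> is_gen a b g \<and> gen_src g = s \<and> is_path a b (gen_tgt g) gs t"

text \<open>The congruence on paths in \<open>S(a,c)\<close> generated by the interchange relation. Since whiskering a generator
  yields a generator, it is stable under \<open>\<star>\<close>.\<close>

inductive path_eq :: "'u \<Rightarrow> 'u \<Rightarrow> ('i, 'k, 'u) gen list \<Rightarrow> ('i, 'k, 'u) gen list \<Rightarrow> bool"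
  for a c where
  interchange: "is_gen a b \<alpha> \<Longrightarrow> is_gen b c \<beta> \<Longrightarrow>
     path_eq a c [whisker_left (gen_src \<beta>) \<alpha>, whisker_right \<beta> (gen_tgt \<alpha>)]
                 [whisker_right \<beta> (gen_src \<alpha>), whisker_left (gen_tgt \<beta>) \<alpha>]"
| refl: "path_eq a c ps ps"
| sym: "path_eq a c ps qs \<Longrightarrow> path_eq a c qs ps"
| trans: "path_eq a c ps qs \<Longrightarrow> path_eq a c qs rs \<Longrightarrow> path_eq a c ps rs"
| congr: "path_eq a c ps qs \<Longrightarrow> path_eq a c (xs @ ps @ ys) (xs @ qs @ ys)"

definition path_class :: "'u \<Rightarrow> 'u \<Rightarrow> ('i, 'k, 'u) gen list \<Rightarrow> ('i, 'k, 'u) gen list set" where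
  "path_class a b ps = {qs. path_eq a b ps qs}"

definition StrCat :: "'u \<Rightarrow> 'u \<Rightarrow> (('i, 'u) strng, ('i, 'k, 'u) str_arr) cat" where
  "StrCat a b = \<lparr>
     Obj = {s. is_string a b s},
     Arr = {(s, path_class a b ps, t) | s ps t. is_path a b s ps t},
     Dom = \<lambda>(s, P, t). s,
     Cod = \<lambda>(s, P, t). t,
     Ide = \<lambda>s. (s, path_class a b [], s),
     Cmp = \<lambda>(s', Q, t') (s, P, t). (s, \<Union>p\<in>P. \<Union>q\<in>Q. path_class a b (p @ q), t') \<rparr>"


section \<open>String evaluation\<close>

fun ev_edge :: "('i, 'u) edge \<Rightarrow> 'o" where
  "ev_edge (i, x, y) = vhom (FObj F i) x y"

fun ev_str :: "('i, 'u) strng \<Rightarrow> 'o" where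
  "ev_str [] = Unt V"
| "ev_str [e] = ev_edge e"
| "ev_str (e # e' # es) = ev_str (e' # es) \<otimes> ev_edge e"

text \<open>\<open>theta t s : ev t \<otimes> ev s \<rightarrow> ev (t \<star> s)\<close>\<close>

fun theta :: "('i, 'u) strng \<Rightarrow> ('i, 'u) strng \<Rightarrow> 'm" where
  "theta t [] = RUn V (ev_str t)"
| "theta t (e # s) =
     (if t = [] then LUn V (ev_str (e # s))
      else if s = [] then Ide V (ev_str t \<otimes> ev_edge e)
      else (theta t s \<boxtimes> Ide V (ev_edge e)) \<cdot> inv_arr V (Asc V (ev_str t) (ev_str s) (ev_edge e)))"

fun ev_prim :: "('i, 'k, 'u) prim \<Rightarrow> 'm" where
  "ev_prim (Transport f x y) = hmap (FArr F f) x y"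
| "ev_prim (Contract i x y z) = vcomp (FObj F i) x y z"
| "ev_prim (Insert i x) = vunit (FObj F i) x"

text \<open>
  A generator \<open>(u, p, v)\<close> is evaluated by applying \<^term>\<open>ev_prim p\<close> to the factors it concerns.
  The isomorphisms \<^const>\<open>theta\<close> bring these factors together, and for insertions
  (\<open>prim_src p = []\<close>) they contain the inverse unitor which creates the factor \<open>\<one>\<close>.
\<close>

fun ev_gen :: "('i, 'k, 'u) gen \<Rightarrow> 'm" where
  "ev_gen (u, p, v) =
     theta u (prim_tgt p \<star> v)
     \<cdot> ((Ide V (ev_str u)
          \<boxtimes> (theta (prim_tgt p) v
              \<cdot> ((ev_prim p \<boxtimes> Ide V (ev_str v)) \<cdot> inv_arr V (theta (prim_src p) v))))
        \<cdot> inv_arr V (theta u (prim_src p \<star> v)))"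

fun ev_path :: "('i, 'u) strng \<Rightarrow> ('i, 'k, 'u) gen list \<Rightarrow> 'm" where
  "ev_path s [] = Ide V (ev_str s)"
| "ev_path s (g # gs) = ev_path (gen_tgt g) gs \<cdot> ev_gen g"

definition ev :: "(('i, 'u) strng, ('i, 'k, 'u) str_arr, 'o, 'm) func" where
  "ev = \<lparr> FObj = ev_str, FArr = \<lambda>(s, P, t). ev_path s (SOME ps. ps \<in> P) \<rparr>"


section \<open>The enriched category of strings\<close>

definition shom :: "'u \<Rightarrow> 'u \<Rightarrow> 'o" where
  "shom a b = colim_obj (StrCat a b) V ev"

definition sleg :: "'u \<Rightarrow> 'u \<Rightarrow> ('i, 'u) strng \<Rightarrow> 'm" where
  "sleg a b = colim_leg (StrCat a b) V ev"

definition StrCat2 ::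
  "'u \<Rightarrow> 'u \<Rightarrow> 'u \<Rightarrow> (('i, 'u) strng \<times> ('i, 'u) strng,
                     ('i, 'k, 'u) str_arr \<times> ('i, 'k, 'u) str_arr) cat" where
  "StrCat2 a b c = prod_cat (StrCat b c) (StrCat a b)"

definition ev2 ::
  "(('i, 'u) strng \<times> ('i, 'u) strng, ('i, 'k, 'u) str_arr \<times> ('i, 'k, 'u) str_arr, 'o, 'm) func" where
  "ev2 = \<lparr> FObj = \<lambda>(t, s). FObj ev t \<otimes> FObj ev s, FArr = \<lambda>(\<beta>, \<alpha>). FArr ev \<beta> \<boxtimes> FArr ev \<alpha> \<rparr>"

definition mu_inv :: "'u \<Rightarrow> 'u \<Rightarrow> 'u \<Rightarrow> 'm" where
  "mu_inv a b c = colim_map (StrCat2 a b c) V ev2 (shom b c \<otimes> shom a b)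
                    (\<lambda>(t, s). sleg b c t \<boxtimes> sleg a b s)"

definition scomp :: "'u \<Rightarrow> 'u \<Rightarrow> 'u \<Rightarrow> 'm" where
  "scomp a b c = colim_map (StrCat2 a b c) V ev2 (shom a c)
                   (\<lambda>(t, s). sleg a c (t \<star> s) \<cdot> theta t s)
                 \<cdot> inv_arr V (mu_inv a b c)"

definition colim_star :: "('u, 'o, 'm) vcat" where
  "colim_star = \<lparr> vobj = colimOb, vhom = shom, vcomp = scomp, vunit = \<lambda>a. sleg a a [] \<rparr>"

end

end

theory Submission
  imports Defs
begin

text \<open>
  Conjugating the tensor product by \<open>theta\<close> turns the arrows between evaluations of strings into a
  strict monoidal category, in which a generator \<open>(u, p, v)\<close> evaluates to \<open>id\<^sub>u \<otimes> p \<otimes> id\<^sub>v\<close>. The only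
  coherence needed for this is the associativity of \<open>theta\<close>, an induction on the last string. Then
  interchange, and hence functoriality of \<open>ev\<close>, is bifunctoriality of the strict tensor product.

  Since \<open>\<otimes>\<close> preserves colimits in each argument, arrows out of tensor products of the hom-objects are
  determined on the legs \<open>\<kappa>\<^sub>t \<otimes> \<kappa>\<^sub>s\<close>, where composition is concatenation; so the axioms of an
  enriched category reduce to the associativity of \<open>theta\<close> again. A cocone \<open>\<delta>\<close> over \<open>F\<close> with vertex
  \<open>E\<close> assigns to a string the composite in \<open>E\<close> of the images of its edges. This is compatible with
  concatenation, therefore with generators, as it is so on transports, contractions and insertions by
  the functoriality of the \<open>\<delta>\<^sub>i\<close>; the induced maps on colimits are the unique enriched functor
  out of the colimit, because every string is a concatenation of edges.
\<close>

section \<open>Arrows and inverses\<close>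

text \<open>Colimits and inverses are picked by description operators (\<open>SOME\<close>,
  \<open>THE\<close>), so nothing is known of \<open>colimOb\<close>, \<open>shom\<close> or
  \<open>inv_arr\<close> until existence is proved. For objects this requires colimits of small
  sets; for hom-objects it requires every \<open>StrCat a b\<close> to be small. Strings and paths
  are finite lists, hence form countable unions over their lengths, which is why \<kappa> is
  uncountable and regular. Cocompleteness speaks of shapes made of elements of the type of \<kappa>,
  whereas string categories consist of lists and classes of paths; isomorphic copies along
  injections bridge the gap.

  \<open>theta\<close> is a unitor when a string is empty and an iterated associator otherwise. Its
  associativity therefore needs coherences of units that are not among the axioms of a monoidal
  category; they are derived from pentagon and triangle.

  An arrow of strings is a class of paths, and \<open>ev\<close> evaluates a chosen representative.
  Naturality is therefore checked along paths, one generator at a time.\<close>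

context category
begin

lemma arr_Cmp [simp]: "f \<in> Arr C \<Longrightarrow> g \<in> Arr C \<Longrightarrow> Cod C f = Dom C g \<Longrightarrow> g \<cdot> f \<in> Arr C"
  and Dom_Cmp [simp]: "f \<in> Arr C \<Longrightarrow> g \<in> Arr C \<Longrightarrow> Cod C f = Dom C g \<Longrightarrow> Dom C (g \<cdot> f) = Dom C f"
  and Cod_Cmp [simp]: "f \<in> Arr C \<Longrightarrow> g \<in> Arr C \<Longrightarrow> Cod C f = Dom C g \<Longrightarrow> Cod C (g \<cdot> f) = Cod C g"
  using Cmp_in_hom[of f "Dom C f" "Cod C f" g "Cod C g"] by (auto simp: in_hom_def)

lemma arr_Ide [simp]: "a \<in> Obj C \<Longrightarrow> Ide C a \<in> Arr C"
  and Dom_Ide [simp]: "a \<in> Obj C \<Longrightarrow> Dom C (Ide C a) = a"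
  and Cod_Ide [simp]: "a \<in> Obj C \<Longrightarrow> Cod C (Ide C a) = a"
  using Ide_in_hom[of a] by (auto simp: in_hom_def)

text \<open>The object \<open>a\<close> is a variable tied to \<open>f\<close> by a premise, so that
  the rule also fires when the codomain of \<open>f\<close> equals \<open>a\<close> only after
  simplification.\<close>

lemma Ide_Cmp [simp]: "f \<in> Arr C \<Longrightarrow> Cod C f = a \<Longrightarrow> Ide C a \<cdot> f = f"
  using Ide_left[of f "Dom C f" a] by (simp add: in_hom_def)

lemma Cmp_Ide [simp]: "f \<in> Arr C \<Longrightarrow> Dom C f = a \<Longrightarrow> f \<cdot> Ide C a = f"
  using Ide_right[of f a "Cod C f"] by (simp add: in_hom_def)

lemma assoc [simp]:
  "f \<in> Arr C \<Longrightarrow> g \<in> Arr C \<Longrightarrow> h \<in> Arr C \<Longrightarrow> Cod C f = Dom C g \<Longrightarrow> Cod C g = Dom C h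
    \<Longrightarrow> (h \<cdot> g) \<cdot> f = h \<cdot> (g \<cdot> f)"
  using Cmp_assoc by (simp add: in_hom_def)

declare Dom_in [simp] Cod_in [simp]

text \<open>Two inverses agree by
  \<open>g' = g' \<cdot> (f \<cdot> g) = (g' \<cdot> f) \<cdot> g = g\<close>, so the description in
  \<open>inv_arr\<close> denotes.\<close>

lemma inverse_of_inv_arr: "is_iso C f \<Longrightarrow> inverse_of C f (inv_arr C f)"
proof -
  assume f: "is_iso C f"
  then obtain g where g: "inverse_of C f g" by (auto simp: is_iso_def)
  have "g' = g" if g': "inverse_of C f g'" for g'
  proof -
    have "g' = g' \<cdot> (f \<cdot> g)"
      using f g g' by (simp add: is_iso_def inverse_of_def in_hom_def)
    also have "\<dots> = (g' \<cdot> f) \<cdot> g"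
      using f g g' by (subst assoc) (auto simp: is_iso_def inverse_of_def in_hom_def)
    also have "\<dots> = g"
      using f g g' by (simp add: is_iso_def inverse_of_def in_hom_def)
    finally show ?thesis .
  qed
  with g show ?thesis unfolding inv_arr_def by (rule theI)
qed

lemma is_iso_arr: "is_iso C f \<Longrightarrow> f \<in> Arr C"
  by (simp add: is_iso_def)

lemma arr_inv [simp]: "is_iso C f \<Longrightarrow> inv_arr C f \<in> Arr C"
  and Dom_inv [simp]: "is_iso C f \<Longrightarrow> Dom C (inv_arr C f) = Cod C f"
  and Cod_inv [simp]: "is_iso C f \<Longrightarrow> Cod C (inv_arr C f) = Dom C f"
  and inv_Cmp [simp]: "is_iso C f \<Longrightarrow> inv_arr C f \<cdot> f = Ide C (Dom C f)"
  and Cmp_inv [simp]: "is_iso C f \<Longrightarrow> f \<cdot> inv_arr C f = Ide C (Cod C f)"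
  using inverse_of_inv_arr[of f] by (auto simp: inverse_of_def in_hom_def)

text \<open>Since \<open>assoc\<close> rewrites composites to right-nested form, an inverse pair
  usually stands in front of a further factor; this rule and the next cancel it there.\<close>

lemma inv_Cmp_Cmp [simp]:
  "is_iso C f \<Longrightarrow> g \<in> Arr C \<Longrightarrow> Cod C g = Dom C f \<Longrightarrow> inv_arr C f \<cdot> (f \<cdot> g) = g"
  by (subst assoc[symmetric]) (auto simp: is_iso_arr)

lemma Cmp_inv_Cmp [simp]:
  "is_iso C f \<Longrightarrow> g \<in> Arr C \<Longrightarrow> Cod C g = Cod C f \<Longrightarrow> f \<cdot> (inv_arr C f \<cdot> g) = g"
  by (subst assoc[symmetric]) (auto simp: is_iso_arr)

lemma is_isoI:
  assumes "f \<in> Arr C" "g \<in> Arr C" "Dom C g = Cod C f" "Cod C g = Dom C f"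
    "g \<cdot> f = Ide C (Dom C f)" "f \<cdot> g = Ide C (Cod C f)"
  shows "is_iso C f"
  using assms by (auto simp: is_iso_def inverse_of_def in_hom_def)

lemma is_iso_Ide [simp]: "a \<in> Obj C \<Longrightarrow> is_iso C (Ide C a)"
  by (rule is_isoI[of _ "Ide C a"]) auto


lemma is_iso_inv [simp]: "is_iso C f \<Longrightarrow> is_iso C (inv_arr C f)"
  by (rule is_isoI[of _ f]) (auto simp: is_iso_arr)

lemma is_iso_Cmp [simp]:
  "is_iso C f \<Longrightarrow> is_iso C g \<Longrightarrow> Cod C f = Dom C g \<Longrightarrow> is_iso C (g \<cdot> f)"
  by (rule is_isoI[of _ "inv_arr C f \<cdot> inv_arr C g"]) (simp_all add: is_iso_arr)

lemma iso_cancel_right: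
  assumes "is_iso C e" "f \<in> Arr C" "g \<in> Arr C" "Dom C f = Cod C e" "Dom C g = Cod C e"
    "f \<cdot> e = g \<cdot> e"
  shows "f = g"
proof -
  have "(f \<cdot> e) \<cdot> inv_arr C e = (g \<cdot> e) \<cdot> inv_arr C e" using assms by simp
  then show ?thesis using assms(1-5) by (simp add: is_iso_arr)
qed

lemma iso_cancel_left:
  assumes "is_iso C e" "f \<in> Arr C" "g \<in> Arr C" "Cod C f = Dom C e" "Cod C g = Dom C e"
    "e \<cdot> f = e \<cdot> g"
  shows "f = g"
proof -
  have "inv_arr C e \<cdot> (e \<cdot> f) = inv_arr C e \<cdot> (e \<cdot> g)" using assms by simp
  then show ?thesis using assms(1-5) by (simp add: is_iso_arr)
qed


end


section \<open>Colimits\<close>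

lemma colim_is_colimit:
  "is_colimit J C D c \<Longrightarrow> is_colimit_cocone J C D (colim_obj J C D) (colim_leg J C D)"
  unfolding is_colimit_def colim_def
  by (rule someI2_ex[where P = "\<lambda>(c, \<iota>). is_colimit_cocone J C D c \<iota>"]) auto

text \<open>Both arrows mediate the cocone with legs \<open>f \<cdot> \<iota> j\<close>. Equations
  between arrows out of hom-objects and their tensor products are proved in this form, by evaluation
  on legs.\<close>

lemma colimit_ext:
  assumes "is_colimit_cocone J C D c \<iota>" "is_functor J C D" "category C" "category J"
    and "in_hom C f c d" "in_hom C g c d" "\<And>j. j \<in> Obj J \<Longrightarrow> f \<cdot>\<^bsub>C\<^esub> \<iota> j = g \<cdot>\<^bsub>C\<^esub> \<iota> j"
  shows "f = g"
proof -
  interpret category C by fact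
  interpret J: category J by fact
  have "is_cocone J C D d (\<lambda>j. f \<cdot>\<^bsub>C\<^esub> \<iota> j)"
    using assms(1,2,5) unfolding is_colimit_cocone_def is_cocone_def is_functor_def
    by (auto simp: in_hom_def)
  then have "\<exists>!h. in_hom C h c d \<and> (\<forall>j\<in>Obj J. h \<cdot>\<^bsub>C\<^esub> \<iota> j = f \<cdot>\<^bsub>C\<^esub> \<iota> j)"
    using assms(1) by (simp add: is_colimit_cocone_def)
  then obtain h where "\<And>k. in_hom C k c d \<Longrightarrow> (\<forall>j\<in>Obj J. k \<cdot>\<^bsub>C\<^esub> \<iota> j = f \<cdot>\<^bsub>C\<^esub> \<iota> j) \<Longrightarrow> k = h"
    by (elim ex1E) blast
  from this[OF assms(5)] this[OF assms(6)] assms(7) show ?thesis by simp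
qed

lemma colim_map:
  assumes "is_colimit J C D c" "is_cocone J C D d \<delta>"
  shows "in_hom C (colim_map J C D d \<delta>) (colim_obj J C D) d"
    and "j \<in> Obj J \<Longrightarrow> colim_map J C D d \<delta> \<cdot>\<^bsub>C\<^esub> colim_leg J C D j = \<delta> j"
proof -
  have "\<exists>!h. in_hom C h (colim_obj J C D) d \<and> (\<forall>j\<in>Obj J. h \<cdot>\<^bsub>C\<^esub> colim_leg J C D j = \<delta> j)"
    using colim_is_colimit[OF assms(1)] assms(2) unfolding is_colimit_cocone_def by blast
  from theI'[OF this, folded colim_map_def]
  show "in_hom C (colim_map J C D d \<delta>) (colim_obj J C D) d"
    and "j \<in> Obj J \<Longrightarrow> colim_map J C D d \<delta> \<cdot>\<^bsub>C\<^esub> colim_leg J C D j = \<delta> j" by auto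
qed

lemma is_colimit_coconeI:
  assumes "is_cocone J C D c \<iota>"
    and "\<And>d \<delta>. is_cocone J C D d \<delta> \<Longrightarrow> \<exists>h. in_hom C h c d \<and> (\<forall>j\<in>Obj J. h \<cdot>\<^bsub>C\<^esub> \<iota> j = \<delta> j)"
    and "\<And>d f g. in_hom C f c d \<Longrightarrow> in_hom C g c d
           \<Longrightarrow> (\<And>j. j \<in> Obj J \<Longrightarrow> f \<cdot>\<^bsub>C\<^esub> \<iota> j = g \<cdot>\<^bsub>C\<^esub> \<iota> j) \<Longrightarrow> f = g"
  shows "is_colimit_cocone J C D c \<iota>"
  unfolding is_colimit_cocone_def
proof (intro conjI allI impI)
  fix d \<delta> assume "is_cocone J C D d \<delta>"
  from assms(2)[OF this] obtain h where "in_hom C h c d" "\<forall>j\<in>Obj J. h \<cdot>\<^bsub>C\<^esub> \<iota> j = \<delta> j" by blast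
  then show "\<exists>!h. in_hom C h c d \<and> (\<forall>j\<in>Obj J. h \<cdot>\<^bsub>C\<^esub> \<iota> j = \<delta> j)"
    using assms(3) by (intro ex1I[of _ h]) auto
qed fact

text \<open>The mediating arrow \<open>k\<close> in the opposite direction is an inverse, by
  uniqueness on both sides. The case at hand is \<open>mu_inv\<close>, whose target is a tensor
  product of chosen colimits and not itself a chosen one.\<close>

lemma colim_map_iso:
  assumes "is_colimit_cocone J C D c \<iota>" "is_functor J C D" "category C" "category J"
  shows "is_iso C (colim_map J C D c \<iota>)"
proof -
  interpret category C by fact
  interpret J: category J by fact
  let ?c = "colim_obj J C D" and ?\<iota> = "colim_leg J C D"
  have ex: "is_colimit J C D c" using assms(1) by (auto simp: is_colimit_def)
  have co: "is_cocone J C D c \<iota>" using assms(1) by (simp add: is_colimit_cocone_def)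
  have co': "is_colimit_cocone J C D ?c ?\<iota>" by (rule colim_is_colimit[OF ex])
  have co'': "is_cocone J C D ?c ?\<iota>" using co' by (simp add: is_colimit_cocone_def)
  have legs: "?\<iota> j \<in> Arr C" "Cod C (?\<iota> j) = ?c" "\<iota> j \<in> Arr C" "Cod C (\<iota> j) = c" 
    "Dom C (?\<iota> j) = FObj D j" "Dom C (\<iota> j) = FObj D j"
    if "j \<in> Obj J" for j
    using that co co'' by (simp_all add: is_cocone_def in_hom_def)
  have objs: "c \<in> Obj C" "?c \<in> Obj C"
    using co co'' by (simp_all add: is_cocone_def)
  note m = colim_map[OF ex co]
  obtain k where k: "in_hom C k c ?c" "\<And>j. j \<in> Obj J \<Longrightarrow> k \<cdot>\<^bsub>C\<^esub> \<iota> j = ?\<iota> j"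
  proof -
    have "\<exists>!k. in_hom C k c ?c \<and> (\<forall>j\<in>Obj J. k \<cdot>\<^bsub>C\<^esub> \<iota> j = ?\<iota> j)"
      using assms(1) co'' unfolding is_colimit_cocone_def by simp
    then show thesis using that by (elim ex1E) blast
  qed
  show ?thesis
  proof (rule is_isoI[of _ k])
    show "k \<cdot>\<^bsub>C\<^esub> colim_map J C D c \<iota> = Ide C (Dom C (colim_map J C D c \<iota>))"
      by (rule colimit_ext[OF co' assms(2-4), of _ ?c])
         (use m k legs objs in \<open>auto simp: in_hom_def\<close>)
    show "colim_map J C D c \<iota> \<cdot>\<^bsub>C\<^esub> k = Ide C (Cod C (colim_map J C D c \<iota>))"
      by (rule colimit_ext[OF assms(1) assms(2-4), of _ c])
         (use m k legs objs in \<open>auto simp: in_hom_def\<close>)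
  qed (use m k in \<open>auto simp: in_hom_def\<close>)
qed

text \<open>Legs are total functions, but only their values on objects of \<open>J\<close> matter;
  reindexing along an injection and back may change the others.\<close>

lemma is_cocone_cong:
  assumes "category J" "is_cocone J C D d \<delta>" "\<And>j. j \<in> Obj J \<Longrightarrow> \<delta> j = \<delta>' j"
  shows "is_cocone J C D d \<delta>'"
  using assms by (simp add: is_cocone_def category.Dom_in category.Cod_in)

lemma is_colimit_cocone_cong:
  assumes "category J" "is_colimit_cocone J C D c \<iota>" "\<And>j. j \<in> Obj J \<Longrightarrow> \<iota> j = \<iota>' j"
  shows "is_colimit_cocone J C D c \<iota>'"
proof -
  have "is_cocone J C D c \<iota>" using assms(2) by (simp add: is_colimit_cocone_def)
  then have "is_cocone J C D c \<iota>'" using assms(3) by (rule is_cocone_cong[OF assms(1)])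
  with assms(2,3) show ?thesis by (simp add: is_colimit_cocone_def)
qed


subsection \<open>Diagram shapes of arbitrary type\<close>

text \<open>A copy of \<open>J\<close> with objects and arrows renamed by \<open>g\<close> and
  \<open>k\<close>. If these are injective on \<open>J\<close>, then \<open>inv_into\<close>
  recovers the original names and the copy is isomorphic to \<open>J\<close>; it brings a small
  shape into the type over which cocompleteness quantifies.\<close>

definition transfer_cat :: "('i \<Rightarrow> 'j) \<Rightarrow> ('k \<Rightarrow> 'l) \<Rightarrow> ('i, 'k) cat \<Rightarrow> ('j, 'l) cat" where
  "transfer_cat g k J = \<lparr> Obj = g ` Obj J, Arr = k ` Arr J,
     Dom = \<lambda>f. g (Dom J (inv_into (Arr J) k f)), Cod = \<lambda>f. g (Cod J (inv_into (Arr J) k f)),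
     Ide = \<lambda>x. k (Ide J (inv_into (Obj J) g x)),
     Cmp = \<lambda>f h. k (inv_into (Arr J) k f \<cdot>\<^bsub>J\<^esub> inv_into (Arr J) k h) \<rparr>"

definition transfer_func ::
  "('i \<Rightarrow> 'j) \<Rightarrow> ('k \<Rightarrow> 'l) \<Rightarrow> ('i, 'k) cat \<Rightarrow> ('i, 'k, 'o, 'm) func \<Rightarrow> ('j, 'l, 'o, 'm) func" where
  "transfer_func g k J D = \<lparr> FObj = \<lambda>x. FObj D (inv_into (Obj J) g x),
     FArr = \<lambda>f. FArr D (inv_into (Arr J) k f) \<rparr>"

context
  fixes g :: "'i \<Rightarrow> 'j" and k :: "'k \<Rightarrow> 'l" and J :: "('i, 'k) cat"
  assumes g: "inj_on g (Obj J)" and k: "inj_on k (Arr J)" and J: "category J"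
begin

interpretation J: category J by (rule J)

lemma transfer_cat_category: "category (transfer_cat g k J)"
  by unfold_locales (auto simp: transfer_cat_def in_hom_def g k inj_on_eq_iff[OF g])

lemma transfer_func_is_functor:
  "is_functor J C D \<Longrightarrow> is_functor (transfer_cat g k J) C (transfer_func g k J D)"
  by (auto simp: is_functor_def transfer_cat_def transfer_func_def g k inj_on_eq_iff[OF g])

lemma transfer_cocone:
  "is_cocone (transfer_cat g k J) C (transfer_func g k J D) d \<delta> \<longleftrightarrow> is_cocone J C D d (\<lambda>j. \<delta> (g j))"
  using g k by (auto simp: is_cocone_def transfer_cat_def transfer_func_def)


lemma transfer_colimit_cocone:
  "is_colimit_cocone (transfer_cat g k J) C (transfer_func g k J D) c \<iota>
    \<longleftrightarrow> is_colimit_cocone J C D c (\<lambda>j. \<iota> (g j))"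
  unfolding is_colimit_cocone_def transfer_cocone
proof (intro conj_cong refl iffI allI impI)
  fix d \<delta>
  assume h: "\<forall>d \<delta>. is_cocone J C D d (\<lambda>j. \<delta> (g j)) \<longrightarrow>
      (\<exists>!h. in_hom C h c d \<and> (\<forall>j\<in>Obj (transfer_cat g k J). h \<cdot>\<^bsub>C\<^esub> \<iota> j = \<delta> j))"
    and \<delta>: "is_cocone J C D d \<delta>"
  \<comment> \<open>A cocone over the copy is indexed by renamed objects, so \<open>\<delta>\<close>
    is turned into one by precomposition with \<open>inv_into (Obj J) g\<close>.\<close>
  from \<delta> have "is_cocone J C D d (\<lambda>j. \<delta> (inv_into (Obj J) g (g j)))"
    by (rule is_cocone_cong[OF J]) (simp add: g)
  with h have "\<exists>!h. in_hom C h c d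
      \<and> (\<forall>j\<in>Obj (transfer_cat g k J). h \<cdot>\<^bsub>C\<^esub> \<iota> j = \<delta> (inv_into (Obj J) g j))"
    by (elim allE[of _ d] allE[of _ "\<lambda>j. \<delta> (inv_into (Obj J) g j)"]) auto
  then show "\<exists>!h. in_hom C h c d \<and> (\<forall>j\<in>Obj J. h \<cdot>\<^bsub>C\<^esub> \<iota> (g j) = \<delta> j)"
    using g by (simp add: transfer_cat_def)
qed (simp add: transfer_cat_def)

end

section \<open>Small sets\<close>

context
  fixes \<kappa> :: "'u rel"
  assumes \<kappa>: "size_bound \<kappa>"
begin

lemma Card_order_bound: "Card_order \<kappa>" and regular_bound: "regularCard \<kappa>"
  and natLeq_bound: "natLeq <o \<kappa>"
  using \<kappa> by (auto simp: size_bound_def)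

lemma Cinfinite_bound: "Cinfinite \<kappa>"
  using natLeq_bound Card_order_bound
  by (metis Cinfinite_csum csum_absorb2' natLeq_cinfinite natLeq_Card_order ordLess_imp_ordLeq
        Card_order_csum cinfinite_mono)

lemma small_subset: "small \<kappa> B \<Longrightarrow> A \<subseteq> B \<Longrightarrow> small \<kappa> A"
  unfolding small_def by (meson card_of_mono1 ordLeq_ordLess_trans)

lemma small_image: "small \<kappa> A \<Longrightarrow> small \<kappa> (f ` A)"
  unfolding small_def by (meson card_of_image ordLeq_ordLess_trans)

text \<open>Regularity of \<kappa> enters here; smallness of sums, binary unions and sets of lists
  is derived from it.\<close>

lemma small_UN: "small \<kappa> A \<Longrightarrow> (\<And>a. a \<in> A \<Longrightarrow> small \<kappa> (B a)) \<Longrightarrow> small \<kappa> (\<Union>a\<in>A. B a)"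
  unfolding small_def
  using card_of_UNION_ordLess_infinite_Field_regularCard[OF regular_bound Cinfinite_bound] by blast

lemma small_Sigma: "small \<kappa> A \<Longrightarrow> (\<And>a. a \<in> A \<Longrightarrow> small \<kappa> (B a)) \<Longrightarrow> small \<kappa> (Sigma A B)"
proof -
  assume "small \<kappa> A" "\<And>a. a \<in> A \<Longrightarrow> small \<kappa> (B a)"
  then have "small \<kappa> (\<Union>a\<in>A. Pair a ` B a)" by (intro small_UN small_image)
  then show ?thesis by (rule small_subset) auto
qed

lemma small_nat: "small \<kappa> (UNIV :: nat set)"
  unfolding small_def using natLeq_bound card_of_nat ordIso_ordLess_trans by blast

lemma small_finite: "finite A \<Longrightarrow> small \<kappa> A"
  unfolding small_def using natLeq_bound
  by (metis finite_iff_ordLess_natLeq ordLess_transitive)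

lemma small_Un: "small \<kappa> A \<Longrightarrow> small \<kappa> B \<Longrightarrow> small \<kappa> (A \<union> B)"
  using small_UN[OF small_finite[of "{A, B}"], of id] by auto

text \<open>The lists of each fixed length form a small set, and there are countably many lengths;
  uncountability of \<kappa> makes this a small union. Strings, and paths of generators, are such
  lists.\<close>

lemma small_lists: "small \<kappa> A \<Longrightarrow> small \<kappa> (lists A)"
proof -
  assume A: "small \<kappa> A"
  have len: "small \<kappa> {xs \<in> lists A. length xs = n}" for n
  proof (induction n)
    case (Suc n)
    have "{xs \<in> lists A. length xs = Suc n} \<subseteq> (\<lambda>(x, xs). x # xs) ` (A \<times> {xs \<in> lists A. length xs = n})"
      by (auto simp: length_Suc_conv image_iff)
    then show ?case using A Suc by (meson small_Sigma small_image small_subset)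
  qed (auto intro: small_finite)
  have "lists A = (\<Union>n. {xs \<in> lists A. length xs = n})" by auto
  then show ?thesis using small_UN[OF small_nat, of "\<lambda>n. {xs \<in> lists A. length xs = n}"] len by simp
qed

text \<open>\<kappa> is an order on elements of \<open>'u\<close>, so its field already provides as
  many elements of that type as a small set can need.\<close>

lemma small_inj: "small \<kappa> A \<Longrightarrow> \<exists>g :: 'a \<Rightarrow> 'u. inj_on g A" for A :: "'a set"
proof -
  assume "small \<kappa> A"
  then have "|A| \<le>o |Field \<kappa>|"
    unfolding small_def using card_of_Field_ordIso[OF Card_order_bound]
    by (meson ordIso_symmetric ordLess_imp_ordLeq ordLess_ordIso_trans)
  then show ?thesis unfolding card_of_ordLeq[symmetric] by blast
qed

lemma transfer_small:
  fixes J :: "('i, 'k) cat"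
  assumes J: "small_category \<kappa> J"
  obtains g :: "'i \<Rightarrow> 'u" and k :: "'k \<Rightarrow> 'u"
    where "inj_on g (Obj J)" "inj_on k (Arr J)" "small_category \<kappa> (transfer_cat g k J)"
proof -
  obtain g :: "'i \<Rightarrow> 'u" and k :: "'k \<Rightarrow> 'u" where g: "inj_on g (Obj J)" and k: "inj_on k (Arr J)"
    using J small_inj[of "Obj J"] small_inj[of "Arr J"] unfolding small_category_def by blast
  moreover have "small_category \<kappa> (transfer_cat g k J)"
    using J transfer_cat_category[OF g k]
    by (simp add: small_category_def transfer_cat_def small_image)
  ultimately show thesis using that by blast
qed

lemma cocomplete_colimit:
  fixes J :: "('i, 'k) cat"
  assumes "cocomplete \<kappa> C" and J: "small_category \<kappa> J" and D: "is_functor J C D"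
  shows "\<exists>c. is_colimit J C D c"
proof -
  have cat: "category J" using J by (simp add: small_category_def)
  obtain g :: "'i \<Rightarrow> 'u" and k :: "'k \<Rightarrow> 'u" where gk: "inj_on g (Obj J)" "inj_on k (Arr J)"
    and small: "small_category \<kappa> (transfer_cat g k J)"
    using transfer_small[OF J] .
  have "\<exists>c. is_colimit (transfer_cat g k J) C (transfer_func g k J D) c"
    using assms(1) small transfer_func_is_functor[OF gk cat D] unfolding cocomplete_def by blast
  then show ?thesis
    unfolding is_colimit_def transfer_colimit_cocone[OF gk cat] by blast
qed

lemma preserves_colimit:
  fixes J :: "('i, 'k) cat"
  assumes T: "preserves_small_colimits \<kappa> C E T" and J: "small_category \<kappa> J"
    and D: "is_functor J C D" and c: "is_colimit_cocone J C D c \<iota>"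
  shows "is_colimit_cocone J E (func_comp T D) (FObj T c) (\<lambda>j. FArr T (\<iota> j))"
proof -
  have cat: "category J" using J by (simp add: small_category_def)
  obtain g :: "'i \<Rightarrow> 'u" and k :: "'k \<Rightarrow> 'u" where gk: "inj_on g (Obj J)" "inj_on k (Arr J)"
    and small: "small_category \<kappa> (transfer_cat g k J)"
    using transfer_small[OF J] .
  \<comment> \<open>Legs indexed by renamed objects; at \<open>g j\<close> with \<open>j\<close> in
    \<open>Obj J\<close> they return the original leg at \<open>j\<close>.\<close>
  let ?\<iota> = "\<lambda>x. \<iota> (inv_into (Obj J) g x)"

  have "is_colimit_cocone J C D c (\<lambda>j. ?\<iota> (g j))"
    by (rule is_colimit_cocone_cong[OF cat c]) (simp add: gk)
  then have "is_colimit_cocone (transfer_cat g k J) C (transfer_func g k J D) c ?\<iota>"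
    by (simp add: transfer_colimit_cocone[OF gk cat])
  then have "is_colimit_cocone (transfer_cat g k J) E (func_comp T (transfer_func g k J D)) (FObj T c)
      (\<lambda>j. FArr T (?\<iota> j))"
    using T small transfer_func_is_functor[OF gk cat D] unfolding preserves_small_colimits_def by blast
  also have "func_comp T (transfer_func g k J D) = transfer_func g k J (func_comp T D)"
    by (simp add: func_comp_def transfer_func_def)
  finally have "is_colimit_cocone J E (func_comp T D) (FObj T c) (\<lambda>j. FArr T (?\<iota> (g j)))"
    by (simp add: transfer_colimit_cocone[OF gk cat])
  then show ?thesis by (rule is_colimit_cocone_cong[OF cat]) (simp add: gk)
qed

lemma small_prod_cat:
  "small_category \<kappa> J \<Longrightarrow> small_category \<kappa> K \<Longrightarrow> small_category \<kappa> (prod_cat J K)"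
proof -
  assume JK: "small_category \<kappa> J" "small_category \<kappa> K"
  interpret J: category J using JK by (simp add: small_category_def)
  interpret K: category K using JK by (simp add: small_category_def)
  have "category (prod_cat J K)"
    by unfold_locales (auto simp: prod_cat_def in_hom_def)
  then show ?thesis using JK by (simp add: small_category_def prod_cat_def small_Sigma)
qed

end


section \<open>Colimits of small sets\<close>

lemma category_SetC: "category (SetC \<kappa>)"
  by unfold_locales
    (auto simp: SetC_def in_hom_def image_subset_iff intro!: set_map.equality ext)

text \<open>The object set \<open>colimOb\<close> is a chosen colimit, so it has its universal
  property only once some colimit is known to exist; one is built here as a quotient of the disjoint
  union.\<close>

lemma SetC_cocomplete:
  fixes J :: "('i, 'k) cat"
  assumes \<kappa>: "size_bound \<kappa>" and J: "small_category \<kappa> J" and D: "is_functor J (SetC \<kappa>) D"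
  shows "\<exists>c. is_colimit J (SetC \<kappa>) D c"
proof -
  interpret J: category J using J by (simp add: small_category_def)
  let ?A = "FObj D"
  have A: "small \<kappa> (?A j)" if "j \<in> Obj J" for j
    using D that by (simp add: is_functor_def SetC_def)
  have Df: "SDom (FArr D f) = ?A (Dom J f)" "SCod (FArr D f) = ?A (Cod J f)"
    "x \<in> ?A (Dom J f) \<Longrightarrow> SFun (FArr D f) x \<in> ?A (Cod J f)" if "f \<in> Arr J" for f x
  proof -
    have "in_hom (SetC \<kappa>) (FArr D f) (?A (Dom J f)) (?A (Cod J f))"
      using D that by (simp add: is_functor_def)
    then show "SDom (FArr D f) = ?A (Dom J f)" "SCod (FArr D f) = ?A (Cod J f)"
      "x \<in> ?A (Dom J f) \<Longrightarrow> SFun (FArr D f) x \<in> ?A (Cod J f)"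
      by (auto simp: in_hom_def SetC_def image_subset_iff)
  qed
  \<comment> \<open>Families with values in the type of elements are enough as tests, because the
    vertex of a cocone is a set of elements of this same type.\<close>
  define compat :: "('i \<Rightarrow> 'a \<Rightarrow> 'a) \<Rightarrow> bool" where
    "compat \<phi> \<longleftrightarrow> (\<forall>f\<in>Arr J. \<forall>x\<in>?A (Dom J f). \<phi> (Cod J f) (SFun (FArr D f) x) = \<phi> (Dom J f) x)" for \<phi>
  \<comment> \<open>Two elements are identified iff every compatible family of functions does so; this spares the
    generated equivalence relation.\<close>
  define cl where "cl = (\<lambda>(j, x). {(i, y) \<in> Sigma (Obj J) ?A. \<forall>\<phi>. compat \<phi> \<longrightarrow> \<phi> i y = \<phi> j x})"
  let ?Q = "cl ` Sigma (Obj J) ?A"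
  have cl_eq: "\<phi> i y = \<phi> j x"
    if "compat \<phi>" "i \<in> Obj J" "y \<in> ?A i" "cl (i, y) = cl (j, x)" for \<phi> i y j x
  proof -
    have "(i, y) \<in> cl (i, y)" using that(2,3) by (simp add: cl_def)
    then have "(i, y) \<in> cl (j, x)" using that(4) by simp
    then have "\<forall>\<phi>. compat \<phi> \<longrightarrow> \<phi> i y = \<phi> j x" by (simp add: cl_def)
    then show ?thesis using that(1) by blast
  qed
  have "small \<kappa> (Sigma (Obj J) ?A)" using J A by (intro small_Sigma[OF \<kappa>]) (auto simp: small_category_def)
  then have Q: "small \<kappa> ?Q" by (rule small_image[OF \<kappa>])
  \<comment> \<open>The classes are sets of pairs, but an object of \<open>SetC\<close> must consist
    of elements of the given type; being few enough, the classes can be named by such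
    elements.\<close>
  then obtain e :: "('i \<times> 'a) set \<Rightarrow> 'a" where e: "inj_on e ?Q" using small_inj[OF \<kappa>] by blast
  define c where "c = e ` ?Q"
  have c: "small \<kappa> c" unfolding c_def by (rule small_image[OF \<kappa> Q])
  define \<iota> where
    "\<iota> j = \<lparr> SDom = ?A j, SCod = c, SFun = \<lambda>x. if x \<in> ?A j then e (cl (j, x)) else undefined \<rparr>" for j
  have "is_colimit_cocone J (SetC \<kappa>) D c \<iota>"
  proof (rule is_colimit_coconeI)
    have "cl (Cod J f, SFun (FArr D f) x) = cl (Dom J f, x)" if "f \<in> Arr J" "x \<in> ?A (Dom J f)" for f x
      using that by (auto simp: cl_def compat_def)
    then show "is_cocone J (SetC \<kappa>) D c \<iota>"
      using c A Df by (auto simp: is_cocone_def SetC_def in_hom_def \<iota>_def c_def)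
  next
    fix d \<delta> assume \<delta>: "is_cocone J (SetC \<kappa>) D d \<delta>"
    have \<delta>j: "SDom (\<delta> j) = ?A j" "SCod (\<delta> j) = d" "x \<in> ?A j \<Longrightarrow> SFun (\<delta> j) x \<in> d"
      "x \<notin> ?A j \<Longrightarrow> SFun (\<delta> j) x = undefined"
      if "j \<in> Obj J" for j x
      using \<delta> that by (auto simp: is_cocone_def SetC_def in_hom_def image_subset_iff)
    define \<phi> where "\<phi> j = SFun (\<delta> j)" for j
    have comp: "compat \<phi>"
      unfolding compat_def
    proof (intro ballI)
      fix f x assume f: "f \<in> Arr J" and x: "x \<in> ?A (Dom J f)"
      have "\<delta> (Cod J f) \<cdot>\<^bsub>SetC \<kappa>\<^esub> FArr D f = \<delta> (Dom J f)" using \<delta> f by (simp add: is_cocone_def)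
      then have "SFun (\<delta> (Cod J f) \<cdot>\<^bsub>SetC \<kappa>\<^esub> FArr D f) x = SFun (\<delta> (Dom J f)) x" by simp
      then show "\<phi> (Cod J f) (SFun (FArr D f) x) = \<phi> (Dom J f) x"
        using f x Df[OF f] by (simp add: SetC_def \<phi>_def)
    qed
    \<comment> \<open>A representative of the class named by \<open>z\<close>; the value of
      \<open>h\<close> does not depend on it, by \<open>cl_eq\<close> for the compatible family
      \<open>\<phi>\<close>.\<close>
    define p where "p z = (SOME p. p \<in> Sigma (Obj J) ?A \<and> e (cl p) = z)" for z
    define h where
      "h = \<lparr> SDom = c, SCod = d,
         SFun = \<lambda>z. if z \<in> c then \<phi> (fst (p z)) (snd (p z)) else undefined \<rparr>"
    have p: "p z \<in> Sigma (Obj J) ?A \<and> e (cl (p z)) = z" if "z \<in> c" for z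
    proof -
      have "\<exists>p. p \<in> Sigma (Obj J) ?A \<and> e (cl p) = z" using that by (auto simp: c_def)
      then show ?thesis unfolding p_def by (rule someI_ex)
    qed
    have h: "SFun h (e (cl (j, x))) = \<phi> j x" if "j \<in> Obj J" "x \<in> ?A j" for j x
    proof -
      have z: "e (cl (j, x)) \<in> c" using that by (auto simp: c_def)
      obtain i y where py: "p (e (cl (j, x))) = (i, y)" by force
      with p[OF z] have iy: "i \<in> Obj J" "y \<in> ?A i" "e (cl (i, y)) = e (cl (j, x))" by auto
      then have "cl (i, y) = cl (j, x)" using e that by (auto simp: inj_on_def)
      with cl_eq[OF comp iy(1,2)] show ?thesis using z py by (simp add: h_def)
    qed
    have "in_hom (SetC \<kappa>) h c d"
      using c \<delta> p \<delta>j(3) by (fastforce simp: in_hom_def SetC_def h_def is_cocone_def \<phi>_def)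
    moreover have "h \<cdot>\<^bsub>SetC \<kappa>\<^esub> \<iota> j = \<delta> j" if "j \<in> Obj J" for j
    proof -
      have "SFun (h \<cdot>\<^bsub>SetC \<kappa>\<^esub> \<iota> j) = SFun (\<delta> j)"
        using h[OF that] \<delta>j[OF that] by (auto simp: SetC_def \<iota>_def \<phi>_def)
      then show ?thesis using \<delta>j[OF that] by (simp add: SetC_def \<iota>_def h_def)
    qed
    ultimately show "\<exists>h. in_hom (SetC \<kappa>) h c d \<and> (\<forall>j\<in>Obj J. h \<cdot>\<^bsub>SetC \<kappa>\<^esub> \<iota> j = \<delta> j)" by blast
  next
    fix d f g assume f: "in_hom (SetC \<kappa>) f c d" and g: "in_hom (SetC \<kappa>) g c d"
      and eq: "\<And>j. j \<in> Obj J \<Longrightarrow> f \<cdot>\<^bsub>SetC \<kappa>\<^esub> \<iota> j = g \<cdot>\<^bsub>SetC \<kappa>\<^esub> \<iota> j"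
    have "SFun f z = SFun g z" for z
    proof (cases "z \<in> c")
      case True
      then obtain j x where jx: "j \<in> Obj J" "x \<in> ?A j" "z = e (cl (j, x))" by (auto simp: c_def)
      from eq[OF jx(1)] have "SFun (f \<cdot>\<^bsub>SetC \<kappa>\<^esub> \<iota> j) x = SFun (g \<cdot>\<^bsub>SetC \<kappa>\<^esub> \<iota> j) x" by simp
      then show ?thesis using jx by (simp add: SetC_def \<iota>_def)
    qed (use f g in \<open>simp add: in_hom_def SetC_def\<close>)
    then have "SFun f = SFun g" by blast
    then show "f = g" using f g by (simp add: in_hom_def SetC_def)
  qed
  then show ?thesis by (auto simp: is_colimit_def)
qed


section \<open>Coherence of units\<close>

context monoidal_category
begin

declare Ten_in [simp] Unt_in [simp]

lemma arr_TenA [simp]: "f \<in> Arr V \<Longrightarrow> g \<in> Arr V \<Longrightarrow> f \<boxtimes> g \<in> Arr V"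
  and Dom_TenA [simp]: "f \<in> Arr V \<Longrightarrow> g \<in> Arr V \<Longrightarrow> Dom V (f \<boxtimes> g) = Dom V f \<otimes> Dom V g"
  and Cod_TenA [simp]: "f \<in> Arr V \<Longrightarrow> g \<in> Arr V \<Longrightarrow> Cod V (f \<boxtimes> g) = Cod V f \<otimes> Cod V g"
  using TenA_in_hom[of f _ _ g] by (auto simp: in_hom_def)

lemma TenA_interchange [simp]:
  "f \<in> Arr V \<Longrightarrow> f' \<in> Arr V \<Longrightarrow> g \<in> Arr V \<Longrightarrow> g' \<in> Arr V \<Longrightarrow> Cod V f = Dom V f' \<Longrightarrow> Cod V g = Dom V g'
    \<Longrightarrow> (f' \<boxtimes> g') \<cdot> (f \<boxtimes> g) = (f' \<cdot> f) \<boxtimes> (g' \<cdot> g)"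
  using TenA_Cmp by (simp add: in_hom_def)

text \<open>Applies an equation at the head of a right-nested composite, where \<open>assoc\<close>
  has broken up its left-hand side \<open>g' \<cdot> g\<close>.\<close>

lemma Cmp_tail:
  "g' \<cdot> g = h \<Longrightarrow> x \<in> Arr V \<Longrightarrow> g \<in> Arr V \<Longrightarrow> g' \<in> Arr V \<Longrightarrow> Cod V x = Dom V g \<Longrightarrow> Cod V g = Dom V g'
    \<Longrightarrow> g' \<cdot> (g \<cdot> x) = h \<cdot> x"
  using assoc[of x g g'] by simp

lemma TenA_interchange_tail [simp]:
  "f \<in> Arr V \<Longrightarrow> f' \<in> Arr V \<Longrightarrow> g \<in> Arr V \<Longrightarrow> g' \<in> Arr V \<Longrightarrow> x \<in> Arr V
    \<Longrightarrow> Cod V f = Dom V f' \<Longrightarrow> Cod V g = Dom V g' \<Longrightarrow> Cod V x = Dom V f \<otimes> Dom V g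
    \<Longrightarrow> (f' \<boxtimes> g') \<cdot> ((f \<boxtimes> g) \<cdot> x) = ((f' \<cdot> f) \<boxtimes> (g' \<cdot> g)) \<cdot> x"
  by (rule Cmp_tail) auto

declare TenA_Ide [simp] Asc_iso [simp] LUn_iso [simp] RUn_iso [simp]

lemma arr_Asc [simp]: "A \<in> Obj V \<Longrightarrow> B \<in> Obj V \<Longrightarrow> D \<in> Obj V \<Longrightarrow> Asc V A B D \<in> Arr V"
  and Dom_Asc [simp]: "A \<in> Obj V \<Longrightarrow> B \<in> Obj V \<Longrightarrow> D \<in> Obj V \<Longrightarrow> Dom V (Asc V A B D) = A \<otimes> B \<otimes> D"
  and Cod_Asc [simp]: "A \<in> Obj V \<Longrightarrow> B \<in> Obj V \<Longrightarrow> D \<in> Obj V \<Longrightarrow> Cod V (Asc V A B D) = A \<otimes> (B \<otimes> D)"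
  using Asc_in_hom[of A B D] by (auto simp: in_hom_def)

lemma arr_LUn [simp]: "A \<in> Obj V \<Longrightarrow> LUn V A \<in> Arr V"
  and Dom_LUn [simp]: "A \<in> Obj V \<Longrightarrow> Dom V (LUn V A) = Unt V \<otimes> A"
  and Cod_LUn [simp]: "A \<in> Obj V \<Longrightarrow> Cod V (LUn V A) = A"
  using LUn_in_hom[of A] by (auto simp: in_hom_def)

lemma arr_RUn [simp]: "A \<in> Obj V \<Longrightarrow> RUn V A \<in> Arr V"
  and Dom_RUn [simp]: "A \<in> Obj V \<Longrightarrow> Dom V (RUn V A) = A \<otimes> Unt V"
  and Cod_RUn [simp]: "A \<in> Obj V \<Longrightarrow> Cod V (RUn V A) = A"
  using RUn_in_hom[of A] by (auto simp: in_hom_def)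

lemma Asc_nat:
  "f \<in> Arr V \<Longrightarrow> g \<in> Arr V \<Longrightarrow> h \<in> Arr V \<Longrightarrow> Cod V f = A \<Longrightarrow> Cod V g = B \<Longrightarrow> Cod V h = D
    \<Longrightarrow> Asc V A B D \<cdot> (f \<boxtimes> g \<boxtimes> h) = (f \<boxtimes> (g \<boxtimes> h)) \<cdot> Asc V (Dom V f) (Dom V g) (Dom V h)"
  using Asc_natural[of f _ A g _ B h _ D] by (simp add: in_hom_def)

lemma LUn_nat: "f \<in> Arr V \<Longrightarrow> Cod V f = A \<Longrightarrow> LUn V A \<cdot> (Ide V (Unt V) \<boxtimes> f) = f \<cdot> LUn V (Dom V f)"
  using LUn_natural[of f _ A] by (simp add: in_hom_def)

lemma RUn_nat: "f \<in> Arr V \<Longrightarrow> Cod V f = A \<Longrightarrow> RUn V A \<cdot> (f \<boxtimes> Ide V (Unt V)) = f \<cdot> RUn V (Dom V f)"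
  using RUn_natural[of f _ A] by (simp add: in_hom_def)

lemma is_iso_TenA [simp]: "is_iso V f \<Longrightarrow> is_iso V g \<Longrightarrow> is_iso V (f \<boxtimes> g)"
  by (rule is_isoI[of _ "inv_arr V f \<boxtimes> inv_arr V g"]) (simp_all add: is_iso_arr)

text \<open>By naturality of the left unitor, tensoring with the unit is conjugation by invertible
  arrows and loses nothing. Coherence of units can thus be tested after adding a unit factor, where
  pentagon and triangle apply.\<close>

lemma Unt_TenA_faithful:
  assumes "f \<in> Arr V" "g \<in> Arr V" "Dom V f = Dom V g" "Cod V f = Cod V g"
    "Ide V (Unt V) \<boxtimes> f = Ide V (Unt V) \<boxtimes> g"
  shows "f = g"
  by (rule iso_cancel_right[of "LUn V (Dom V f)"]) 
    (use assms LUn_nat[of f "Cod V f"] LUn_nat[of g "Cod V f"] in auto)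

lemma TenA_Unt_faithful:
  assumes "f \<in> Arr V" "g \<in> Arr V" "Dom V f = Dom V g" "Cod V f = Cod V g"
    "f \<boxtimes> Ide V (Unt V) = g \<boxtimes> Ide V (Unt V)"
  shows "f = g"
  by (rule iso_cancel_right[of "RUn V (Dom V f)"]) 
    (use assms RUn_nat[of f "Cod V f"] RUn_nat[of g "Cod V f"] in auto)

text \<open>Kelly's derivation from the axioms: pentagon and triangle for the objects
  \<open>1, 1, A, B\<close> give the equation with an additional unit on the left. It settles the
  case of \<open>theta_assoc\<close> in which the first string is empty.\<close>

lemma LUn_Ten:
  assumes A: "A \<in> Obj V" and B: "B \<in> Obj V"
  shows "LUn V (A \<otimes> B) \<cdot> Asc V (Unt V) A B = LUn V A \<boxtimes> Ide V B"
proof (rule Unt_TenA_faithful)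
  let ?U = "Unt V" and ?x = "LUn V (A \<otimes> B) \<cdot> Asc V (Unt V) A B"
  \<comment> \<open>With \<open>Ide V ?U \<boxtimes> Asc V ?U A B\<close> in front, this invertible
    arrow becomes the three-arrow side of the pentagon.\<close>
  let ?e = "Asc V ?U (?U \<otimes> A) B \<cdot> (Asc V ?U ?U A \<boxtimes> Ide V B)"
  show "Ide V ?U \<boxtimes> ?x = Ide V ?U \<boxtimes> (LUn V A \<boxtimes> Ide V B)"
  proof (rule iso_cancel_right[of ?e])
    have "(Ide V ?U \<boxtimes> ?x) \<cdot> ?e
        = (Ide V ?U \<boxtimes> LUn V (A \<otimes> B)) \<cdot> ((Ide V ?U \<boxtimes> Asc V ?U A B) \<cdot> ?e)"
      using A B by simp
    also have "\<dots> = (Ide V ?U \<boxtimes> LUn V (A \<otimes> B)) \<cdot> (Asc V ?U ?U (A \<otimes> B) \<cdot> Asc V (?U \<otimes> ?U) A B)"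
      using A B by (subst pentagon) auto
    also have "\<dots> = (RUn V ?U \<boxtimes> (Ide V A \<boxtimes> Ide V B)) \<cdot> Asc V (?U \<otimes> ?U) A B"
      using A B by (subst Cmp_tail[OF triangle]) auto
    also have "\<dots> = Asc V ?U A B \<cdot> (RUn V ?U \<boxtimes> Ide V A \<boxtimes> Ide V B)"
      using A B by (subst Asc_nat) auto
    also have "\<dots> = Asc V ?U A B \<cdot> ((Ide V ?U \<boxtimes> LUn V A \<boxtimes> Ide V B) \<cdot> (Asc V ?U ?U A \<boxtimes> Ide V B))"
      using A B by (simp add: triangle)
    also have "\<dots> = (Ide V ?U \<boxtimes> (LUn V A \<boxtimes> Ide V B)) \<cdot> ?e"
      using A B by (subst Cmp_tail[OF Asc_nat]) auto
    finally show "(Ide V ?U \<boxtimes> ?x) \<cdot> ?e = (Ide V ?U \<boxtimes> (LUn V A \<boxtimes> Ide V B)) \<cdot> ?e" .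
  qed (use A B in auto)
qed (use A B in auto)

text \<open>The mirror image, from the pentagon for \<open>A, B, 1, 1\<close> with a unit added on
  the right. It settles the case of \<open>theta_assoc\<close> in which the third string is
  empty.\<close>

lemma RUn_Ten:
  assumes A: "A \<in> Obj V" and B: "B \<in> Obj V"
  shows "(Ide V A \<boxtimes> RUn V B) \<cdot> Asc V A B (Unt V) = RUn V (A \<otimes> B)"
proof (rule TenA_Unt_faithful)
  let ?U = "Unt V" and ?x = "(Ide V A \<boxtimes> RUn V B) \<cdot> Asc V A B (Unt V)"
  show "?x \<boxtimes> Ide V ?U = RUn V (A \<otimes> B) \<boxtimes> Ide V ?U"
  proof (rule iso_cancel_left[of "Asc V A B ?U"])
    have "Asc V A B ?U \<cdot> (?x \<boxtimes> Ide V ?U)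
        = Asc V A B ?U \<cdot> ((Ide V A \<boxtimes> RUn V B \<boxtimes> Ide V ?U) \<cdot> (Asc V A B ?U \<boxtimes> Ide V ?U))"
      using A B by simp
    also have "\<dots> = (Ide V A \<boxtimes> (RUn V B \<boxtimes> Ide V ?U)) \<cdot>
        (Asc V A (B \<otimes> ?U) ?U \<cdot> (Asc V A B ?U \<boxtimes> Ide V ?U))"
      using A B by (subst Cmp_tail[OF Asc_nat]) auto
    also have "\<dots> = (Ide V A \<boxtimes> (Ide V B \<boxtimes> LUn V ?U)) \<cdot> ((Ide V A \<boxtimes> Asc V B ?U ?U) \<cdot>
        (Asc V A (B \<otimes> ?U) ?U \<cdot> (Asc V A B ?U \<boxtimes> Ide V ?U)))"
      using A B by (simp add: triangle)
    also have "\<dots> = (Ide V A \<boxtimes> (Ide V B \<boxtimes> LUn V ?U)) \<cdot> (Asc V A B (?U \<otimes> ?U) \<cdot> Asc V (A \<otimes> B) ?U ?U)"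
      using A B by (subst pentagon) auto
    also have "\<dots> = Asc V A B ?U \<cdot> ((Ide V A \<boxtimes> Ide V B \<boxtimes> LUn V ?U) \<cdot> Asc V (A \<otimes> B) ?U ?U)"
      using A B by (subst Cmp_tail[OF Asc_nat]) (auto simp del: TenA_Ide)
    also have "\<dots> = Asc V A B ?U \<cdot> (RUn V (A \<otimes> B) \<boxtimes> Ide V ?U)"
      using A B by (simp add: triangle)
    finally show "Asc V A B ?U \<cdot> (?x \<boxtimes> Ide V ?U) = Asc V A B ?U \<cdot> (RUn V (A \<otimes> B) \<boxtimes> Ide V ?U)" .
  qed (use A B in auto)
qed (use A B in auto)

text \<open>Naturality of the left unitor at itself turns \<open>LUn V (?U \<otimes> ?U)\<close>
  into \<open>Ide V ?U \<boxtimes> LUn V ?U\<close>, after which \<open>LUn_Ten\<close> and the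
  triangle describe the same arrow. It makes the two unitor cases of \<open>theta\<close> agree on a
  pair of empty strings.\<close>

lemma LUn_Unt: "LUn V (Unt V) = RUn V (Unt V)"
proof (rule TenA_Unt_faithful)
  let ?U = "Unt V"
  have "LUn V (?U \<otimes> ?U) = Ide V ?U \<boxtimes> LUn V ?U"
    by (rule iso_cancel_left[of "LUn V ?U"]) (auto simp: LUn_nat)
  then show "LUn V ?U \<boxtimes> Ide V ?U = RUn V ?U \<boxtimes> Ide V ?U"
    using LUn_Ten[of ?U ?U] triangle[of ?U ?U] by simp
qed auto


section \<open>Tensor products of colimits\<close>

text \<open>Stated for arbitrary diagrams so that it can be iterated: \<open>ev2\<close> is the case
  of two evaluations, and one more factor yields the diagram behind associativity.\<close>

definition ten_func ::
  "('i, 'k, 'o, 'm) func \<Rightarrow> ('j, 'l, 'o, 'm) func \<Rightarrow> ('i \<times> 'j, 'k \<times> 'l, 'o, 'm) func" where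
  "ten_func D E = \<lparr> FObj = \<lambda>(t, s). FObj D t \<otimes> FObj E s, FArr = \<lambda>(\<beta>, \<alpha>). FArr D \<beta> \<boxtimes> FArr E \<alpha> \<rparr>"

lemma is_functor_ten_func:
  "is_functor J V D \<Longrightarrow> is_functor K V E \<Longrightarrow> is_functor (prod_cat J K) V (ten_func D E)"
  by (auto simp: is_functor_def prod_cat_def ten_func_def in_hom_def)

text \<open>Preservation in each variable separately suffices because a cocone over a product can be
  mediated one variable at a time: along \<open>K\<close> with \<open>t\<close> fixed, out of
  \<open>FObj D t \<otimes> e\<close>, and along \<open>J\<close> afterwards.\<close>

lemma tensor_colimit:
  fixes J :: "('i, 'k) cat" and K :: "('j, 'l) cat"
  assumes \<kappa>: "size_bound \<kappa>" and coc: "tensor_cocontinuous \<kappa> V"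
    and J: "small_category \<kappa> J" and K: "small_category \<kappa> K"
    and D: "is_functor J V D" and E: "is_functor K V E"
    and c: "is_colimit_cocone J V D c \<iota>" and e: "is_colimit_cocone K V E e \<epsilon>"
  shows "is_colimit_cocone (prod_cat J K) V (ten_func D E) (c \<otimes> e) (\<lambda>(t, s). \<iota> t \<boxtimes> \<epsilon> s)"
proof -
  interpret J: category J using J by (simp add: small_category_def)
  interpret K: category K using K by (simp add: small_category_def)
  note cats = category_axioms J.category_axioms K.category_axioms
  have coc1: "is_cocone J V D c \<iota>" and coc2: "is_cocone K V E e \<epsilon>"
    using c e by (auto simp: is_colimit_cocone_def)
  have c_obj [simp]: "c \<in> Obj V" and e_obj [simp]: "e \<in> Obj V"
    using coc1 coc2 by (auto simp: is_cocone_def)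
  have D_obj [simp]: "FObj D j \<in> Obj V" if "j \<in> Obj J" for j using D that by (simp add: is_functor_def)
  have E_obj [simp]: "FObj E j \<in> Obj V" if "j \<in> Obj K" for j using E that by (simp add: is_functor_def)
  have D_arr [simp]: "FArr D f \<in> Arr V" "Dom V (FArr D f) = FObj D (Dom J f)"
    "Cod V (FArr D f) = FObj D (Cod J f)" if "f \<in> Arr J" for f
    using D that by (auto simp: is_functor_def in_hom_def)
  have E_arr [simp]: "FArr E f \<in> Arr V" "Dom V (FArr E f) = FObj E (Dom K f)"
    "Cod V (FArr E f) = FObj E (Cod K f)" if "f \<in> Arr K" for f
    using E that by (auto simp: is_functor_def in_hom_def)
  have D_Ide [simp]: "FArr D (Ide J j) = Ide V (FObj D j)" if "j \<in> Obj J" for j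
    using D that by (simp add: is_functor_def)
  have E_Ide [simp]: "FArr E (Ide K j) = Ide V (FObj E j)" if "j \<in> Obj K" for j
    using E that by (simp add: is_functor_def)
  have \<iota> [simp]: "\<iota> j \<in> Arr V" "Dom V (\<iota> j) = FObj D j" "Cod V (\<iota> j) = c" if "j \<in> Obj J" for j
    using coc1 that by (auto simp: is_cocone_def in_hom_def)
  have \<epsilon> [simp]: "\<epsilon> j \<in> Arr V" "Dom V (\<epsilon> j) = FObj E j" "Cod V (\<epsilon> j) = e" if "j \<in> Obj K" for j
    using coc2 that by (auto simp: is_cocone_def in_hom_def)
  have \<iota>_nat [simp]: "\<iota> (Cod J f) \<cdot> FArr D f = \<iota> (Dom J f)" if "f \<in> Arr J" for f
    using coc1 that by (auto simp: is_cocone_def)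
  have \<epsilon>_nat [simp]: "\<epsilon> (Cod K f) \<cdot> FArr E f = \<epsilon> (Dom K f)" if "f \<in> Arr K" for f
    using coc2 that by (auto simp: is_cocone_def)
  let ?L = "\<lambda>j. func_comp (tensor_left V (FObj D j)) E" and ?R = "func_comp (tensor_right V e) D"
  have L: "is_colimit_cocone K V (?L j) (FObj D j \<otimes> e) (\<lambda>s. Ide V (FObj D j) \<boxtimes> \<epsilon> s)"
    and fL: "is_functor K V (?L j)" if "j \<in> Obj J" for j
  proof -
    have "preserves_small_colimits \<kappa> V V (tensor_left V (FObj D j))"
      using coc that by (simp add: tensor_cocontinuous_def)
    from preserves_colimit[OF \<kappa> this K E e]
    show "is_colimit_cocone K V (?L j) (FObj D j \<otimes> e) (\<lambda>s. Ide V (FObj D j) \<boxtimes> \<epsilon> s)"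
      by (simp add: tensor_left_def)
    show "is_functor K V (?L j)"
      using E that by (auto simp: is_functor_def func_comp_def tensor_left_def in_hom_def)
  qed
  have R: "is_colimit_cocone J V ?R (c \<otimes> e) (\<lambda>t. \<iota> t \<boxtimes> Ide V e)" and fR: "is_functor J V ?R"
  proof -
    have "preserves_small_colimits \<kappa> V V (tensor_right V e)"
      using coc by (simp add: tensor_cocontinuous_def)
    from preserves_colimit[OF \<kappa> this J D c]
    show "is_colimit_cocone J V ?R (c \<otimes> e) (\<lambda>t. \<iota> t \<boxtimes> Ide V e)"
      by (simp add: tensor_right_def)
    show "is_functor J V ?R"
      using D by (auto simp: is_functor_def func_comp_def tensor_right_def in_hom_def)
  qed
  show ?thesis
  proof (rule is_colimit_coconeI)
    show "is_cocone (prod_cat J K) V (ten_func D E) (c \<otimes> e) (\<lambda>(t, s). \<iota> t \<boxtimes> \<epsilon> s)"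
      by (auto simp: is_cocone_def prod_cat_def ten_func_def in_hom_def)
  next
    fix d \<delta> assume \<delta>: "is_cocone (prod_cat J K) V (ten_func D E) d \<delta>"
    have d [simp]: "d \<in> Obj V" using \<delta> by (simp add: is_cocone_def)
    have \<delta>_arr [simp]: "\<delta> (t, s) \<in> Arr V" "Dom V (\<delta> (t, s)) = FObj D t \<otimes> FObj E s" "Cod V (\<delta> (t, s)) = d"
      if "t \<in> Obj J" "s \<in> Obj K" for t s
      using \<delta> that by (auto simp: is_cocone_def prod_cat_def ten_func_def in_hom_def)
    have \<delta>_nat: "\<delta> (Cod J f, Cod K g) \<cdot> (FArr D f \<boxtimes> FArr E g) = \<delta> (Dom J f, Dom K g)"
      if "f \<in> Arr J" "g \<in> Arr K" for f g
      using \<delta> that by (auto simp: is_cocone_def prod_cat_def ten_func_def)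
    have "\<exists>h. in_hom V h (FObj D t \<otimes> e) d \<and> (\<forall>s\<in>Obj K. h \<cdot> (Ide V (FObj D t) \<boxtimes> \<epsilon> s) = \<delta> (t, s))"
      if t: "t \<in> Obj J" for t
    proof -
      \<comment> \<open>Naturality in \<open>s\<close> alone is naturality of
        \<open>\<delta>\<close> at the identity of \<open>t\<close>.\<close>
      have "is_cocone K V (?L t) d (\<lambda>s. \<delta> (t, s))"
        using t \<delta>_nat[of "Ide J t"]
        by (auto simp: is_cocone_def func_comp_def tensor_left_def in_hom_def)
      with L[OF t] show ?thesis unfolding is_colimit_cocone_def by (blast dest: ex1_implies_ex)
    qed
    then obtain h where h: "\<And>t. t \<in> Obj J \<Longrightarrow> in_hom V (h t) (FObj D t \<otimes> e) d"
      and h\<epsilon>: "\<And>t s. t \<in> Obj J \<Longrightarrow> s \<in> Obj K \<Longrightarrow> h t \<cdot> (Ide V (FObj D t) \<boxtimes> \<epsilon> s) = \<delta> (t, s)"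
      by metis
    have h_arr [simp]: "h t \<in> Arr V" "Dom V (h t) = FObj D t \<otimes> e" "Cod V (h t) = d" if "t \<in> Obj J" for t
      using h[OF that] by (auto simp: in_hom_def)
    \<comment> \<open>The arrows \<open>h t\<close> form a cocone in \<open>t\<close>: this is
      tested on the legs of the inner colimit, where it is naturality of
      \<open>\<delta>\<close>.\<close>
    have "h (Cod J f) \<cdot> (FArr D f \<boxtimes> Ide V e) = h (Dom J f)" if f: "f \<in> Arr J" for f
    proof (rule colimit_ext[OF L fL cats(1,3)])
      fix s assume s: "s \<in> Obj K"
      have "h (Cod J f) \<cdot> (FArr D f \<boxtimes> Ide V e) \<cdot> (Ide V (FObj D (Dom J f)) \<boxtimes> \<epsilon> s)
          = (h (Cod J f) \<cdot> (Ide V (FObj D (Cod J f)) \<boxtimes> \<epsilon> s)) \<cdot> (FArr D f \<boxtimes> Ide V (FObj E s))"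
        using f s by simp
      also have "\<dots> = \<delta> (Dom J f, s)"
        using f s \<delta>_nat[OF f, of "Ide K s"] by (simp add: h\<epsilon> del: assoc)
      finally show "(h (Cod J f) \<cdot> (FArr D f \<boxtimes> Ide V e)) \<cdot> (Ide V (FObj D (Dom J f)) \<boxtimes> \<epsilon> s)
          = h (Dom J f) \<cdot> (Ide V (FObj D (Dom J f)) \<boxtimes> \<epsilon> s)"
        using f s by (simp add: h\<epsilon>)
    qed (use f in \<open>auto simp: in_hom_def\<close>)
    then have "is_cocone J V ?R d h"
      by (auto simp: is_cocone_def func_comp_def tensor_right_def in_hom_def)
    with R obtain k where k: "in_hom V k (c \<otimes> e) d" "\<And>t. t \<in> Obj J \<Longrightarrow> k \<cdot> (\<iota> t \<boxtimes> Ide V e) = h t"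
      unfolding is_colimit_cocone_def by (blast dest: ex1_implies_ex)
    have "k \<cdot> (\<iota> t \<boxtimes> \<epsilon> s) = \<delta> (t, s)" if "t \<in> Obj J" "s \<in> Obj K" for t s
    proof -
      have "k \<cdot> (\<iota> t \<boxtimes> \<epsilon> s) = (k \<cdot> (\<iota> t \<boxtimes> Ide V e)) \<cdot> (Ide V (FObj D t) \<boxtimes> \<epsilon> s)"
        using that k(1) by (simp add: in_hom_def)
      then show ?thesis using that by (simp add: k(2) h\<epsilon> del: assoc)
    qed
    with k(1) show "\<exists>k. in_hom V k (c \<otimes> e) d
        \<and> (\<forall>p\<in>Obj (prod_cat J K). k \<cdot> (case p of (t, s) \<Rightarrow> \<iota> t \<boxtimes> \<epsilon> s) = \<delta> p)"
      by (auto simp: prod_cat_def)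
  next
    fix d f g
    assume f: "in_hom V f (c \<otimes> e) d" and g: "in_hom V g (c \<otimes> e) d"
      and eq: "\<And>p. p \<in> Obj (prod_cat J K) \<Longrightarrow>
        f \<cdot> (case p of (t, s) \<Rightarrow> \<iota> t \<boxtimes> \<epsilon> s) = g \<cdot> (case p of (t, s) \<Rightarrow> \<iota> t \<boxtimes> \<epsilon> s)"
    note f' = f[unfolded in_hom_def] and g' = g[unfolded in_hom_def]
    show "f = g"
    proof (rule colimit_ext[OF R fR cats(1,2) f g])
      fix t assume t: "t \<in> Obj J"
      show "f \<cdot> (\<iota> t \<boxtimes> Ide V e) = g \<cdot> (\<iota> t \<boxtimes> Ide V e)"
      proof (rule colimit_ext[OF L fL cats(1,3)])
        fix s assume s: "s \<in> Obj K"
        show "(f \<cdot> (\<iota> t \<boxtimes> Ide V e)) \<cdot> (Ide V (FObj D t) \<boxtimes> \<epsilon> s)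
            = (g \<cdot> (\<iota> t \<boxtimes> Ide V e)) \<cdot> (Ide V (FObj D t) \<boxtimes> \<epsilon> s)"
          using eq[of "(t, s)"] t s f' g' by (simp add: prod_cat_def)
      qed (use t f' g' in \<open>auto simp: in_hom_def\<close>)
    qed
  qed
qed

end


section \<open>Strictification\<close>

locale string_diagram = string_construction \<kappa> V I F + monoidal_category V
  for \<kappa> :: "'u rel" and V :: "('o, 'm) mcat" (structure) and I :: "('i, 'k) cat"
    and F :: "('i, 'k, ('u, 'o, 'm) vcat, ('u, 'o, 'm) vfun) func" +
  assumes bound: "size_bound \<kappa>"
    and cocomp: "cocomplete \<kappa> V"
    and cocont: "tensor_cocontinuous \<kappa> V"
    and small_I: "small_category \<kappa> I"
    and functor_F: "is_functor I (CatV \<kappa> V) F"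
begin

section \<open>Hom-objects of the diagram, evaluation of strings and the isomorphisms
  \<open>theta\<close>\<close>

lemma F_obj: "i \<in> Obj I \<Longrightarrow> enriched_category V (FObj F i)"
  and small_F_obj: "i \<in> Obj I \<Longrightarrow> small \<kappa> (vobj (FObj F i))"
  using functor_F by (auto simp: is_functor_def CatV_def)

lemma F_arr: "f \<in> Arr I \<Longrightarrow> enriched_functor V (FArr F f)"
  and vdom_F [simp]: "f \<in> Arr I \<Longrightarrow> vdom (FArr F f) = FObj F (Dom I f)"
  and vcod_F [simp]: "f \<in> Arr I \<Longrightarrow> vcod (FArr F f) = FObj F (Cod I f)"
  using functor_F by (auto simp: is_functor_def CatV_def in_hom_def)

lemma category_I: "category I"
  using small_I by (simp add: small_category_def)

sublocale I: category I by (rule category_I)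

lemma omap_F [simp]:
  "f \<in> Arr I \<Longrightarrow> x \<in> vobj (FObj F (Dom I f)) \<Longrightarrow> omap (FArr F f) x \<in> vobj (FObj F (Cod I f))"
  using enriched_functor.omap_in[OF F_arr] by simp

lemma hmap_F [simp]:
  assumes "f \<in> Arr I" "x \<in> vobj (FObj F (Dom I f))" "y \<in> vobj (FObj F (Dom I f))"
  shows "hmap (FArr F f) x y \<in> Arr V"
    and "Dom V (hmap (FArr F f) x y) = vhom (FObj F (Dom I f)) x y"
    and "Cod V (hmap (FArr F f) x y) = vhom (FObj F (Cod I f)) (omap (FArr F f) x) (omap (FArr F f) y)"
  using enriched_functor.hmap_in_hom[OF F_arr[OF assms(1)], of x y] assms by (auto simp: in_hom_def)

lemma ev_edge_obj [simp]: "is_edge e \<Longrightarrow> ev_edge e \<in> Obj V"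
  using enriched_category.vhom_in[OF F_obj] by (cases e) auto

text \<open>Consecutive edges need not match: evaluation and \<open>theta\<close> see only the
  hom-object of each edge, so coherence holds for all lists of edges and no endpoints have to be
  carried along.\<close>

definition valid :: "('i, 'u) strng \<Rightarrow> bool" where
  "valid s \<longleftrightarrow> (\<forall>e\<in>set s. is_edge e)"

lemma valid_lists: "valid s \<longleftrightarrow> s \<in> lists {e. is_edge e}"
  unfolding valid_def lists_eq_set by blast

lemma valid_simps [simp]: "valid []" "valid (e # s) \<longleftrightarrow> is_edge e \<and> valid s"
  "valid (t \<star> s) \<longleftrightarrow> valid t \<and> valid s"
  by (auto simp: valid_def star_def)

lemma star_simps [simp]: "t \<star> [] = t" "[] \<star> s = s" "(t \<star> u) \<star> s = t \<star> u \<star> s" "t \<star> (e # s) = e # (t \<star> s)"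
    "t \<star> s = [] \<longleftrightarrow> t = [] \<and> s = []"
  by (auto simp: star_def)

lemma ev_str_Cons [simp]: "s \<noteq> [] \<Longrightarrow> ev_str (e # s) = ev_str s \<otimes> ev_edge e"
  by (cases s) auto

lemma ev_str_obj [simp]: "valid s \<Longrightarrow> ev_str s \<in> Obj V"
  by (induction s rule: ev_str.induct) auto

declare theta.simps(2) [simp del]

text \<open>Replaces the nested case distinction of the definition by one rule per case. By
  definition a pair of empty strings falls under the right unitor; the first rule covers it because
  of \<open>LUn_Unt\<close>.\<close>

lemma theta_simps [simp]:
  "theta [] s = LUn V (ev_str s)"
  "t \<noteq> [] \<Longrightarrow> theta t [e] = Ide V (ev_str t \<otimes> ev_edge e)"
  "t \<noteq> [] \<Longrightarrow> s \<noteq> [] \<Longrightarrow> theta t (e # s)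
     = (theta t s \<boxtimes> Ide V (ev_edge e)) \<cdot> inv_arr V (Asc V (ev_str t) (ev_str s) (ev_edge e))"
  by (cases s) (auto simp: LUn_Unt theta.simps(2))

lemma theta_iso_hom:
  "valid t \<Longrightarrow> valid s \<Longrightarrow> is_iso V (theta t s) \<and> Dom V (theta t s) = ev_str t \<otimes> ev_str s
     \<and> Cod V (theta t s) = ev_str (t \<star> s)"
proof (induction s)
  case (Cons e s)
  then have ih: "is_iso V (theta t s)" "Dom V (theta t s) = ev_str t \<otimes> ev_str s"
    "Cod V (theta t s) = ev_str (t \<star> s)" and e: "is_edge e" "valid s" "valid t" by auto
  show ?case
    using ih e by (cases "t = []"; cases "s = []") (simp_all add: is_iso_arr)
qed simp

lemma theta_iso [simp]: "valid t \<Longrightarrow> valid s \<Longrightarrow> is_iso V (theta t s)"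
  and theta_arr [simp]: "valid t \<Longrightarrow> valid s \<Longrightarrow> theta t s \<in> Arr V"
  and Dom_theta [simp]: "valid t \<Longrightarrow> valid s \<Longrightarrow> Dom V (theta t s) = ev_str t \<otimes> ev_str s"
  and Cod_theta [simp]: "valid t \<Longrightarrow> valid s \<Longrightarrow> Cod V (theta t s) = ev_str (t \<star> s)"
  using theta_iso_hom is_iso_arr by blast+

text \<open>Adding an edge to \<open>w\<close> tensors the square with
  \<open>Ide V (ev_edge e)\<close> on the right and inserts associators, whose mismatch is one
  instance of the pentagon. Empty strings lead to coherences of units instead.\<close>

lemma theta_assoc:
  assumes "valid u" "valid v" "valid w"
  shows "theta u (v \<star> w) \<cdot> ((Ide V (ev_str u) \<boxtimes> theta v w) \<cdot> Asc V (ev_str u) (ev_str v) (ev_str w))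
    = theta (u \<star> v) w \<cdot> (theta u v \<boxtimes> Ide V (ev_str w))"
  using assms(3)
proof (induction w)
  case Nil
  then show ?case using assms(1,2) by (simp add: RUn_Ten RUn_nat)
next
  case (Cons e w)
  then have e: "is_edge e" and w: "valid w" by auto
  note va = assms(1,2) e w
  let ?U = "ev_str u" and ?V = "ev_str v" and ?W = "ev_str w" and ?E = "ev_edge e"
  show ?case
  \<comment> \<open>With \<open>u\<close> or \<open>v\<close> empty the string \<open>e # w\<close>
    is kept whole, as coherence of units holds for any object in its place.\<close>
  proof (cases "u = [] \<or> v = []")
    case True
    then show ?thesis
    proof
      assume u: "u = []"
      let ?X = "ev_str (e # w)"
      have X: "?X \<in> Obj V" "valid (e # w)" using e w by auto
      have "theta u (v \<star> (e # w)) \<cdot> ((Ide V ?U \<boxtimes> theta v (e # w)) \<cdot> Asc V ?U ?V ?X)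
          = theta v (e # w) \<cdot> (LUn V (?V \<otimes> ?X) \<cdot> Asc V (Unt V) ?V ?X)"
        unfolding u theta_simps(1) ev_str.simps(1) using X va by (subst Cmp_tail[OF LUn_nat]) (auto simp del: star_simps(4) theta_simps(3) ev_str_Cons)
      also have "\<dots> = theta (u \<star> v) (e # w) \<cdot> (theta u v \<boxtimes> Ide V ?X)"
        using X va u by (simp add: LUn_Ten del: star_simps(4) theta_simps(3) ev_str_Cons)
      finally show ?thesis .
    next
      assume v: "v = []"
      let ?X = "ev_str (e # w)"
      have X: "?X \<in> Obj V" "valid (e # w)" using e w by auto
      then show ?thesis using va unfolding v
        by (simp add: triangle del: star_simps(4) theta_simps(2-) ev_str_Cons)
    qed
  next
    case False
    then have ne: "u \<noteq> []" "v \<noteq> []" by auto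
    show ?thesis
    proof (cases "w = []")
      \<comment> \<open>For a single edge, \<open>theta v [e]\<close> is an identity, and the
        associator cancels against its inverse in \<open>theta u (e # v)\<close>.\<close>
      case True
      with ne va show ?thesis by simp
    next
      case w_ne: False
      \<comment> \<open>The pentagon solved for inverse associators, the form in which they occur in
        \<open>theta\<close>.\<close>
      have pent: "inv_arr V (Asc V ?U (?V \<otimes> ?W) ?E) \<cdot> ((Ide V ?U \<boxtimes> inv_arr V (Asc V ?V ?W ?E))
            \<cdot> Asc V ?U ?V (?W \<otimes> ?E))
          = (Asc V ?U ?V ?W \<boxtimes> Ide V ?E) \<cdot> inv_arr V (Asc V (?U \<otimes> ?V) ?W ?E)" (is "?l = ?r")
      proof (rule iso_cancel_right[of "Asc V (?U \<otimes> ?V) ?W ?E"])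
        have "?l \<cdot> Asc V (?U \<otimes> ?V) ?W ?E = inv_arr V (Asc V ?U (?V \<otimes> ?W) ?E) \<cdot>
            ((Ide V ?U \<boxtimes> inv_arr V (Asc V ?V ?W ?E)) \<cdot> (Asc V ?U ?V (?W \<otimes> ?E) \<cdot> Asc V (?U \<otimes> ?V) ?W ?E))"
          using va by simp
        also have "\<dots> = ?r \<cdot> Asc V (?U \<otimes> ?V) ?W ?E"
          using va by (subst pentagon[symmetric]) auto
        finally show "?l \<cdot> Asc V (?U \<otimes> ?V) ?W ?E = ?r \<cdot> Asc V (?U \<otimes> ?V) ?W ?E" .
      qed (use va in auto)
      have inat: "inv_arr V (Asc V (Cod V f) (Cod V g) (Cod V h)) \<cdot> (f \<boxtimes> (g \<boxtimes> h))
          = (f \<boxtimes> g \<boxtimes> h) \<cdot> inv_arr V (Asc V (Dom V f) (Dom V g) (Dom V h))"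
        if "f \<in> Arr V" "g \<in> Arr V" "h \<in> Arr V" for f g h
      proof (rule iso_cancel_left[of "Asc V (Cod V f) (Cod V g) (Cod V h)"])
        show "Asc V (Cod V f) (Cod V g) (Cod V h) \<cdot> (inv_arr V (Asc V (Cod V f) (Cod V g) (Cod V h)) \<cdot> (f \<boxtimes> (g \<boxtimes> h)))
           = Asc V (Cod V f) (Cod V g) (Cod V h) \<cdot> ((f \<boxtimes> g \<boxtimes> h) \<cdot> inv_arr V (Asc V (Dom V f) (Dom V g) (Dom V h)))"
          using that by (subst Cmp_tail[OF Asc_nat]) auto
      qed (use that in auto)
      have "theta u (v \<star> (e # w)) \<cdot> ((Ide V ?U \<boxtimes> theta v (e # w)) \<cdot> Asc V ?U ?V (?W \<otimes> ?E))
          = (theta u (v \<star> w) \<boxtimes> Ide V ?E) \<cdot> ((inv_arr V (Asc V ?U (ev_str (v \<star> w)) ?E) \<cdot>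
             (Ide V ?U \<boxtimes> (theta v w \<boxtimes> Ide V ?E))) \<cdot>
             ((Ide V ?U \<boxtimes> inv_arr V (Asc V ?V ?W ?E)) \<cdot> Asc V ?U ?V (?W \<otimes> ?E)))"
        using va ne w_ne by simp
      also have "\<dots> = (theta u (v \<star> w) \<boxtimes> Ide V ?E) \<cdot> ((Ide V ?U \<boxtimes> theta v w \<boxtimes> Ide V ?E) \<cdot> ?l)"
        using inat[of "Ide V ?U" "theta v w" "Ide V ?E"] va by simp
      also have "\<dots> = ((theta u (v \<star> w) \<cdot> ((Ide V ?U \<boxtimes> theta v w) \<cdot> Asc V ?U ?V ?W)) \<boxtimes> Ide V ?E)
          \<cdot> inv_arr V (Asc V (?U \<otimes> ?V) ?W ?E)"
        unfolding pent using va by simp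
      also have "\<dots> = (theta (u \<star> v) w \<boxtimes> Ide V ?E) \<cdot> ((theta u v \<boxtimes> Ide V ?W \<boxtimes> Ide V ?E)
          \<cdot> inv_arr V (Asc V (?U \<otimes> ?V) ?W ?E))"
        unfolding Cons.IH[OF w] using va by simp
      also have "(theta u v \<boxtimes> Ide V ?W \<boxtimes> Ide V ?E) \<cdot> inv_arr V (Asc V (?U \<otimes> ?V) ?W ?E)
          = inv_arr V (Asc V (ev_str (u \<star> v)) ?W ?E) \<cdot> (theta u v \<boxtimes> (Ide V ?W \<boxtimes> Ide V ?E))"
        using inat[of "theta u v" "Ide V ?W" "Ide V ?E"] va by (simp del: TenA_Ide)
      finally show ?thesis using va ne w_ne by simp
    qed
  qed
qed

text \<open>The strict tensor product of \<open>f : ev x \<rightarrow> ev x'\<close> and \<open>g : ev y \<rightarrow> ev y'\<close>. The strings are arguments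
  because they cannot be recovered from their evaluations.\<close>

definition sten :: "('i, 'u) strng \<Rightarrow> ('i, 'u) strng \<Rightarrow> 'm \<Rightarrow> ('i, 'u) strng \<Rightarrow> ('i, 'u) strng \<Rightarrow> 'm \<Rightarrow> 'm" where
  "sten x x' f y y' g = theta x' y' \<cdot> ((f \<boxtimes> g) \<cdot> inv_arr V (theta x y))"

definition str_hom :: "('i, 'u) strng \<Rightarrow> ('i, 'u) strng \<Rightarrow> 'm \<Rightarrow> bool" where
  "str_hom x y f \<longleftrightarrow> valid x \<and> valid y \<and> f \<in> Arr V \<and> Dom V f = ev_str x \<and> Cod V f = ev_str y"

lemma str_hom_Ide [simp]: "valid x \<Longrightarrow> str_hom x x (Ide V (ev_str x))"
  by (simp add: str_hom_def)

lemma str_hom_Cmp: "str_hom x y f \<Longrightarrow> str_hom y z g \<Longrightarrow> str_hom x z (g \<cdot> f)"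
  by (simp add: str_hom_def)

lemma str_hom_sten [simp]:
  "str_hom x x' f \<Longrightarrow> str_hom y y' g \<Longrightarrow> str_hom (x \<star> y) (x' \<star> y') (sten x x' f y y' g)"
  by (simp add: str_hom_def sten_def)

lemma sten_theta:
  "str_hom x x' f \<Longrightarrow> str_hom y y' g \<Longrightarrow> sten x x' f y y' g \<cdot> theta x y = theta x' y' \<cdot> (f \<boxtimes> g)"
  by (simp add: sten_def str_hom_def)

lemma sten_Ide [simp]: "valid x \<Longrightarrow> valid y \<Longrightarrow> sten x x (Ide V (ev_str x)) y y (Ide V (ev_str y)) = Ide V (ev_str (x \<star> y))"
  by (simp add: sten_def)

lemma sten_Nil_left [simp]: "str_hom y y' g \<Longrightarrow> sten [] [] (Ide V (Unt V)) y y' g = g"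
  unfolding sten_def theta_simps by (subst Cmp_tail[OF LUn_nat]) (auto simp: str_hom_def)

lemma sten_Nil_right [simp]: "str_hom x x' f \<Longrightarrow> sten x x' f [] [] (Ide V (Unt V)) = f"
  unfolding sten_def theta.simps by (subst Cmp_tail[OF RUn_nat]) (auto simp: str_hom_def)

lemma sten_Cmp:
  assumes "str_hom x x' f" "str_hom x' x'' f'" "str_hom y y' g" "str_hom y' y'' g'"
  shows "sten x' x'' f' y' y'' g' \<cdot> sten x x' f y y' g = sten x x'' (f' \<cdot> f) y y'' (g' \<cdot> g)"
  using assms by (simp add: sten_def str_hom_def)

text \<open>No associator appears: \<open>\<star>\<close> is strictly associative, and after
  precomposition with \<open>theta\<close> the equation follows from \<open>theta_assoc\<close> on
  source and target and naturality of the associator in between.\<close>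

lemma sten_assoc:
  assumes "str_hom x x' f" "str_hom y y' g" "str_hom z z' h"
  shows "sten (x \<star> y) (x' \<star> y') (sten x x' f y y' g) z z' h
    = sten x x' f (y \<star> z) (y' \<star> z') (sten y y' g z z' h)" (is "?l = ?r")
proof (rule iso_cancel_right[of "theta (x \<star> y) z \<cdot> (theta x y \<boxtimes> Ide V (ev_str z))"])
  note h' = assms str_hom_sten[OF assms(1,2)] str_hom_sten[OF assms(2,3)]
  have l': "str_hom ((x \<star> y) \<star> z) ((x' \<star> y') \<star> z') ?l" and r': "str_hom (x \<star> y \<star> z) (x' \<star> y' \<star> z') ?r"
    using str_hom_sten[OF h'(4,3)] str_hom_sten[OF h'(1,5)] by simp_all
  note h = h'[unfolded str_hom_def] and l = l'[unfolded str_hom_def] and r = r'[unfolded str_hom_def]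
  have "?l \<cdot> (theta (x \<star> y) z \<cdot> (theta x y \<boxtimes> Ide V (ev_str z)))
      = theta (x' \<star> y') z' \<cdot> ((sten x x' f y y' g \<boxtimes> h) \<cdot> (theta x y \<boxtimes> Ide V (ev_str z)))"
    using h h' l by (subst Cmp_tail[OF sten_theta]) auto
  also have "\<dots> = theta (x' \<star> y') z' \<cdot> ((theta x' y' \<boxtimes> Ide V (ev_str z')) \<cdot> (f \<boxtimes> g \<boxtimes> h))"
    using h h' by (simp add: sten_theta[OF h'(1,2)])
  also have "\<dots> = theta x' (y' \<star> z') \<cdot> ((Ide V (ev_str x') \<boxtimes> theta y' z') \<cdot>
      (Asc V (ev_str x') (ev_str y') (ev_str z') \<cdot> (f \<boxtimes> g \<boxtimes> h)))"
    using h by (subst Cmp_tail[OF theta_assoc[symmetric]]) auto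
  also have "\<dots> = theta x' (y' \<star> z') \<cdot> ((f \<boxtimes> (theta y' z' \<cdot> (g \<boxtimes> h))) \<cdot> Asc V (ev_str x) (ev_str y) (ev_str z))"
    using h by (subst Asc_nat) auto
  also have "\<dots> = theta x' (y' \<star> z') \<cdot> ((f \<boxtimes> sten y y' g z z' h) \<cdot>
      ((Ide V (ev_str x) \<boxtimes> theta y z) \<cdot> Asc V (ev_str x) (ev_str y) (ev_str z)))"
    using h h' by (simp add: sten_theta[OF h'(2,3)])
  also have "\<dots> = ?r \<cdot> (theta x (y \<star> z) \<cdot> ((Ide V (ev_str x) \<boxtimes> theta y z) \<cdot> Asc V (ev_str x) (ev_str y) (ev_str z)))"
    using h h' r by (subst Cmp_tail[OF sten_theta]) auto
  also have "\<dots> = ?r \<cdot> (theta (x \<star> y) z \<cdot> (theta x y \<boxtimes> Ide V (ev_str z)))"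
    using h by (subst theta_assoc) auto
  finally show "?l \<cdot> (theta (x \<star> y) z \<cdot> (theta x y \<boxtimes> Ide V (ev_str z)))
    = ?r \<cdot> (theta (x \<star> y) z \<cdot> (theta x y \<boxtimes> Ide V (ev_str z)))" .
  show "?l \<in> Arr V" "?r \<in> Arr V" "Dom V ?l = Cod V (theta (x \<star> y) z \<cdot> (theta x y \<boxtimes> Ide V (ev_str z)))"
    "Dom V ?r = Cod V (theta (x \<star> y) z \<cdot> (theta x y \<boxtimes> Ide V (ev_str z)))"
    using l r h by auto
qed (use assms in \<open>auto simp: str_hom_def\<close>)


section \<open>Categories of strings\<close>

text \<open>The functor laws are equalities of records and rest on the convention that object maps
  are \<open>undefined\<close> outside the object set.\<close>

lemma functor_obF: "is_functor I (SetC \<kappa>) obF"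
proof -
  have Ff: "in_hom (CatV \<kappa> V) (FArr F f) (FObj F (Dom I f)) (FObj F (Cod I f))" if "f \<in> Arr I" for f
    using functor_F that by (simp add: is_functor_def)
  have "in_hom (SetC \<kappa>) (FArr obF f) (FObj obF (Dom I f)) (FObj obF (Cod I f))" if f: "f \<in> Arr I" for f
    using f small_F_obj enriched_functor.omap_undefined[OF F_arr[OF f]]
    by (auto simp: in_hom_def SetC_def obF_def func_comp_def Ob_functor_def)
  moreover have "FArr obF (Ide I i) = Ide (SetC \<kappa>) (FObj obF i)" if "i \<in> Obj I" for i
  proof -
    have "FArr F (Ide I i) = Ide (CatV \<kappa> V) (FObj F i)" using functor_F that by (simp add: is_functor_def)
    then show ?thesis by (simp add: SetC_def obF_def func_comp_def Ob_functor_def CatV_def)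
  qed
  moreover have "FArr obF (g \<cdot>\<^bsub>I\<^esub> f) = FArr obF g \<cdot>\<^bsub>SetC \<kappa>\<^esub> FArr obF f"
    if "f \<in> Arr I" "g \<in> Arr I" "Cod I f = Dom I g" for f g
  proof -
    have "FArr F (g \<cdot>\<^bsub>I\<^esub> f) = FArr F g \<cdot>\<^bsub>CatV \<kappa> V\<^esub> FArr F f"
      using functor_F that by (simp add: is_functor_def)
    then show ?thesis
      by (auto simp: SetC_def obF_def func_comp_def Ob_functor_def CatV_def intro!: set_map.equality ext)
  qed
  ultimately show ?thesis
    using small_F_obj by (auto simp: is_functor_def SetC_def obF_def func_comp_def Ob_functor_def)
qed

section \<open>The colimit of the object sets and the classes of objects\<close>

lemma colimOb_colimit: "is_colimit_cocone I (SetC \<kappa>) obF colimOb (colim_leg I (SetC \<kappa>) obF)"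
proof -
  obtain c where "is_colimit I (SetC \<kappa>) obF c"
    using SetC_cocomplete[OF bound small_I functor_obF] by blast
  then show ?thesis unfolding colimOb_def by (rule colim_is_colimit)
qed

lemma colimOb_cocone: "is_cocone I (SetC \<kappa>) obF colimOb (colim_leg I (SetC \<kappa>) obF)"
  using colimOb_colimit by (simp add: is_colimit_cocone_def)

lemma small_colimOb: "small \<kappa> colimOb"
  using colimOb_cocone by (simp add: is_cocone_def SetC_def)

lemma obF_simps [simp]: "FObj obF i = vobj (FObj F i)"
    "FArr obF f = \<lparr> SDom = vobj (vdom (FArr F f)), SCod = vobj (vcod (FArr F f)), SFun = omap (FArr F f) \<rparr>"
  by (auto simp: obF_def func_comp_def Ob_functor_def)

lemma SetC_hom:
  "in_hom (SetC \<kappa>) f A B \<longleftrightarrow> small \<kappa> A \<and> small \<kappa> B \<and> SDom f = A \<and> SCod f = B \<and> (\<forall>x\<in>A. SFun f x \<in> B)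
     \<and> (\<forall>x. x \<notin> A \<longrightarrow> SFun f x = undefined)"
  by (auto simp: in_hom_def SetC_def)

lemma SetC_Cmp: "g \<cdot>\<^bsub>SetC \<kappa>\<^esub> f = \<lparr> SDom = SDom f, SCod = SCod g,
    SFun = \<lambda>x. if x \<in> SDom f then SFun g (SFun f x) else undefined \<rparr>"
  by (simp add: SetC_def)

lemma cls_in [simp]: "i \<in> Obj I \<Longrightarrow> x \<in> vobj (FObj F i) \<Longrightarrow> cls i x \<in> colimOb"
  using colimOb_cocone by (simp add: is_cocone_def SetC_hom cls_def)

lemma cls_nat [simp]:
  assumes "f \<in> Arr I" "x \<in> vobj (FObj F (Dom I f))"
  shows "cls (Cod I f) (omap (FArr F f) x) = cls (Dom I f) x"
proof -
  let ?l = "colim_leg I (SetC \<kappa>) obF"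
  have "?l (Cod I f) \<cdot>\<^bsub>SetC \<kappa>\<^esub> FArr obF f = ?l (Dom I f)"
    using colimOb_cocone assms by (simp add: is_cocone_def)
  then have "SFun (?l (Cod I f) \<cdot>\<^bsub>SetC \<kappa>\<^esub> FArr obF f) x = SFun (?l (Dom I f)) x" by simp
  then show ?thesis
    using assms by (simp add: SetC_Cmp cls_def)
qed

section \<open>Strings with fixed endpoints, generators and whiskering\<close>

lemma is_string_valid: "is_string a b s \<Longrightarrow> valid s"
  by (induction a b s rule: is_string.induct) auto

lemma is_string_ends: "is_string a b s \<Longrightarrow> a \<in> colimOb \<and> b \<in> colimOb"
  by (induction a b s rule: is_string.induct) auto

lemma is_string_star: "is_string a c (t \<star> s) \<longleftrightarrow> (\<exists>b. is_string a b s \<and> is_string b c t)"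
proof (induction s arbitrary: a)
  case Nil
  then show ?case using is_string_ends[of a c t] by auto
next
  case (Cons e s)
  then show ?case by (cases e) auto
qed

lemma is_string_starI: "is_string b c t \<Longrightarrow> is_string a b s \<Longrightarrow> is_string a c (t \<star> s)"
  using is_string_star by blast

lemma is_prim_hom [simp]: "is_prim p \<Longrightarrow> str_hom (prim_src p) (prim_tgt p) (ev_prim p)"
  using enriched_category.vcomp_in_hom[OF F_obj] enriched_category.vunit_in_hom[OF F_obj]
  by (cases p) (auto simp: str_hom_def in_hom_def star_def)

lemma is_prim_valid [simp]: "is_prim p \<Longrightarrow> valid (prim_src p)" "is_prim p \<Longrightarrow> valid (prim_tgt p)"
  using is_prim_hom by (auto simp: str_hom_def)

lemma ev_gen_sten:
  "ev_gen (u, p, v) = sten u u (Ide V (ev_str u)) (prim_src p \<star> v) (prim_tgt p \<star> v)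
     (sten (prim_src p) (prim_tgt p) (ev_prim p) v v (Ide V (ev_str v)))"
  by (simp add: sten_def)

lemma is_gen_valid:
  "is_gen a b (u, p, v) \<Longrightarrow> valid u \<and> valid v \<and> is_prim p"
  by (auto dest: is_string_valid)

declare ev_gen.simps [simp del]

lemma ev_gen_hom [simp]: "is_gen a b g \<Longrightarrow> str_hom (gen_src g) (gen_tgt g) (ev_gen g)"
  by (cases g) (auto simp: ev_gen_sten dest: is_gen_valid simp del: is_gen.simps)

lemma gen_src_whisker [simp]: "gen_src (whisker_left t g) = t \<star> gen_src g"
    "gen_src (whisker_right g s) = gen_src g \<star> s"
  and gen_tgt_whisker [simp]: "gen_tgt (whisker_left t g) = t \<star> gen_tgt g"
    "gen_tgt (whisker_right g s) = gen_tgt g \<star> s"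
  by (cases g; simp add: whisker_left_def whisker_right_def)+

lemma is_gen_strings: "is_gen a b g \<Longrightarrow> is_string a b (gen_src g) \<and> is_string a b (gen_tgt g)"
  by (cases g) auto

lemma is_gen_whisker_left: "is_gen a b g \<Longrightarrow> is_string b c t \<Longrightarrow> is_gen a c (whisker_left t g)"
  by (cases g) (auto simp: whisker_left_def intro: is_string_starI)

lemma is_gen_whisker_right: "is_gen b c g \<Longrightarrow> is_string a b s \<Longrightarrow> is_gen a c (whisker_right g s)"
proof (cases g)
  fix u p v
  assume g: "g = (u, p, v)" "is_gen b c g" and s: "is_string a b s"
  have "is_string a c (gen_src g \<star> s)" "is_string a c (gen_tgt g \<star> s)"
    using is_gen_strings[OF g(2)] s by (auto intro: is_string_starI)
  with g show ?thesis by (simp add: whisker_right_def)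
qed

text \<open>Whiskering by \<open>t\<close> enlarges the left context to \<open>t \<star> u\<close>;
  strict associativity brings the identities of \<open>t\<close> and \<open>u\<close> together, and
  \<open>sten_Ide\<close> merges them.\<close>

lemma ev_gen_whisker_left:
  assumes "is_gen a b g" "valid t"
  shows "ev_gen (whisker_left t g) = sten t t (Ide V (ev_str t)) (gen_src g) (gen_tgt g) (ev_gen g)"
proof (cases g)
  case (fields u p v)
  then have "valid u" "valid v" "is_prim p" using is_gen_valid assms(1) by blast+
  then show ?thesis
    using assms(2) fields sten_assoc[of t t "Ide V (ev_str t)" u u "Ide V (ev_str u)" 
       "prim_src p \<star> v" "prim_tgt p \<star> v" "sten (prim_src p) (prim_tgt p) (ev_prim p) v v (Ide V (ev_str v))"]
    by (simp add: whisker_left_def ev_gen_sten)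
qed

text \<open>The nested strict tensor product is reassociated twice: across \<open>u\<close>, and
  then to join the identities of \<open>v\<close> and \<open>s\<close>.\<close>

lemma ev_gen_whisker_right:
  assumes "is_gen b c g" "valid s"
  shows "ev_gen (whisker_right g s) = sten (gen_src g) (gen_tgt g) (ev_gen g) s s (Ide V (ev_str s))"
proof (cases g)
  case (fields u p v)
  then have v: "valid u" "valid v" "is_prim p" using is_gen_valid assms(1) by blast+
  let ?s = "Ide V (ev_str s)" and ?u = "Ide V (ev_str u)" and ?v = "Ide V (ev_str v)"
  let ?x = "prim_src p" and ?y = "prim_tgt p" and ?f = "ev_prim p"
  have "sten (gen_src g) (gen_tgt g) (ev_gen g) s s ?s
      = sten u u ?u (?x \<star> v \<star> s) (?y \<star> v \<star> s) (sten (?x \<star> v) (?y \<star> v) (sten ?x ?y ?f v v ?v) s s ?s)"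
    using v assms(2) fields
    sten_assoc[of u u ?u "?x \<star> v" "?y \<star> v" "sten ?x ?y ?f v v ?v" s s ?s] by (simp add: ev_gen_sten)
  also have "sten (?x \<star> v) (?y \<star> v) (sten ?x ?y ?f v v ?v) s s ?s
      = sten ?x ?y ?f (v \<star> s) (v \<star> s) (Ide V (ev_str (v \<star> s)))"
    using v assms(2) sten_assoc[of ?x ?y ?f v v ?v s s ?s] by simp
  finally show ?thesis using fields by (simp add: whisker_right_def ev_gen_sten)
qed

text \<open>Both orders are compared with the simultaneous application of \<open>\<beta>\<close> and
  \<open>\<alpha>\<close>, a single strict tensor product.\<close>

lemma ev_interchange:
  assumes "is_gen a b \<alpha>" "is_gen b c \<beta>"
  shows "ev_gen (whisker_right \<beta> (gen_tgt \<alpha>)) \<cdot> ev_gen (whisker_left (gen_src \<beta>) \<alpha>)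
      = sten (gen_src \<beta>) (gen_tgt \<beta>) (ev_gen \<beta>) (gen_src \<alpha>) (gen_tgt \<alpha>) (ev_gen \<alpha>)"
    and "ev_gen (whisker_left (gen_tgt \<beta>) \<alpha>) \<cdot> ev_gen (whisker_right \<beta> (gen_src \<alpha>))
      = sten (gen_src \<beta>) (gen_tgt \<beta>) (ev_gen \<beta>) (gen_src \<alpha>) (gen_tgt \<alpha>) (ev_gen \<alpha>)"
proof -
  note h = ev_gen_hom[OF assms(1)] ev_gen_hom[OF assms(2)]
  note v = h[unfolded str_hom_def]
  note w = ev_gen_whisker_left[OF assms(1)] ev_gen_whisker_right[OF assms(2)]
  show "ev_gen (whisker_right \<beta> (gen_tgt \<alpha>)) \<cdot> ev_gen (whisker_left (gen_src \<beta>) \<alpha>)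
      = sten (gen_src \<beta>) (gen_tgt \<beta>) (ev_gen \<beta>) (gen_src \<alpha>) (gen_tgt \<alpha>) (ev_gen \<alpha>)"
    using v h sten_Cmp[OF str_hom_Ide[of "gen_src \<beta>"] h(2) h(1) str_hom_Ide[of "gen_tgt \<alpha>"]]
    by (simp add: w)
  show "ev_gen (whisker_left (gen_tgt \<beta>) \<alpha>) \<cdot> ev_gen (whisker_right \<beta> (gen_src \<alpha>))
      = sten (gen_src \<beta>) (gen_tgt \<beta>) (ev_gen \<beta>) (gen_src \<alpha>) (gen_tgt \<alpha>) (ev_gen \<alpha>)"
    using v h sten_Cmp[OF h(2) str_hom_Ide[of "gen_tgt \<beta>"] str_hom_Ide[of "gen_src \<alpha>"] h(1)]
    by (simp add: w)
qed

section \<open>Paths, their congruence and the evaluation functor\<close>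

lemma is_path_append:
  "is_path a b s (ps @ qs) t \<longleftrightarrow> (\<exists>r. is_path a b s ps r \<and> is_path a b r qs t)"
proof (induction ps arbitrary: s)
  case Nil
  then show ?case by (cases qs) (auto dest: is_gen_strings)
next
  case (Cons p ps)
  then show ?case by auto
qed

lemma is_path_strings: "is_path a b s ps t \<Longrightarrow> is_string a b s \<and> is_string a b t"
  by (induction ps arbitrary: s) (auto dest: is_gen_strings)

lemma ev_path_hom: "is_path a b s ps t \<Longrightarrow> str_hom s t (ev_path s ps)"
proof (induction ps arbitrary: s)
  case (Cons g ps)
  then show ?case using str_hom_Cmp[OF ev_gen_hom, of a b g] by auto
qed (auto dest: is_string_valid)

lemma ev_path_append:
  "is_path a b s ps r \<Longrightarrow> is_path a b r qs t \<Longrightarrow> ev_path s (ps @ qs) = ev_path r qs \<cdot> ev_path s ps"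
proof (induction ps arbitrary: s)
  case Nil
  then show ?case using ev_path_hom[of a b r qs t] by (auto simp: str_hom_def)
next
  case (Cons g ps)
  then show ?case
    using ev_path_hom[of a b "gen_tgt g" ps r] ev_path_hom[of a b r qs t] ev_gen_hom[of a b g]
    by (auto simp: str_hom_def)
qed

text \<open>The relation \<open>path_eq\<close> lives on arbitrary lists of generators, composable
  or not. Hence being a path from \<open>s\<close> to \<open>t\<close> has to be transported along
  with the evaluation, and in both directions because of the symmetry rule.\<close>

lemma path_eq_sound:
  "path_eq a c ps qs \<Longrightarrow>
     (is_path a c s ps t \<longleftrightarrow> is_path a c s qs t) \<and> (is_path a c s ps t \<longrightarrow> ev_path s ps = ev_path s qs)"
proof (induction arbitrary: s t rule: path_eq.induct)
  case (interchange b \<alpha> \<beta>)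
  note s = is_gen_strings[OF interchange(1)] is_gen_strings[OF interchange(2)]
  have g: "is_gen a c (whisker_left (gen_src \<beta>) \<alpha>)" "is_gen a c (whisker_left (gen_tgt \<beta>) \<alpha>)"
    "is_gen a c (whisker_right \<beta> (gen_src \<alpha>))" "is_gen a c (whisker_right \<beta> (gen_tgt \<alpha>))"
    using is_gen_whisker_left[OF interchange(1)] is_gen_whisker_right[OF interchange(2)] s by auto
  note h = g[THEN ev_gen_hom, unfolded str_hom_def]
  have st: "is_string a c (gen_tgt \<beta> \<star> gen_tgt \<alpha>)" using s by (auto intro: is_string_starI)
  then have v: "valid (gen_tgt \<beta> \<star> gen_tgt \<alpha>)" by (rule is_string_valid)
  show ?case using g h v st ev_interchange[OF interchange] by auto
next
  case (congr ps qs xs ys)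
  have "is_path a c s (xs @ ps @ ys) t \<longleftrightarrow> is_path a c s (xs @ qs @ ys) t"
    using congr by (simp add: is_path_append)
  moreover have "ev_path s (xs @ ps @ ys) = ev_path s (xs @ qs @ ys)"
    if p: "is_path a c s (xs @ ps @ ys) t"
  proof -
    \<comment> \<open>The strings at which the replaced segment begins and ends; the induction
      hypothesis is applied between them.\<close>
    obtain r r' where r: "is_path a c s xs r" "is_path a c r ps r'" "is_path a c r' ys t"
      using p unfolding is_path_append by blast
    then have "is_path a c r qs r'" "ev_path r ps = ev_path r qs" using congr.IH by blast+
    then show ?thesis
      using r ev_path_append[of a c s xs r "ps @ ys" t] ev_path_append[of a c s xs r "qs @ ys" t]
        ev_path_append[of a c r ps r' ys t] ev_path_append[of a c r qs r' ys t]
      by (simp add: is_path_append) metis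
  qed
  ultimately show ?case by blast
qed auto

lemma path_class_eq: "path_eq a b ps qs \<Longrightarrow> path_class a b ps = path_class a b qs"
  unfolding path_class_def using path_eq.sym path_eq.trans by blast

lemma path_class_self: "ps \<in> path_class a b ps"
  by (simp add: path_class_def path_eq.refl)

lemma path_eq_append:
  assumes "path_eq a b ps ps'" "path_eq a b qs qs'"
  shows "path_eq a b (ps @ qs) (ps' @ qs')"
  using path_eq.congr[OF assms(1), of "[]" qs] path_eq.congr[OF assms(2), of ps' "[]"]
  by (auto intro: path_eq.trans)

text \<open>The union over all representatives collapses to one class, because
  \<open>path_eq\<close> is a congruence and classes are nonempty.\<close>

lemma StrCat_Cmp:
  "(s', path_class a b qs, t') \<cdot>\<^bsub>StrCat a b\<^esub> (s, path_class a b ps, t) = (s, path_class a b (ps @ qs), t')"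
proof -
  have "(\<Union>p\<in>path_class a b ps. \<Union>q\<in>path_class a b qs. path_class a b (p @ q)) = path_class a b (ps @ qs)"
  proof -
    have "path_class a b (p @ q) = path_class a b (ps @ qs)"
      if "p \<in> path_class a b ps" "q \<in> path_class a b qs" for p q
      using path_class_eq[OF path_eq_append[of a b ps p qs q]] that by (simp add: path_class_def)
    moreover have "path_class a b ps \<noteq> {}" "path_class a b qs \<noteq> {}" using path_class_self by blast+
    ultimately show ?thesis by simp
  qed
  then show ?thesis by (simp add: StrCat_def)
qed

lemma StrCat_simps [simp]:
  "Obj (StrCat a b) = {s. is_string a b s}"
  "Arr (StrCat a b) = {(s, path_class a b ps, t) | s ps t. is_path a b s ps t}"
  "Dom (StrCat a b) (s, P, t) = s" "Cod (StrCat a b) (s, P, t) = t"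
  "Ide (StrCat a b) s = (s, path_class a b [], s)"
  by (auto simp: StrCat_def)

lemma StrCat_hom:
  "in_hom (StrCat a b) f s t \<longleftrightarrow> (\<exists>ps. f = (s, path_class a b ps, t) \<and> is_path a b s ps t)"
  by (auto simp: in_hom_def)

lemma category_StrCat: "category (StrCat a b)"
proof
  fix s assume "s \<in> Obj (StrCat a b)"
  then show "in_hom (StrCat a b) (Ide (StrCat a b) s) s s"
    unfolding StrCat_hom by (intro exI[of _ "[]"]) simp
next
  fix f x y g z
  assume "in_hom (StrCat a b) f x y" "in_hom (StrCat a b) g y z"
  then show "in_hom (StrCat a b) (g \<cdot>\<^bsub>StrCat a b\<^esub> f) x z"
    using is_path_append StrCat_Cmp unfolding StrCat_hom by blast
qed (auto simp: StrCat_hom StrCat_Cmp simp del: StrCat_simps(2), 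
     auto dest: is_path_strings)

text \<open>Edges lie in a small sum, strings are lists of edges, a generator consists of two
  strings and a primitive move, and arrows are represented by lists of generators; smallness passes
  through each of these steps.\<close>

lemma small_StrCat: "small_category \<kappa> (StrCat a b)"
proof -
  let ?E = "{e. is_edge e}"
  have I: "small \<kappa> (Obj I)" "small \<kappa> (Arr I)" using small_I by (auto simp: small_category_def)
  have "small \<kappa> (SIGMA i:Obj I. vobj (FObj F i) \<times> vobj (FObj F i))"
    by (intro small_Sigma[OF bound] I small_F_obj)
  then have E: "small \<kappa> ?E" by (rule small_subset[OF bound]) auto
  then have L: "small \<kappa> (lists ?E)" by (rule small_lists[OF bound])
  have S: "small \<kappa> {s. is_string a b s}"
    by (rule small_subset[OF bound L]) (use is_string_valid valid_lists in blast)
  have P: "small \<kappa> {p. is_prim p}"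
  proof (rule small_subset[OF bound])
    show "small \<kappa> (((\<lambda>(f, i, x, y). Transport f x y) ` (Arr I \<times> ?E)) \<union>
        ((\<lambda>((i, x, y), (i', y', z)). Contract i x y z) ` (?E \<times> ?E)) \<union> ((\<lambda>(i, x, y). Insert i x) ` ?E))"
      by (intro small_Un[OF bound] small_image[OF bound] small_Sigma[OF bound] I E)
    show "{p. is_prim p} \<subseteq> ((\<lambda>(f, i, x, y). Transport f x y) ` (Arr I \<times> ?E)) \<union>
        ((\<lambda>((i, x, y), (i', y', z)). Contract i x y z) ` (?E \<times> ?E)) \<union> ((\<lambda>(i, x, y). Insert i x) ` ?E)"
    proof
      fix p assume "p \<in> {p. is_prim p}"
      then show "p \<in> ((\<lambda>(f, i, x, y). Transport f x y) ` (Arr I \<times> ?E)) \<union>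
        ((\<lambda>((i, x, y), (i', y', z)). Contract i x y z) ` (?E \<times> ?E)) \<union> ((\<lambda>(i, x, y). Insert i x) ` ?E)"
        by (cases p) (force simp: image_iff)+
    qed
  qed
  have G: "small \<kappa> {g. is_gen a b g}"
  proof (rule small_subset[OF bound])
    show "small \<kappa> (lists ?E \<times> {p :: ('i, 'k, 'u) prim. is_prim p} \<times> lists ?E)"
      by (intro small_Sigma[OF bound] L P)
    show "{g. is_gen a b g} \<subseteq> lists ?E \<times> {p. is_prim p} \<times> lists ?E"
      using is_gen_valid valid_lists by fast
  qed
  have paths: "is_path a b s ps t \<Longrightarrow> ps \<in> lists {g. is_gen a b g}" for s ps t
    by (induction ps arbitrary: s) auto
  have "small \<kappa> ((\<lambda>(s, ps, t). (s, path_class a b ps, t)) `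
      ({s. is_string a b s} \<times> lists {g. is_gen a b g} \<times> {s. is_string a b s}))"
    by (intro small_image[OF bound] small_Sigma[OF bound] small_lists[OF bound] S G)
  then have "small \<kappa> (Arr (StrCat a b))"
  proof (rule small_subset[OF bound], intro subsetI)
    fix f assume "f \<in> Arr (StrCat a b)"
    then obtain s ps t where f: "f = (s, path_class a b ps, t)" and p: "is_path a b s ps t" by auto
    show "f \<in> (\<lambda>(s, ps, t). (s, path_class a b ps, t)) `
      ({s. is_string a b s} \<times> lists {g. is_gen a b g} \<times> {s. is_string a b s})"
      by (rule image_eqI[of _ _ "(s, ps, t)"]) (use f paths[OF p] is_path_strings[OF p] in auto)
  qed
  then show ?thesis using S category_StrCat by (simp add: small_category_def del: StrCat_simps(2))
qed

lemma ev_simps [simp]: "FObj ev = ev_str"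
  by (simp add: ev_def)

text \<open>\<open>ev\<close> evaluates an arbitrarily chosen member of the class; by soundness of
  the congruence the result is that of any representing path.\<close>

lemma ev_arr [simp]:
  assumes "is_path a b s ps t"
  shows "FArr ev (s, path_class a b ps, t) = ev_path s ps"
proof -
  have "(SOME qs. qs \<in> path_class a b ps) \<in> path_class a b ps" using path_class_self by (rule someI)
  then show ?thesis using path_eq_sound[of a b ps _ s t] assms by (simp add: ev_def path_class_def)
qed

lemma functor_ev: "is_functor (StrCat a b) V ev"
proof -
  have "in_hom V (ev_path s ps) (ev_str s) (ev_str t)" if "is_path a b s ps t" for s ps t
    using ev_path_hom[OF that] by (simp add: str_hom_def in_hom_def)
  moreover have "ev_path s (ps @ qs) = ev_path r qs \<cdot> ev_path s ps \<and> is_path a b s (ps @ qs) t"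
    if "is_path a b s ps r" "is_path a b r qs t" for s ps r qs t
    using that ev_path_append is_path_append by blast
  moreover have "valid s" if "is_string a b s" for s using is_string_valid that .
  ultimately show ?thesis
    by (auto simp: is_functor_def StrCat_Cmp)
qed

text \<open>Arrows are composed of generators, so naturality may be tested on generators alone. Both
  directions serve: one gives the relations between the legs \<open>sleg\<close>, the other
  recognises \<open>string_map\<close> as a cocone.\<close>

lemma ev_cocone_iff:
  "is_cocone (StrCat a b) V ev d \<delta> \<longleftrightarrow> d \<in> Obj V \<and> (\<forall>s. is_string a b s \<longrightarrow> in_hom V (\<delta> s) (ev_str s) d)
     \<and> (\<forall>g. is_gen a b g \<longrightarrow> \<delta> (gen_tgt g) \<cdot> ev_gen g = \<delta> (gen_src g))" (is "?l \<longleftrightarrow> ?r")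
proof
  assume l: ?l
  have "\<delta> (gen_tgt g) \<cdot> ev_gen g = \<delta> (gen_src g)" if g: "is_gen a b g" for g
  proof -
    have p: "is_path a b (gen_src g) [g] (gen_tgt g)" using g is_gen_strings by auto
    then have "(gen_src g, path_class a b [g], gen_tgt g) \<in> Arr (StrCat a b)" by auto
    then have "\<delta> (gen_tgt g) \<cdot> ev_path (gen_src g) [g] = \<delta> (gen_src g)"
      using l ev_arr[OF p] unfolding is_cocone_def by force
    then show ?thesis using ev_gen_hom[OF g] by (simp add: str_hom_def)
  qed
  with l show ?r by (auto simp: is_cocone_def)
next
  assume r: ?r
  have "\<delta> t \<cdot> ev_path s ps = \<delta> s" if "is_path a b s ps t" for s ps t
    using that
  proof (induction ps arbitrary: s)
    case Nil
    then show ?case using r by (auto simp: in_hom_def)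
  next
    case (Cons g ps)
    then have g: "is_gen a b g" and ps: "is_path a b (gen_tgt g) ps t" and s: "s = gen_src g" by auto
    have "\<delta> t \<cdot> (ev_path (gen_tgt g) ps \<cdot> ev_gen g) = \<delta> (gen_tgt g) \<cdot> ev_gen g"
      using ev_path_hom[OF ps] ev_gen_hom[OF g] r is_path_strings[OF ps]
      by (subst Cmp_tail[OF Cons.IH[OF ps]]) (auto simp: in_hom_def str_hom_def)
    then show ?case using r g s by simp
  qed
  with r show ?l by (auto simp: is_cocone_def)
qed


section \<open>The enriched category of strings\<close>

lemma shom_colimit: "is_colimit_cocone (StrCat a b) V ev (shom a b) (sleg a b)"
  and ex_colimit: "\<exists>c. is_colimit (StrCat a b) V ev c"
proof -
  show ex: "\<exists>c. is_colimit (StrCat a b) V ev c"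
    by (rule cocomplete_colimit[OF bound cocomp small_StrCat functor_ev])
  show "is_colimit_cocone (StrCat a b) V ev (shom a b) (sleg a b)"
    unfolding shom_def sleg_def using ex colim_is_colimit[of "StrCat a b" V ev] by blast
qed

lemma shom_cocone: "is_cocone (StrCat a b) V ev (shom a b) (sleg a b)"
  using shom_colimit by (simp add: is_colimit_cocone_def)

lemma shom_obj [simp]: "shom a b \<in> Obj V"
  using shom_cocone by (simp add: is_cocone_def)

lemma sleg_arr [simp]:
  assumes "is_string a b s"
  shows "sleg a b s \<in> Arr V" "Dom V (sleg a b s) = ev_str s" "Cod V (sleg a b s) = shom a b"
  using shom_cocone assms unfolding ev_cocone_iff by (auto simp: in_hom_def)

lemma sleg_gen: "is_gen a b g \<Longrightarrow> sleg a b (gen_tgt g) \<cdot> ev_gen g = sleg a b (gen_src g)"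
  using shom_cocone unfolding ev_cocone_iff by blast

lemma shom_ext:
  assumes "in_hom V f (shom a b) d" "in_hom V g (shom a b) d"
    and "\<And>s. is_string a b s \<Longrightarrow> f \<cdot> sleg a b s = g \<cdot> sleg a b s"
  shows "f = g"
  by (rule colimit_ext[OF shom_colimit functor_ev category_axioms category_StrCat assms(1,2)])
     (use assms(3) in auto)

lemma ev2_ten_func: "ev2 = ten_func ev ev"
  by (simp add: ev2_def ten_func_def)

lemma shom2_colimit:
  "is_colimit_cocone (StrCat2 a b c) V ev2 (shom b c \<otimes> shom a b) (\<lambda>(t, s). sleg b c t \<boxtimes> sleg a b s)"
  unfolding ev2_ten_func StrCat2_def
  by (rule tensor_colimit[OF bound cocont small_StrCat small_StrCat functor_ev functor_ev
        shom_colimit shom_colimit])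

lemma functor_ev2: "is_functor (StrCat2 a b c) V ev2"
  unfolding ev2_ten_func StrCat2_def by (rule is_functor_ten_func[OF functor_ev functor_ev])

lemma small_StrCat2: "small_category \<kappa> (StrCat2 a b c)"
  unfolding StrCat2_def by (rule small_prod_cat[OF bound small_StrCat small_StrCat])

lemma category_StrCat2: "category (StrCat2 a b c)"
  using small_StrCat2 by (simp add: small_category_def)

lemma Obj_StrCat2: "Obj (StrCat2 a b c) = {t. is_string b c t} \<times> {s. is_string a b s}"
  by (simp add: StrCat2_def prod_cat_def)

lemma shom2_ext:
  assumes "in_hom V f (shom b c \<otimes> shom a b) d" "in_hom V g (shom b c \<otimes> shom a b) d"
    and "\<And>t s. is_string b c t \<Longrightarrow> is_string a b s
           \<Longrightarrow> f \<cdot> (sleg b c t \<boxtimes> sleg a b s) = g \<cdot> (sleg b c t \<boxtimes> sleg a b s)"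
  shows "f = g"
  by (rule colimit_ext[OF shom2_colimit functor_ev2 category_axioms category_StrCat2 assms(1,2)])
     (use assms(3) in \<open>auto simp: Obj_StrCat2\<close>)

text \<open>One more use of \<open>tensor_colimit\<close>, with the two-variable diagram as first
  factor; this matches the left-nested source of the associativity law.\<close>

lemma shom3_ext:
  assumes "in_hom V f (shom c d \<otimes> shom b c \<otimes> shom a b) e" "in_hom V g (shom c d \<otimes> shom b c \<otimes> shom a b) e"
    and "\<And>u t s. is_string c d u \<Longrightarrow> is_string b c t \<Longrightarrow> is_string a b s
           \<Longrightarrow> f \<cdot> (sleg c d u \<boxtimes> sleg b c t \<boxtimes> sleg a b s) = g \<cdot> (sleg c d u \<boxtimes> sleg b c t \<boxtimes> sleg a b s)"
  shows "f = g"
proof -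
  have co: "is_colimit_cocone (prod_cat (StrCat2 b c d) (StrCat a b)) V (ten_func ev2 ev)
      (shom c d \<otimes> shom b c \<otimes> shom a b) (\<lambda>(r, s). (case r of (u, t) \<Rightarrow> sleg c d u \<boxtimes> sleg b c t) \<boxtimes> sleg a b s)"
    by (rule tensor_colimit[OF bound cocont small_StrCat2 small_StrCat functor_ev2 functor_ev
        shom2_colimit shom_colimit])
  have cat: "category (prod_cat (StrCat2 b c d) (StrCat a b))"
    using small_prod_cat[OF bound small_StrCat2 small_StrCat] by (simp add: small_category_def)
  show ?thesis
    by (rule colimit_ext[OF co is_functor_ten_func[OF functor_ev2 functor_ev] category_axioms cat assms(1,2)])
       (use assms(3) in \<open>auto simp: prod_cat_def Obj_StrCat2\<close>)
qed

text \<open>Each generator of the path, whiskered by \<open>s\<close>, is a generator of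
  \<open>StrCat a c\<close> and is absorbed by the leg. Treating the two variables separately spares
  an action of \<open>\<star>\<close> on classes of paths.\<close>

lemma sleg_theta_right:
  assumes "is_path b c t qs t'" "is_string a b s"
  shows "sleg a c (t' \<star> s) \<cdot> (theta t' s \<cdot> (ev_path t qs \<boxtimes> Ide V (ev_str s))) = sleg a c (t \<star> s) \<cdot> theta t s"
  using assms(1)
proof (induction qs arbitrary: t)
  case Nil
  then have "is_string a c (t \<star> s)" "valid t" "valid s" "t' = t"
    using assms(2) by (auto intro: is_string_starI dest: is_string_valid)
  then show ?case by simp
next
  case (Cons g qs)
  then have g: "is_gen b c g" and t: "t = gen_src g" and qs: "is_path b c (gen_tgt g) qs t'" by auto
  note h = ev_gen_hom[OF g]  and hq = ev_path_hom[OF qs]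
  note w = ev_gen_hom[OF is_gen_whisker_right[OF g assms(2)]]
  have str: "is_string a c (gen_src g \<star> s)" "is_string a c (gen_tgt g \<star> s)" "is_string a c (t' \<star> s)"
    using is_gen_strings[OF g] is_path_strings[OF qs] assms(2) by (auto intro: is_string_starI)
  have s: "valid s" using assms(2) by (rule is_string_valid)
  \<comment> \<open>The generator applied first is split off as the innermost factor, leaving the
    statement for the rest of the path.\<close>
  have "sleg a c (t' \<star> s) \<cdot> (theta t' s \<cdot> (ev_path t (g # qs) \<boxtimes> Ide V (ev_str s)))
      = (sleg a c (t' \<star> s) \<cdot> (theta t' s \<cdot> (ev_path (gen_tgt g) qs \<boxtimes> Ide V (ev_str s))))
          \<cdot> (ev_gen g \<boxtimes> Ide V (ev_str s))"
    using str s h hq by (simp add: str_hom_def)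
  also have "\<dots> = sleg a c (gen_tgt g \<star> s) \<cdot> (theta (gen_tgt g) s \<cdot> (ev_gen g \<boxtimes> Ide V (ev_str s)))"
    unfolding Cons.IH[OF qs] using str s h by (simp add: str_hom_def)
  also have "\<dots> = (sleg a c (gen_tgt g \<star> s) \<cdot> ev_gen (whisker_right g s)) \<cdot> theta (gen_src g) s"
    using str s h w sten_theta[OF h str_hom_Ide[OF s]] ev_gen_whisker_right[OF g s]
    by (simp add: str_hom_def)
  also have "\<dots> = sleg a c (t \<star> s) \<cdot> theta t s"
    using sleg_gen[OF is_gen_whisker_right[OF g assms(2)]] t by simp
  finally show ?case .
qed

lemma sleg_theta_left:
  assumes "is_path a b s ps s'" "is_string b c t"
  shows "sleg a c (t \<star> s') \<cdot> (theta t s' \<cdot> (Ide V (ev_str t) \<boxtimes> ev_path s ps)) = sleg a c (t \<star> s) \<cdot> theta t s"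
  using assms(1)
proof (induction ps arbitrary: s)
  case Nil
  then have "is_string a c (t \<star> s)" "valid t" "valid s" "s' = s"
    using assms(2) by (auto intro: is_string_starI dest: is_string_valid)
  then show ?case by simp
next
  case (Cons g ps)
  then have g: "is_gen a b g" and s: "s = gen_src g" and ps: "is_path a b (gen_tgt g) ps s'" by auto
  note h = ev_gen_hom[OF g] and hq = ev_path_hom[OF ps]
  note w = ev_gen_hom[OF is_gen_whisker_left[OF g assms(2)]]
  have str: "is_string a c (t \<star> gen_src g)" "is_string a c (t \<star> gen_tgt g)" "is_string a c (t \<star> s')"
    using is_gen_strings[OF g] is_path_strings[OF ps] assms(2) by (auto intro: is_string_starI)
  have t: "valid t" using assms(2) by (rule is_string_valid)
  have "sleg a c (t \<star> s') \<cdot> (theta t s' \<cdot> (Ide V (ev_str t) \<boxtimes> ev_path s (g # ps)))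
      = (sleg a c (t \<star> s') \<cdot> (theta t s' \<cdot> (Ide V (ev_str t) \<boxtimes> ev_path (gen_tgt g) ps)))
          \<cdot> (Ide V (ev_str t) \<boxtimes> ev_gen g)"
    using str t h hq by (simp add: str_hom_def)
  also have "\<dots> = sleg a c (t \<star> gen_tgt g) \<cdot> (theta t (gen_tgt g) \<cdot> (Ide V (ev_str t) \<boxtimes> ev_gen g))"
    unfolding Cons.IH[OF ps] using str t h by (simp add: str_hom_def)
  also have "\<dots> = (sleg a c (t \<star> gen_tgt g) \<cdot> ev_gen (whisker_left t g)) \<cdot> theta t (gen_src g)"
    using str t h w sten_theta[OF str_hom_Ide[OF t] h] ev_gen_whisker_left[OF g t]
    by (simp add: str_hom_def)
  also have "\<dots> = sleg a c (t \<star> s) \<cdot> theta t s"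
    using sleg_gen[OF is_gen_whisker_left[OF g assms(2)]] s by simp
  finally show ?case .
qed

text \<open>An arrow of the product category evaluates to
  \<open>(\<beta> \<boxtimes> id) \<cdot> (id \<boxtimes> \<alpha>)\<close>, passing through the
  pair \<open>(t, s')\<close>, so naturality in each variable is enough.\<close>

lemma scomp_cocone:
  "is_cocone (StrCat2 a b c) V ev2 (shom a c) (\<lambda>(t, s). sleg a c (t \<star> s) \<cdot> theta t s)"
proof -
  have hom: "in_hom V (sleg a c (t \<star> s) \<cdot> theta t s) (ev_str t \<otimes> ev_str s) (shom a c)"
    if "is_string b c t" "is_string a b s" for t s
  proof -
    have "is_string a c (t \<star> s)" "valid t" "valid s"
      using that by (auto intro: is_string_starI is_string_valid)
    then show ?thesis by (simp add: in_hom_def)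
  qed
  have nat: "(sleg a c (t' \<star> s') \<cdot> theta t' s') \<cdot> (ev_path t qs \<boxtimes> ev_path s ps) = sleg a c (t \<star> s) \<cdot> theta t s"
    if qs: "is_path b c t qs t'" and ps: "is_path a b s ps s'" for t t' s s' qs ps
  proof -
    have str: "is_string b c t" "is_string b c t'" "is_string a b s" "is_string a b s'"
      using is_path_strings[OF qs] is_path_strings[OF ps] by auto
    have str': "is_string a c (t' \<star> s')" "is_string a c (t \<star> s')"
      using str by (auto intro: is_string_starI)
    note h = ev_path_hom[OF qs, unfolded str_hom_def] ev_path_hom[OF ps, unfolded str_hom_def]
    have "(sleg a c (t' \<star> s') \<cdot> theta t' s') \<cdot> (ev_path t qs \<boxtimes> ev_path s ps)
        = (sleg a c (t' \<star> s') \<cdot> (theta t' s' \<cdot> (ev_path t qs \<boxtimes> Ide V (ev_str s'))))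
            \<cdot> (Ide V (ev_str t) \<boxtimes> ev_path s ps)"
      using str' h by simp
    also have "\<dots> = (sleg a c (t \<star> s') \<cdot> theta t s') \<cdot> (Ide V (ev_str t) \<boxtimes> ev_path s ps)"
      using sleg_theta_right[OF qs str(4)] by simp
    also have "\<dots> = sleg a c (t \<star> s') \<cdot> (theta t s' \<cdot> (Ide V (ev_str t) \<boxtimes> ev_path s ps))"
      using str' h by simp
    finally show ?thesis using sleg_theta_left[OF ps str(1)] by simp
  qed
  show ?thesis
    using hom nat unfolding is_cocone_def
    by (fastforce simp: Obj_StrCat2 ev2_def StrCat2_def prod_cat_def)
qed

lemma mu_inv_iso: "is_iso V (mu_inv a b c)"
  unfolding mu_inv_def
  by (rule colim_map_iso[OF shom2_colimit functor_ev2 category_axioms category_StrCat2])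

text \<open>The legs of the chosen colimit of \<open>ev2\<close> link the two factors of
  \<open>scomp\<close>: \<open>mu_inv\<close> sends them to tensor products of legs and so cancels
  against its inverse. Later proofs use composition only through this equation and its type.\<close>

lemma scomp_hom: "in_hom V (scomp a b c) (shom b c \<otimes> shom a b) (shom a c)"
  and scomp_sleg: "is_string b c t \<Longrightarrow> is_string a b s
    \<Longrightarrow> scomp a b c \<cdot> (sleg b c t \<boxtimes> sleg a b s) = sleg a c (t \<star> s) \<cdot> theta t s"
proof -
  have ex: "is_colimit (StrCat2 a b c) V ev2 (shom b c \<otimes> shom a b)"
    using shom2_colimit by (auto simp: is_colimit_def)
  have co: "is_cocone (StrCat2 a b c) V ev2 (shom b c \<otimes> shom a b) (\<lambda>(t, s). sleg b c t \<boxtimes> sleg a b s)"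
    using shom2_colimit by (simp add: is_colimit_cocone_def)
  let ?k = "colim_map (StrCat2 a b c) V ev2 (shom a c) (\<lambda>(t, s). sleg a c (t \<star> s) \<cdot> theta t s)"
  let ?l = "colim_leg (StrCat2 a b c) V ev2"
  note k = colim_map[OF ex scomp_cocone] and m = colim_map[OF ex co, folded mu_inv_def]
  note iso = mu_inv_iso[of a b c]
  show "in_hom V (scomp a b c) (shom b c \<otimes> shom a b) (shom a c)"
    using k(1) m(1) iso unfolding scomp_def by (simp add: in_hom_def)
  assume "is_string b c t" "is_string a b s"
  then have ts: "(t, s) \<in> Obj (StrCat2 a b c)" by (simp add: Obj_StrCat2)
  have "is_cocone (StrCat2 a b c) V ev2 (colim_obj (StrCat2 a b c) V ev2) ?l"
    using colim_is_colimit[OF ex] by (simp add: is_colimit_cocone_def)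
  then have l: "?l (t, s) \<in> Arr V" "Cod V (?l (t, s)) = colim_obj (StrCat2 a b c) V ev2"
    using ts by (auto simp: is_cocone_def in_hom_def)
  have "scomp a b c \<cdot> (sleg b c t \<boxtimes> sleg a b s)
      = (?k \<cdot> inv_arr V (mu_inv a b c)) \<cdot> (mu_inv a b c \<cdot> ?l (t, s))"
    using m(2)[OF ts] by (simp add: scomp_def)
  also have "\<dots> = ?k \<cdot> ?l (t, s)"
    using k(1) m(1) iso l by (simp add: in_hom_def)
  finally show "scomp a b c \<cdot> (sleg b c t \<boxtimes> sleg a b s) = sleg a c (t \<star> s) \<cdot> theta t s"
    using k(2)[OF ts] by simp
qed

lemma scomp_arr [simp]: "scomp a b c \<in> Arr V" "Dom V (scomp a b c) = shom b c \<otimes> shom a b"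
  "Cod V (scomp a b c) = shom a c"
  using scomp_hom by (auto simp: in_hom_def)

section \<open>The laws of an enriched category\<close>

lemma colim_star_simps [simp]: "vobj colim_star = colimOb" "vhom colim_star = shom"
  "vcomp colim_star = scomp" "vunit colim_star = (\<lambda>a. sleg a a [])"
  by (auto simp: colim_star_def)

lemma scomp_assoc:
  "scomp a b d \<cdot> (scomp b c d \<boxtimes> Ide V (shom a b))
    = scomp a c d \<cdot> ((Ide V (shom c d) \<boxtimes> scomp a b c) \<cdot> Asc V (shom c d) (shom b c) (shom a b))"
  (is "?l = ?r")
proof (rule shom3_ext)
  fix u t s assume str: "is_string c d u" "is_string b c t" "is_string a b s"
  have v: "valid u" "valid t" "valid s" using str is_string_valid by blast+
  have str': "is_string b d (u \<star> t)" "is_string a c (t \<star> s)" "is_string a d (u \<star> t \<star> s)"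
    using str by (auto intro!: is_string_starI)
  have "?l \<cdot> (sleg c d u \<boxtimes> sleg b c t \<boxtimes> sleg a b s)
      = (scomp a b d \<cdot> (sleg b d (u \<star> t) \<boxtimes> sleg a b s)) \<cdot> (theta u t \<boxtimes> Ide V (ev_str s))"
    using str str' v by (simp add: scomp_sleg[OF str(1,2)])
  also have "\<dots> = sleg a d (u \<star> t \<star> s) \<cdot> (theta (u \<star> t) s \<cdot> (theta u t \<boxtimes> Ide V (ev_str s)))"
    unfolding scomp_sleg[OF str'(1) str(3)] using str str' v by simp
  also have "\<dots> = sleg a d (u \<star> t \<star> s) \<cdot>
      (theta u (t \<star> s) \<cdot> ((Ide V (ev_str u) \<boxtimes> theta t s) \<cdot> Asc V (ev_str u) (ev_str t) (ev_str s)))"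
    using v by (simp add: theta_assoc)
  also have "\<dots> = (scomp a c d \<cdot> (sleg c d u \<boxtimes> sleg a c (t \<star> s)))
      \<cdot> ((Ide V (ev_str u) \<boxtimes> theta t s) \<cdot> Asc V (ev_str u) (ev_str t) (ev_str s))"
    unfolding scomp_sleg[OF str(1) str'(2)] using str str' v by simp
  also have "\<dots> = scomp a c d \<cdot> ((Ide V (shom c d) \<boxtimes> scomp a b c) \<cdot>
      ((sleg c d u \<boxtimes> (sleg b c t \<boxtimes> sleg a b s)) \<cdot> Asc V (ev_str u) (ev_str t) (ev_str s)))"
    using str str' v by (simp add: scomp_sleg[OF str(2,3)])
  also have "\<dots> = ?r \<cdot> (sleg c d u \<boxtimes> sleg b c t \<boxtimes> sleg a b s)"
    using str str' v Asc_nat[of "sleg c d u" "sleg b c t" "sleg a b s"] by simp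
  finally show "?l \<cdot> (sleg c d u \<boxtimes> sleg b c t \<boxtimes> sleg a b s) = ?r \<cdot> (sleg c d u \<boxtimes> sleg b c t \<boxtimes> sleg a b s)" .
qed (auto simp: in_hom_def)

text \<open>Here one factor is the unit object and not a colimit over strings. Arrows are tested on
  \<open>Ide V (Unt V) \<boxtimes> sleg a b s\<close>, a colimit cocone by cocontinuity of
  \<open>tensor_left V (Unt V)\<close>; there \<open>theta [] s\<close> is the left unitor.\<close>

lemma scomp_unit_left:
  assumes "b \<in> colimOb"
  shows "scomp a b b \<cdot> (sleg b b [] \<boxtimes> Ide V (shom a b)) = LUn V (shom a b)"
proof (rule colimit_ext)
  have n: "is_string b b []" using assms by simp
  let ?T = "tensor_left V (Unt V)"
  show "is_colimit_cocone (StrCat a b) V (func_comp ?T ev) (Unt V \<otimes> shom a b) (\<lambda>s. Ide V (Unt V) \<boxtimes> sleg a b s)"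
  proof -
    have "preserves_small_colimits \<kappa> V V ?T" using cocont by (simp add: tensor_cocontinuous_def)
    from preserves_colimit[OF bound this small_StrCat functor_ev shom_colimit]
    show ?thesis by (simp add: tensor_left_def)
  qed
  show "is_functor (StrCat a b) V (func_comp ?T ev)"
    using functor_ev[of a b] by (auto simp: is_functor_def func_comp_def tensor_left_def in_hom_def)
  show "in_hom V (scomp a b b \<cdot> (sleg b b [] \<boxtimes> Ide V (shom a b))) (Unt V \<otimes> shom a b) (shom a b)"
    "in_hom V (LUn V (shom a b)) (Unt V \<otimes> shom a b) (shom a b)"
    using sleg_arr[OF n] by (auto simp: in_hom_def)
  fix s assume "s \<in> Obj (StrCat a b)"
  then have s: "is_string a b s" "valid s" by (auto intro: is_string_valid)
  have "(scomp a b b \<cdot> (sleg b b [] \<boxtimes> Ide V (shom a b))) \<cdot> (Ide V (Unt V) \<boxtimes> sleg a b s)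
      = scomp a b b \<cdot> (sleg b b [] \<boxtimes> sleg a b s)"
    using s sleg_arr[OF n] by simp
  also have "\<dots> = LUn V (shom a b) \<cdot> (Ide V (Unt V) \<boxtimes> sleg a b s)"
    using s by (simp add: scomp_sleg[OF n] LUn_nat)
  finally show "(scomp a b b \<cdot> (sleg b b [] \<boxtimes> Ide V (shom a b))) \<cdot> (Ide V (Unt V) \<boxtimes> sleg a b s)
    = LUn V (shom a b) \<cdot> (Ide V (Unt V) \<boxtimes> sleg a b s)" .
qed (fact category_axioms category_StrCat)+

lemma scomp_unit_right:
  assumes "a \<in> colimOb"
  shows "scomp a a b \<cdot> (Ide V (shom a b) \<boxtimes> sleg a a []) = RUn V (shom a b)"
proof (rule colimit_ext)
  have n: "is_string a a []" using assms by simp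
  let ?T = "tensor_right V (Unt V)"
  show "is_colimit_cocone (StrCat a b) V (func_comp ?T ev) (shom a b \<otimes> Unt V) (\<lambda>s. sleg a b s \<boxtimes> Ide V (Unt V))"
  proof -
    have "preserves_small_colimits \<kappa> V V ?T" using cocont by (simp add: tensor_cocontinuous_def)
    from preserves_colimit[OF bound this small_StrCat functor_ev shom_colimit]
    show ?thesis by (simp add: tensor_right_def)
  qed
  show "is_functor (StrCat a b) V (func_comp ?T ev)"
    using functor_ev[of a b] by (auto simp: is_functor_def func_comp_def tensor_right_def in_hom_def)
  show "in_hom V (scomp a a b \<cdot> (Ide V (shom a b) \<boxtimes> sleg a a [])) (shom a b \<otimes> Unt V) (shom a b)"
    "in_hom V (RUn V (shom a b)) (shom a b \<otimes> Unt V) (shom a b)"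
    using sleg_arr[OF n] by (auto simp: in_hom_def)
  fix s assume "s \<in> Obj (StrCat a b)"
  then have s: "is_string a b s" "valid s" by (auto intro: is_string_valid)
  have "(scomp a a b \<cdot> (Ide V (shom a b) \<boxtimes> sleg a a [])) \<cdot> (sleg a b s \<boxtimes> Ide V (Unt V))
      = scomp a a b \<cdot> (sleg a b s \<boxtimes> sleg a a [])"
    using s sleg_arr[OF n] by simp
  also have "\<dots> = RUn V (shom a b) \<cdot> (sleg a b s \<boxtimes> Ide V (Unt V))"
    using s by (simp add: scomp_sleg[OF _ n] RUn_nat)
  finally show "(scomp a a b \<cdot> (Ide V (shom a b) \<boxtimes> sleg a a [])) \<cdot> (sleg a b s \<boxtimes> Ide V (Unt V))
    = RUn V (shom a b) \<cdot> (sleg a b s \<boxtimes> Ide V (Unt V))" .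
qed (fact category_axioms category_StrCat)+

lemma enriched_colim_star: "enriched_category V colim_star"
  by unfold_locales
    (auto simp: in_hom_def scomp_assoc scomp_unit_left scomp_unit_right)

lemma colim_star_obj: "colim_star \<in> Obj (CatV \<kappa> V)"
  using enriched_colim_star small_colimOb by (simp add: CatV_def)


section \<open>The colimit cocone\<close>

definition inj_functor :: "'i \<Rightarrow> ('u, 'o, 'm) vfun" where
  "inj_functor i = \<lparr> vdom = FObj F i, vcod = colim_star,
     omap = \<lambda>x. if x \<in> vobj (FObj F i) then cls i x else undefined,
     hmap = \<lambda>x y. if x \<in> vobj (FObj F i) \<and> y \<in> vobj (FObj F i)
       then sleg (cls i x) (cls i y) [(i, x, y)] else undefined \<rparr>"

lemma inj_functor_simps [simp]:
  "vdom (inj_functor i) = FObj F i" "vcod (inj_functor i) = colim_star"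
  "x \<in> vobj (FObj F i) \<Longrightarrow> omap (inj_functor i) x = cls i x"
  "x \<in> vobj (FObj F i) \<Longrightarrow> y \<in> vobj (FObj F i) \<Longrightarrow> hmap (inj_functor i) x y = sleg (cls i x) (cls i y) [(i, x, y)]"
  by (auto simp: inj_functor_def)

text \<open>A primitive move with empty contexts is a generator, and empty contexts act trivially in
  \<open>sten\<close>. Insertions, contractions and transports thereby give the unit law, the
  composition law and the cocone condition for \<open>inj_functor\<close>.\<close>

lemma sleg_prim:
  assumes "is_prim p" "is_string a b (prim_src p)" "is_string a b (prim_tgt p)"
  shows "sleg a b (prim_tgt p) \<cdot> ev_prim p = sleg a b (prim_src p)"
proof -
  have g: "is_gen a b ([], p, [])" using assms by simp
  have "ev_gen ([], p, []) = ev_prim p"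
    using is_prim_hom[OF assms(1)] by (simp add: ev_gen_sten)
  then show ?thesis using sleg_gen[OF g] by simp
qed

lemma enriched_inj_functor:
  assumes i: "i \<in> Obj I"
  shows "enriched_functor V (inj_functor i)"
proof
  interpret Fi: enriched_category V "FObj F i" by (rule F_obj[OF i])
  fix a assume a: "a \<in> vobj (vdom (inj_functor i))"
  show "omap (inj_functor i) a \<in> vobj (vcod (inj_functor i))" using a i by simp
  show "hmap (inj_functor i) a a \<cdot> vunit (vdom (inj_functor i)) a
      = vunit (vcod (inj_functor i)) (omap (inj_functor i) a)"
    using sleg_prim[of "Insert i a" "cls i a" "cls i a"] a i by simp
  fix b assume b: "b \<in> vobj (vdom (inj_functor i))"
  show "in_hom V (hmap (inj_functor i) a b) (vhom (vdom (inj_functor i)) a b)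
      (vhom (vcod (inj_functor i)) (omap (inj_functor i) a) (omap (inj_functor i) b))"
    using a b i by (simp add: in_hom_def)
  fix c assume c: "c \<in> vobj (vdom (inj_functor i))"
  let ?s = "[(i, a, b)]" and ?t = "[(i, b, c)]"
  have str: "is_string (cls i a) (cls i b) ?s" "is_string (cls i b) (cls i c) ?t"
    "is_string (cls i a) (cls i c) (?t \<star> ?s)"
    using a b c i by auto
  have "sleg (cls i a) (cls i c) [(i, a, c)] \<cdot> vcomp (FObj F i) a b c
      = sleg (cls i a) (cls i c) (?t \<star> ?s)"
    using sleg_prim[of "Contract i a b c" "cls i a" "cls i c"] a b c i by simp
  \<comment> \<open>For one-edge strings \<open>theta\<close> is an identity, so composing their
    legs gives the leg of the concatenation itself.\<close>
  also have "\<dots> = scomp (cls i a) (cls i b) (cls i c)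
      \<cdot> (sleg (cls i b) (cls i c) ?t \<boxtimes> sleg (cls i a) (cls i b) ?s)"
    using sleg_arr[OF str(3)] a b c i Fi.vhom_in by (subst scomp_sleg[OF str(2,1)]) simp
  finally show "hmap (inj_functor i) a c \<cdot> vcomp (vdom (inj_functor i)) a b c =
     vcomp (vcod (inj_functor i)) (omap (inj_functor i) a) (omap (inj_functor i) b) (omap (inj_functor i) c)
       \<cdot> (hmap (inj_functor i) b c \<boxtimes> hmap (inj_functor i) a b)"
    using a b c by simp
qed (auto simp: inj_functor_def)

lemma CatV_hom:
  "in_hom (CatV \<kappa> V) G C D \<longleftrightarrow> enriched_category V C \<and> small \<kappa> (vobj C) \<and> enriched_category V D
     \<and> small \<kappa> (vobj D) \<and> enriched_functor V G \<and> vdom G = C \<and> vcod G = D"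
  by (auto simp: in_hom_def CatV_def)

lemma CatV_Cmp: "H \<cdot>\<^bsub>CatV \<kappa> V\<^esub> G = \<lparr> vdom = vdom G, vcod = vcod H,
        omap = \<lambda>a. if a \<in> vobj (vdom G) then omap H (omap G a) else undefined,
        hmap = \<lambda>a b. if a \<in> vobj (vdom G) \<and> b \<in> vobj (vdom G)
                     then hmap H (omap G a) (omap G b) \<cdot> hmap G a b else undefined \<rparr>"
  by (simp add: CatV_def)

lemma inj_functor_hom: "i \<in> Obj I \<Longrightarrow> in_hom (CatV \<kappa> V) (inj_functor i) (FObj F i) colim_star"
  unfolding CatV_hom
  using F_obj small_F_obj enriched_colim_star small_colimOb enriched_inj_functor by simp

lemma inj_functor_cocone: "is_cocone I (CatV \<kappa> V) F colim_star inj_functor"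
proof -
  have "inj_functor (Cod I f) \<cdot>\<^bsub>CatV \<kappa> V\<^esub> FArr F f = inj_functor (Dom I f)" if f: "f \<in> Arr I" for f
  proof -
    let ?i = "Dom I f" and ?j = "Cod I f"
    have "sleg (cls ?i x) (cls ?i y) [(?j, omap (FArr F f) x, omap (FArr F f) y)] \<cdot> hmap (FArr F f) x y
        = sleg (cls ?i x) (cls ?i y) [(?i, x, y)]"
      if "x \<in> vobj (FObj F ?i)" "y \<in> vobj (FObj F ?i)" for x y
      using sleg_prim[of "Transport f x y" "cls ?i x" "cls ?i y"] that f by simp
    then show ?thesis
      unfolding CatV_Cmp using f by (auto simp: inj_functor_def fun_eq_iff)
  qed
  then show ?thesis using colim_star_obj inj_functor_hom by (simp add: is_cocone_def)
qed

end


section \<open>The universal property\<close>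

locale string_cocone = string_diagram \<kappa> V I F
  for \<kappa> :: "'u rel" and V :: "('o, 'm) mcat" (structure) and I :: "('i, 'k) cat"
    and F :: "('i, 'k, ('u, 'o, 'm) vcat, ('u, 'o, 'm) vfun) func" +
  fixes E :: "('u, 'o, 'm) vcat" and \<delta> :: "'i \<Rightarrow> ('u, 'o, 'm) vfun"
  assumes cocone: "is_cocone I (CatV \<kappa> V) F E \<delta>"
begin

sublocale E: enriched_category V E
  using cocone by (simp add: is_cocone_def CatV_def)

lemma small_E: "small \<kappa> (vobj E)"
  using cocone by (simp add: is_cocone_def CatV_def)

lemma \<delta>_functor: "i \<in> Obj I \<Longrightarrow> enriched_functor V (\<delta> i)"
  and vdom_\<delta> [simp]: "i \<in> Obj I \<Longrightarrow> vdom (\<delta> i) = FObj F i"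
  and vcod_\<delta> [simp]: "i \<in> Obj I \<Longrightarrow> vcod (\<delta> i) = E"
  using cocone by (auto simp: is_cocone_def CatV_hom)

lemma \<delta>_nat: "f \<in> Arr I \<Longrightarrow> \<delta> (Cod I f) \<cdot>\<^bsub>CatV \<kappa> V\<^esub> FArr F f = \<delta> (Dom I f)"
  using cocone by (simp add: is_cocone_def)

lemma omap_\<delta> [simp]: "i \<in> Obj I \<Longrightarrow> x \<in> vobj (FObj F i) \<Longrightarrow> omap (\<delta> i) x \<in> vobj E"
  using enriched_functor.omap_in[OF \<delta>_functor] by simp

lemma hmap_\<delta>: "i \<in> Obj I \<Longrightarrow> x \<in> vobj (FObj F i) \<Longrightarrow> y \<in> vobj (FObj F i)
    \<Longrightarrow> in_hom V (hmap (\<delta> i) x y) (vhom (FObj F i) x y) (vhom E (omap (\<delta> i) x) (omap (\<delta> i) y))"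
  using enriched_functor.hmap_in_hom[OF \<delta>_functor] by simp

lemma \<delta>_nat_omap: "f \<in> Arr I \<Longrightarrow> x \<in> vobj (FObj F (Dom I f))
    \<Longrightarrow> omap (\<delta> (Cod I f)) (omap (FArr F f) x) = omap (\<delta> (Dom I f)) x"
  using \<delta>_nat[of f, unfolded CatV_Cmp, THEN arg_cong[of _ _ omap]] by (simp add: fun_eq_iff split: if_splits)

lemma \<delta>_nat_hmap: "f \<in> Arr I \<Longrightarrow> x \<in> vobj (FObj F (Dom I f)) \<Longrightarrow> y \<in> vobj (FObj F (Dom I f))
    \<Longrightarrow> hmap (\<delta> (Cod I f)) (omap (FArr F f) x) (omap (FArr F f) y) \<cdot> hmap (FArr F f) x y = hmap (\<delta> (Dom I f)) x y"
  using \<delta>_nat[of f, unfolded CatV_Cmp, THEN arg_cong[of _ _ "\<lambda>G. hmap G x y"]] by simp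

text \<open>It has to come from the universal property: \<open>colimOb\<close> is a chosen set,
  whose elements carry no preferred representation as \<open>cls i x\<close>.\<close>

definition ob_map :: "'u \<Rightarrow> 'u" where
  "ob_map = SFun (colim_map I (SetC \<kappa>) obF (vobj E) (\<lambda>i. FArr Ob_functor (\<delta> i)))"

lemma Ob_\<delta>_cocone: "is_cocone I (SetC \<kappa>) obF (vobj E) (\<lambda>i. FArr Ob_functor (\<delta> i))"
proof -
  have "FArr Ob_functor (\<delta> (Cod I f)) \<cdot>\<^bsub>SetC \<kappa>\<^esub> FArr obF f = FArr Ob_functor (\<delta> (Dom I f))"
    if f: "f \<in> Arr I" for f
  proof -
    have "omap (\<delta> (Dom I f)) x = undefined" if "x \<notin> vobj (FObj F (Dom I f))" for x
      using enriched_functor.omap_undefined[OF \<delta>_functor] that f by simp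
    then show ?thesis using f \<delta>_nat_omap by (auto simp: SetC_Cmp Ob_functor_def fun_eq_iff)
  qed
  then show ?thesis
    using small_E small_F_obj enriched_functor.omap_undefined[OF \<delta>_functor]
    by (auto simp: is_cocone_def SetC_hom Ob_functor_def) (simp add: SetC_def)
qed

lemma ob_map_hom: "in_hom (SetC \<kappa>) (colim_map I (SetC \<kappa>) obF (vobj E) (\<lambda>i. FArr Ob_functor (\<delta> i))) colimOb (vobj E)"
  and ob_map_cls [simp]: "i \<in> Obj I \<Longrightarrow> x \<in> vobj (FObj F i) \<Longrightarrow> ob_map (cls i x) = omap (\<delta> i) x"
proof -
  have ex: "is_colimit I (SetC \<kappa>) obF colimOb" using colimOb_colimit by (auto simp: is_colimit_def)
  note m = colim_map[OF ex Ob_\<delta>_cocone]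
  show "in_hom (SetC \<kappa>) (colim_map I (SetC \<kappa>) obF (vobj E) (\<lambda>i. FArr Ob_functor (\<delta> i))) colimOb (vobj E)"
    using m(1) by (simp add: colimOb_def)
  assume i: "i \<in> Obj I" and x: "x \<in> vobj (FObj F i)"
  have "SDom (colim_leg I (SetC \<kappa>) obF i) = vobj (FObj F i)"
    using colimOb_cocone i by (simp add: is_cocone_def SetC_hom)
  then show "ob_map (cls i x) = omap (\<delta> i) x"
    using m(2)[OF i, THEN arg_cong[of _ _ "\<lambda>f. SFun f x"]] x
    by (simp add: SetC_Cmp Ob_functor_def ob_map_def cls_def)
qed

lemma ob_map_in [simp]: "a \<in> colimOb \<Longrightarrow> ob_map a \<in> vobj E"
  using ob_map_hom by (simp add: SetC_hom ob_map_def)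

lemma ob_map_undefined: "a \<notin> colimOb \<Longrightarrow> ob_map a = undefined"
  using ob_map_hom by (simp add: SetC_hom ob_map_def)


text \<open>The end \<open>b\<close> is an argument because an empty string does not determine it
  and each composition names the final object. A single edge is a case of its own, as in
  \<open>ev_str\<close>, so that no unitor enters.\<close>

fun string_map :: "'u \<Rightarrow> ('i, 'u) strng \<Rightarrow> 'm" where
  "string_map b [] = vunit E (ob_map b)"
| "string_map b ((i, x, y) # s) = (if s = [] then hmap (\<delta> i) x y
     else vcomp E (omap (\<delta> i) x) (omap (\<delta> i) y) (ob_map b) \<cdot> (string_map b s \<boxtimes> hmap (\<delta> i) x y))"

lemma E_hom [simp]: "a \<in> vobj E \<Longrightarrow> b \<in> vobj E \<Longrightarrow> vhom E a b \<in> Obj V"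
  by (rule E.vhom_in)

lemma E_comp [simp]:
  assumes "a \<in> vobj E" "b \<in> vobj E" "c \<in> vobj E"
  shows "vcomp E a b c \<in> Arr V" "Dom V (vcomp E a b c) = vhom E b c \<otimes> vhom E a b"
    "Cod V (vcomp E a b c) = vhom E a c"
  using E.vcomp_in_hom[OF assms] by (auto simp: in_hom_def)

lemma E_unit [simp]:
  assumes "a \<in> vobj E"
  shows "vunit E a \<in> Arr V" "Dom V (vunit E a) = Unt V" "Cod V (vunit E a) = vhom E a a"
  using E.vunit_in_hom[OF assms] by (auto simp: in_hom_def)

lemma string_map_hom:
  "is_string a b s \<Longrightarrow> in_hom V (string_map b s) (ev_str s) (vhom E (ob_map a) (ob_map b))"
proof (induction s arbitrary: a)
  case (Cons e s)
  obtain i x y where e: "e = (i, x, y)" by (cases e)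
  with Cons.prems have s: "is_string (cls i y) b s" and i: "i \<in> Obj I"
    and xy: "x \<in> vobj (FObj F i)" "y \<in> vobj (FObj F i)" and a: "a = cls i x"
    by auto
  have "b \<in> colimOb" using is_string_ends[OF s] by simp
  then show ?case
    using Cons.IH[OF s] s hmap_\<delta>[OF i xy] i xy unfolding e a
    by (cases "s = []") (auto simp: in_hom_def)
qed (auto simp: in_hom_def)

lemma string_map_arr:
  assumes "is_string a b s"
  shows "string_map b s \<in> Arr V" "Dom V (string_map b s) = ev_str s"
    "Cod V (string_map b s) = vhom E (ob_map a) (ob_map b)"
  using string_map_hom[OF assms] by (auto simp: in_hom_def)

text \<open>Induction on \<open>s\<close> peels off its rightmost factor. An empty string on either
  side gives a unit law of \<open>E\<close>; otherwise the inverse associator in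
  \<open>theta\<close> is matched by associativity of composition in \<open>E\<close>.\<close>

lemma string_map_star:
  assumes "is_string a b s" "is_string b c t"
  shows "string_map c (t \<star> s) \<cdot> theta t s
    = vcomp E (ob_map a) (ob_map b) (ob_map c) \<cdot> (string_map c t \<boxtimes> string_map b s)"
  using assms(1)
proof (induction s arbitrary: a)
  case Nil
  then have a: "a = b" "a \<in> colimOb" by auto
  have c: "c \<in> colimOb" using is_string_ends[OF assms(2)] by simp
  note t = string_map_arr[OF assms(2)]
  have "vcomp E (ob_map b) (ob_map b) (ob_map c) \<cdot> (string_map c t \<boxtimes> vunit E (ob_map b))
      = (vcomp E (ob_map b) (ob_map b) (ob_map c) \<cdot> (Ide V (vhom E (ob_map b) (ob_map c)) \<boxtimes> vunit E (ob_map b)))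
         \<cdot> (string_map c t \<boxtimes> Ide V (Unt V))"
    using a c t by simp
  also have "\<dots> = string_map c t \<cdot> RUn V (ev_str t)"
    using a c t by (subst E.vunit_right) (auto simp: RUn_nat)
  finally show ?case using a by simp
next
  case (Cons e s)
  obtain i x y where e: "e = (i, x, y)" by (cases e)
  with Cons.prems have s: "is_string (cls i y) b s" and i: "i \<in> Obj I"
    and xy: "x \<in> vobj (FObj F i)" "y \<in> vobj (FObj F i)" and a: "a = cls i x"
    by auto
  have bc: "b \<in> colimOb" "c \<in> colimOb" using is_string_ends[OF assms(2)] by simp_all
  have ts: "is_string (cls i y) c (t \<star> s)" using s assms(2) by (auto intro: is_string_starI)
  note d = hmap_\<delta>[OF i xy, unfolded in_hom_def]
  note m = string_map_arr[OF assms(2)] string_map_arr[OF s] string_map_arr[OF Cons.prems] string_map_arr[OF ts]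
  have v: "valid t" "valid s" "is_edge e" using assms(2) Cons.prems is_string_valid by fastforce+
  have ob: "omap (\<delta> i) x \<in> vobj E" "omap (\<delta> i) y \<in> vobj E" "ob_map b \<in> vobj E" "ob_map c \<in> vobj E"
    "vhom (FObj F i) x y \<in> Obj V"
    using i xy bc ev_edge_obj[OF v(3)] e by auto
  show ?case
  proof (cases "t = []")
    case True
    then have b: "b = c" using assms(2) by simp
    have "vcomp E (ob_map a) (ob_map c) (ob_map c) \<cdot> (vunit E (ob_map c) \<boxtimes> string_map c (e # s))
      = (vcomp E (ob_map a) (ob_map c) (ob_map c) \<cdot> (vunit E (ob_map c) \<boxtimes> Ide V (vhom E (ob_map a) (ob_map c))))
         \<cdot> (Ide V (Unt V) \<boxtimes> string_map c (e # s))"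
      using m b bc a i xy by (simp del: string_map.simps(2))
    also have "\<dots> = string_map c (e # s) \<cdot> LUn V (ev_str (e # s))"
      using m b bc a i xy by (subst E.vunit_left) (auto simp: LUn_nat simp del: string_map.simps(2))
    finally show ?thesis using True b by (simp del: string_map.simps(2))
  next
    case t: False
    show ?thesis
    proof (cases "s = []")
      case True
      \<comment> \<open>For a single edge, \<open>theta t [e]\<close> is an identity and the claim
        is the defining recursion, once \<open>b\<close> is seen to be the class of
        \<open>y\<close>.\<close>
      with s have "b = cls i y" by simp
      then show ?thesis using True t a e i xy d m v ob by simp
    next
      case s_ne: False
      let ?x = "omap (\<delta> i) x" and ?y = "omap (\<delta> i) y" and ?b = "ob_map b" and ?c = "ob_map c"
      let ?T = "string_map c t" and ?S = "string_map b s" and ?e = "hmap (\<delta> i) x y"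
      let ?inv = "inv_arr V (Asc V (ev_str t) (ev_str s) (ev_edge e))"
      have "string_map c (t \<star> (e # s)) \<cdot> theta t (e # s)
          = vcomp E ?x ?y ?c \<cdot> (((string_map c (t \<star> s) \<cdot> theta t s) \<boxtimes> ?e) \<cdot> ?inv)"
        using t s_ne v e i xy d m ob by simp
      \<comment> \<open>After the induction hypothesis the composite brackets \<open>t\<close> with
        \<open>s\<close>; associativity in \<open>E\<close> rebrackets it and releases an
        associator, which cancels \<open>?inv\<close> by naturality.\<close>
      also have "\<dots> = (vcomp E ?x ?y ?c \<cdot> (vcomp E ?y ?b ?c \<boxtimes> Ide V (vhom E ?x ?y)))
          \<cdot> ((?T \<boxtimes> ?S \<boxtimes> ?e) \<cdot> ?inv)"
        unfolding Cons.IH[OF s] using v e i xy d m ob by simp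
      also have "\<dots> = vcomp E ?x ?b ?c \<cdot> ((Ide V (vhom E ?b ?c) \<boxtimes> vcomp E ?x ?y ?b) \<cdot>
          ((Asc V (vhom E ?b ?c) (vhom E ?y ?b) (vhom E ?x ?y) \<cdot> (?T \<boxtimes> ?S \<boxtimes> ?e)) \<cdot> ?inv))"
        using v e i xy d m ob by (subst E.vcomp_assoc) auto
      also have "\<dots> = vcomp E ?x ?b ?c \<cdot> ((Ide V (vhom E ?b ?c) \<boxtimes> vcomp E ?x ?y ?b) \<cdot> (?T \<boxtimes> (?S \<boxtimes> ?e)))"
        using v e i xy d m ob Asc_nat[of ?T ?S ?e] by simp
      finally show ?thesis
        using s_ne v e i xy d m ob a by simp
    qed
  qed
qed

lemma string_map_prim:
  assumes "is_prim p" "is_string a b (prim_src p)" "is_string a b (prim_tgt p)"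
  shows "string_map b (prim_tgt p) \<cdot> ev_prim p = string_map b (prim_src p)"
proof (cases p)
  case (Transport f x y)
  \<comment> \<open>This case is the cocone condition on hom-objects; the two others are
    functoriality of a single \<open>\<delta> i\<close>.\<close>
  then show ?thesis using assms by (simp add: \<delta>_nat_hmap)
next
  case (Contract i x y z)
  then have i: "i \<in> Obj I" using assms by simp
  show ?thesis using enriched_functor.hmap_comp[OF \<delta>_functor[OF i], of x y z] Contract assms
    by (auto simp: star_def)
next
  case (Insert i x)
  then have i: "i \<in> Obj I" using assms by simp
  show ?thesis using enriched_functor.hmap_unit[OF \<delta>_functor[OF i], of x] Insert assms by auto
qed

text \<open>Arrows compatible with \<open>string_map\<close> are closed under the strict tensor
  product. A generator is such a product of a primitive move and two identities, so only primitive
  moves need checking.\<close>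

lemma string_map_sten:
  assumes s: "is_string a b s" "is_string a b s'" and t: "is_string b c t" "is_string b c t'"
    and f: "str_hom t t' f" "string_map c t' \<cdot> f = string_map c t"
    and g: "str_hom s s' g" "string_map b s' \<cdot> g = string_map b s"
  shows "string_map c (t' \<star> s') \<cdot> sten t t' f s s' g = string_map c (t \<star> s)"
proof (rule iso_cancel_right[of "theta t s"])
  note st = is_string_starI[OF t(1) s(1)] is_string_starI[OF t(2) s(2)]
  note m = string_map_arr[OF s(1)] string_map_arr[OF s(2)] string_map_arr[OF t(1)]
    string_map_arr[OF t(2)] string_map_arr[OF st(1)] string_map_arr[OF st(2)]
  note h = f(1)[unfolded str_hom_def] g(1)[unfolded str_hom_def]
    str_hom_sten[OF f(1) g(1), unfolded str_hom_def]
  have ob: "ob_map a \<in> vobj E" "ob_map b \<in> vobj E" "ob_map c \<in> vobj E"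
    using is_string_ends[OF s(1)] is_string_ends[OF t(1)] by auto
  have "(string_map c (t' \<star> s') \<cdot> sten t t' f s s' g) \<cdot> theta t s
      = (string_map c (t' \<star> s') \<cdot> theta t' s') \<cdot> (f \<boxtimes> g)"
    using m h by (simp add: sten_theta[OF f(1) g(1)])
  also have "\<dots> = vcomp E (ob_map a) (ob_map b) (ob_map c) \<cdot> (string_map c t \<boxtimes> string_map b s)"
    unfolding string_map_star[OF s(2) t(2)] using m h ob f(2) g(2) by simp
  also have "\<dots> = string_map c (t \<star> s) \<cdot> theta t s"
    by (rule string_map_star[OF s(1) t(1), symmetric])
  finally show "(string_map c (t' \<star> s') \<cdot> sten t t' f s s' g) \<cdot> theta t s = string_map c (t \<star> s) \<cdot> theta t s" .
qed (use is_string_starI[OF t(1) s(1), THEN string_map_arr(1)] is_string_starI[OF t(1) s(1), THEN string_map_arr(2)]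
    is_string_starI[OF t(2) s(2), THEN string_map_arr(1)] is_string_starI[OF t(2) s(2), THEN string_map_arr(2)]
    str_hom_sten[OF f(1) g(1)] f(1) g(1) in \<open>auto simp: str_hom_def\<close>)

text \<open>The start is held fixed: for an empty string it is all that determines the end.\<close>

lemma is_string_end_unique: "is_string a b s \<Longrightarrow> is_string a b' s \<Longrightarrow> b = b'"
  by (induction s arbitrary: a) auto

lemma is_string_start_unique: "is_string a b s \<Longrightarrow> is_string a' b s \<Longrightarrow> a = a'"
  by (cases s) auto

lemma string_map_gen:
  assumes "is_gen a b g"
  shows "string_map b (gen_tgt g) \<cdot> ev_gen g = string_map b (gen_src g)"
proof (cases g)
  case (fields u p v)
  have p: "is_prim p" "is_string a b (u \<star> prim_src p \<star> v)" "is_string a b (u \<star> prim_tgt p \<star> v)"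
    using assms fields by auto
  obtain c1 c2 where src: "is_string a c1 v" "is_string c1 c2 (prim_src p)" "is_string c2 b u"
    using p(2) by (auto simp: is_string_star)
  \<comment> \<open>The target splits at objects of its own; they agree with \<open>c1\<close> and
    \<open>c2\<close>, because the contexts \<open>v\<close> and \<open>u\<close> are shared with
    the source.\<close>
  have tgt: "is_string c1 c2 (prim_tgt p)"
  proof -
    obtain d1 d2 where "is_string a d1 v" "is_string d1 d2 (prim_tgt p)" "is_string d2 b u"
      using p(3) by (auto simp: is_string_star)
    then show ?thesis using src is_string_end_unique is_string_start_unique by metis
  qed
  have m: "string_map c2 (prim_tgt p) \<cdot> ev_prim p = string_map c2 (prim_src p)"
    by (rule string_map_prim[OF p(1) src(2) tgt])
  have v: "valid u" "valid v" using src is_string_valid by blast+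
  have i: "string_map c1 v \<cdot> Ide V (ev_str v) = string_map c1 v"
    "string_map b u \<cdot> Ide V (ev_str u) = string_map b u"
    using string_map_arr[OF src(1)] string_map_arr[OF src(3)] by simp_all
  have "string_map c2 (prim_tgt p \<star> v) \<cdot> sten (prim_src p) (prim_tgt p) (ev_prim p) v v (Ide V (ev_str v))
      = string_map c2 (prim_src p \<star> v)"
    by (rule string_map_sten[OF src(1,1,2) tgt is_prim_hom[OF p(1)] m str_hom_Ide[OF v(2)] i(1)])
  from string_map_sten[OF is_string_starI[OF src(2,1)] is_string_starI[OF tgt src(1)] src(3,3)
      str_hom_Ide[OF v(1)] i(2) str_hom_sten[OF is_prim_hom[OF p(1)] str_hom_Ide[OF v(2)]] this]
  show ?thesis using fields by (simp add: ev_gen_sten)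
qed

section \<open>The induced enriched functor and its uniqueness\<close>

definition hom_map :: "'u \<Rightarrow> 'u \<Rightarrow> 'm" where
  "hom_map a b = colim_map (StrCat a b) V ev (vhom E (ob_map a) (ob_map b)) (string_map b)"

lemma hom_map_hom: "a \<in> colimOb \<Longrightarrow> b \<in> colimOb
    \<Longrightarrow> in_hom V (hom_map a b) (shom a b) (vhom E (ob_map a) (ob_map b))"
  and hom_map_sleg: "is_string a b s \<Longrightarrow> hom_map a b \<cdot> sleg a b s = string_map b s"
proof -
  have co: "is_cocone (StrCat a b) V ev (vhom E (ob_map a) (ob_map b)) (string_map b)"
    if "a \<in> colimOb" "b \<in> colimOb"
    using that string_map_hom string_map_gen by (simp add: ev_cocone_iff)
  obtain c where ex: "is_colimit (StrCat a b) V ev c" using ex_colimit by blast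
  note m = colim_map[OF ex co, folded hom_map_def shom_def sleg_def]
  show "a \<in> colimOb \<Longrightarrow> b \<in> colimOb \<Longrightarrow> in_hom V (hom_map a b) (shom a b) (vhom E (ob_map a) (ob_map b))"
    by (rule m(1))
  show "is_string a b s \<Longrightarrow> hom_map a b \<cdot> sleg a b s = string_map b s"
    using m(2) is_string_ends by simp
qed

lemma hom_map_arr [simp]:
  assumes "a \<in> colimOb" "b \<in> colimOb"
  shows "hom_map a b \<in> Arr V" "Dom V (hom_map a b) = shom a b"
    "Cod V (hom_map a b) = vhom E (ob_map a) (ob_map b)"
  using hom_map_hom[OF assms] by (auto simp: in_hom_def)

definition univ_functor :: "('u, 'o, 'm) vfun" where
  "univ_functor = \<lparr> vdom = colim_star, vcod = E, omap = ob_map,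
     hmap = \<lambda>a b. if a \<in> colimOb \<and> b \<in> colimOb then hom_map a b else undefined \<rparr>"

lemma hom_map_comp:
  assumes "a \<in> colimOb" "b \<in> colimOb" "c \<in> colimOb"
  shows "hom_map a c \<cdot> scomp a b c
    = vcomp E (ob_map a) (ob_map b) (ob_map c) \<cdot> (hom_map b c \<boxtimes> hom_map a b)" (is "?l = ?r")
proof (rule shom2_ext)
  fix t s assume t: "is_string b c t" and s: "is_string a b s"
  have ts: "is_string a c (t \<star> s)" using t s by (rule is_string_starI)
  have v: "valid t" "valid s" using s t is_string_valid by blast+
  have "?l \<cdot> (sleg b c t \<boxtimes> sleg a b s) = (hom_map a c \<cdot> sleg a c (t \<star> s)) \<cdot> theta t s"
    using assms t s ts v by (simp add: scomp_sleg)
  also have "\<dots> = vcomp E (ob_map a) (ob_map b) (ob_map c) \<cdot> (string_map c t \<boxtimes> string_map b s)"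
    unfolding hom_map_sleg[OF ts] by (rule string_map_star[OF s t])
  also have "\<dots> = ?r \<cdot> (sleg b c t \<boxtimes> sleg a b s)"
    using assms t s by (simp add: hom_map_sleg)
  finally show "?l \<cdot> (sleg b c t \<boxtimes> sleg a b s) = ?r \<cdot> (sleg b c t \<boxtimes> sleg a b s)" .
qed (use assms in \<open>auto simp: in_hom_def\<close>)

lemma univ_functor_hom: "in_hom (CatV \<kappa> V) univ_functor colim_star E"
proof -
  have "enriched_functor V univ_functor"
    by unfold_locales
      (auto simp: univ_functor_def hom_map_comp hom_map_sleg ob_map_undefined hom_map_hom)
  then show ?thesis
    using enriched_colim_star small_colimOb small_E E.enriched_category_axioms
    by (simp add: CatV_hom univ_functor_def)
qed

text \<open>On hom-objects this is \<open>string_map\<close> on one-edge strings; equality of the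
  records also rests on the default value \<open>undefined\<close> outside the object set.\<close>

lemma univ_functor_inj:
  assumes i: "i \<in> Obj I"
  shows "univ_functor \<cdot>\<^bsub>CatV \<kappa> V\<^esub> inj_functor i = \<delta> i"
proof -
  have "hom_map (cls i x) (cls i y) \<cdot> sleg (cls i x) (cls i y) [(i, x, y)] = hmap (\<delta> i) x y"
    if "x \<in> vobj (FObj F i)" "y \<in> vobj (FObj F i)" for x y
    using hom_map_sleg[of "cls i x" "cls i y" "[(i, x, y)]"] that i by simp
  then show ?thesis
    unfolding CatV_Cmp
    using i enriched_functor.omap_undefined[OF \<delta>_functor[OF i]] enriched_functor.hmap_undefined[OF \<delta>_functor[OF i]]
    by (intro vfun.equality) (auto simp: univ_functor_def inj_functor_def fun_eq_iff)
qed

lemma univ_functor_unique: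
  assumes K: "in_hom (CatV \<kappa> V) K colim_star E"
    and inj: "\<And>i. i \<in> Obj I \<Longrightarrow> K \<cdot>\<^bsub>CatV \<kappa> V\<^esub> inj_functor i = \<delta> i"
  shows "K = univ_functor"
proof -
  interpret K: enriched_functor V K using K by (simp add: CatV_hom)
  have K_simps [simp]: "vdom K = colim_star" "vcod K = E" using K by (auto simp: CatV_hom)
  have K_omap: "omap K (cls i x) = omap (\<delta> i) x" if "i \<in> Obj I" "x \<in> vobj (FObj F i)" for i x
    using inj[OF that(1), unfolded CatV_Cmp, THEN arg_cong[of _ _ "\<lambda>G. omap G x"]] that by simp
  have K_hmap: "hmap K (cls i x) (cls i y) \<cdot> sleg (cls i x) (cls i y) [(i, x, y)] = hmap (\<delta> i) x y"
    if "i \<in> Obj I" "x \<in> vobj (FObj F i)" "y \<in> vobj (FObj F i)" for i x y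
    using inj[OF that(1), unfolded CatV_Cmp, THEN arg_cong[of _ _ "\<lambda>G. hmap G x y"]] that by simp
  let ?h = "colim_map I (SetC \<kappa>) obF (vobj E) (\<lambda>i. FArr Ob_functor (\<delta> i))"
  \<comment> \<open>Agreement on classes suffices, by uniqueness for the colimit of object sets; the
    comparison is made in \<open>SetC\<close>, where that uniqueness is available.\<close>
  have "FArr Ob_functor K = ?h"
  proof (rule colimit_ext[OF colimOb_colimit functor_obF category_SetC category_I _ ob_map_hom])
    show "in_hom (SetC \<kappa>) (FArr Ob_functor K) colimOb (vobj E)"
      using K.omap_in K.omap_undefined small_E small_colimOb by (auto simp: SetC_hom Ob_functor_def)
    fix i assume i: "i \<in> Obj I"
    have l: "SDom (colim_leg I (SetC \<kappa>) obF i) = vobj (FObj F i)"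
      using colimOb_cocone i by (simp add: is_cocone_def SetC_hom)
    have "?h \<cdot>\<^bsub>SetC \<kappa>\<^esub> colim_leg I (SetC \<kappa>) obF i = FArr Ob_functor (\<delta> i)"
      using colim_map(2)[OF _ Ob_\<delta>_cocone i] colimOb_colimit by (auto simp: is_colimit_def)
    also have "\<dots> = FArr Ob_functor K \<cdot>\<^bsub>SetC \<kappa>\<^esub> colim_leg I (SetC \<kappa>) obF i"
      using i l K_omap enriched_functor.omap_undefined[OF \<delta>_functor[OF i]]
      by (auto simp: SetC_Cmp Ob_functor_def cls_def fun_eq_iff)
    finally show "FArr Ob_functor K \<cdot>\<^bsub>SetC \<kappa>\<^esub> colim_leg I (SetC \<kappa>) obF i
      = ?h \<cdot>\<^bsub>SetC \<kappa>\<^esub> colim_leg I (SetC \<kappa>) obF i" by simp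
  qed
  from arg_cong[OF this, of SFun] have om: "omap K = ob_map"
    by (simp add: ob_map_def Ob_functor_def)
  have K_arr: "hmap K a b \<in> Arr V" "Dom V (hmap K a b) = shom a b"
    "Cod V (hmap K a b) = vhom E (ob_map a) (ob_map b)" if "a \<in> colimOb" "b \<in> colimOb" for a b
    using K.hmap_in_hom[of a b] that om by (auto simp: in_hom_def)
  \<comment> \<open>The cocone condition fixes \<open>K\<close> on one-edge strings. Preservation of
    units and composition extends this to all strings, since the leg at \<open>[]\<close> is a unit
    and the leg at \<open>e # s\<close> is the composite of those at \<open>s\<close> and
    \<open>[e]\<close>.\<close>
  have K_sleg: "hmap K a b \<cdot> sleg a b s = string_map b s" if "is_string a b s" for a b s
    using that
  proof (induction s arbitrary: a)
    case Nil
    then show ?case using K.hmap_unit[of a] om by auto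
  next
    case (Cons e s)
    obtain i x y where e: "e = (i, x, y)" by (cases e)
    with Cons.prems have s: "is_string (cls i y) b s" and i: "i \<in> Obj I"
      and xy: "x \<in> vobj (FObj F i)" "y \<in> vobj (FObj F i)" and a: "a = cls i x"
      by auto
    have ab: "a \<in> colimOb" "b \<in> colimOb" using is_string_ends[OF Cons.prems] by auto
    show ?case
    proof (cases "s = []")
      case True
      then show ?thesis using s K_hmap[OF i xy] e a by simp
    next
      case False
      have es: "is_string (cls i x) (cls i y) [e]" using e i xy by simp
      have y: "cls i y \<in> colimOb" using i xy by simp
      note arr = K_arr[OF ab] K_arr[OF y ab(2)] K_arr[OF ab(1) y] sleg_arr[OF Cons.prems] sleg_arr[OF s] sleg_arr[OF es]
      have "sleg a b (e # s) = scomp a (cls i y) b \<cdot> (sleg (cls i y) b s \<boxtimes> sleg a (cls i y) [e])"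
        using False s es arr a is_string_valid[OF Cons.prems]
        by (subst scomp_sleg) auto
      then have "hmap K a b \<cdot> sleg a b (e # s)
          = (hmap K a b \<cdot> scomp a (cls i y) b) \<cdot> (sleg (cls i y) b s \<boxtimes> sleg a (cls i y) [e])"
        using arr a by simp
      also have "\<dots> = vcomp E (ob_map a) (ob_map (cls i y)) (ob_map b) \<cdot>
          ((hmap K (cls i y) b \<cdot> sleg (cls i y) b s) \<boxtimes> (hmap K a (cls i y) \<cdot> sleg a (cls i y) [e]))"
        using K.hmap_comp[of a "cls i y" b] om ab y arr a by simp
      also have "\<dots> = string_map b (e # s)"
        using Cons.IH[OF s] K_hmap[OF i xy] e a False i xy by simp
      finally show ?thesis .
    qed
  qed
  have "hmap K a b = hom_map a b" if "a \<in> colimOb" "b \<in> colimOb" for a b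
    by (rule shom_ext[of _ a b "vhom E (ob_map a) (ob_map b)"])
       (use K_arr that K_sleg hom_map_sleg in \<open>auto simp: in_hom_def\<close>)
  then have "hmap K = hmap univ_functor"
    using K.hmap_undefined by (auto simp: univ_functor_def fun_eq_iff)
  then show ?thesis using om by (intro vfun.equality) (auto simp: univ_functor_def)
qed

end

context string_diagram
begin

lemma colim_star_colimit: "is_colimit_cocone I (CatV \<kappa> V) F colim_star inj_functor"
  unfolding is_colimit_cocone_def
proof (intro conjI allI impI inj_functor_cocone)
  fix E \<delta> assume "is_cocone I (CatV \<kappa> V) F E \<delta>"
  then interpret string_cocone \<kappa> V I F E \<delta> by unfold_locales
  show "\<exists>!H. in_hom (CatV \<kappa> V) H colim_star E \<and> (\<forall>i\<in>Obj I. H \<cdot>\<^bsub>CatV \<kappa> V\<^esub> inj_functor i = \<delta> i)"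
  proof (rule ex1I)
    show "in_hom (CatV \<kappa> V) univ_functor colim_star E
        \<and> (\<forall>i\<in>Obj I. univ_functor \<cdot>\<^bsub>CatV \<kappa> V\<^esub> inj_functor i = \<delta> i)"
      using univ_functor_hom univ_functor_inj by blast
  next
    fix H assume "in_hom (CatV \<kappa> V) H colim_star E \<and> (\<forall>i\<in>Obj I. H \<cdot>\<^bsub>CatV \<kappa> V\<^esub> inj_functor i = \<delta> i)"
    then show "H = univ_functor" by (intro univ_functor_unique) auto
  qed
qed

end

theorem theorem4p14:
  fixes \<kappa> :: "'u rel"
    and V :: "('o, 'm) mcat"
    and I :: "('i, 'k) cat"
    and F :: "('i, 'k, ('u, 'o, 'm) vcat, ('u, 'o, 'm) vfun) func"
  assumes "size_bound \<kappa>"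
    and "monoidal_category V"
    and "cocomplete \<kappa> V"
    and "tensor_cocontinuous \<kappa> V"
    and "small_category \<kappa> I"
    and "is_functor I (CatV \<kappa> V) F"
  shows "is_colimit I (CatV \<kappa> V) F (string_construction.colim_star \<kappa> V I F)"
proof -
  interpret monoidal_category V by fact
  interpret string_diagram \<kappa> V I F by unfold_locales fact+
  show ?thesis using colim_star_colimit unfolding is_colimit_def by blast
qed

end
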